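(* Let $(X,\omega)$, $(L_p,h_p)$, $A_p$ and $d_p=\dim H^0_{(2)}(X,L_p)$ be as described in the context. Let $\{a_j^p\}_{j=1}^{d_p}$, $p\ge1$, be an array of i.i.d. complex valued random variables whose distribution law $\boldsymbol P$ has density $\phi$ (with respect to Lebesgue measure on $\mathbb C$), such that $\phi:\mathbb C\to[0,M]$ is a bounded function and there exist $c>0$, $\rho>1$ with $$\boldsymbol P(\{z\in\mathbb C:\log|z|>R\})\le\frac c{R^\rho}\,,\quad\forall\,R\ge1 .$$ Let $\sigma_p$ be the $d_p$-fold product measure on $\mathbb C^{d_p}$ induced by $\boldsymbol P$. Then for any $1\le\nu<\rho$ there is a constant $\Gamma=\Gamma(M,c,\rho,\nu)>0$ such that, with $C_p=\Gamma d_p^{\nu/\rho}$, for every $p\ge1$, $$\int_{\mathbb C^{d_p}}\big|\log|\langle a,u\rangle|\,\big|^\nu\,d\sigma_p(a)\le C_p\quad\text{for any } u\in\mathbb C^{d_p}\text{ with }\|u\|=1 .\qquad( * )$$ In particular, if $d_p=O(A_p^N)$ for some $N\in\mathbb N$ and $\rho>N$, then for any $1\le\nu<\rho$ the measures $\sigma_p$ satisfy $( * )$ with constants $C_p=O(A_p^{N\nu/\rho})=o(A_p^\nu)$.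
   Context: $\langle a,u\rangle=\sum_j a_ju_j$. Setting: $(X,\omega)$ is a compact (reduced) normal Kähler space of pure dimension $n$, with regular locus $X_{\rm reg}$ and singular locus $X_{\rm sing}$; $(L_p,h_p)$, $p\ge1$, are holomorphic line bundles on $X$ with singular Hermitian metrics whose curvature currents satisfy $c_1(L_p,h_p)\ge a_p\omega$ on $X$ with $a_p>0$, $a_p\to\infty$; $A_p:=\int_Xc_1(L_p,h_p)\wedge\omega^{n-1}$ (so $A_p\ge a_p\int_X\omega^n\to\infty$); if $X_{\rm sing}\ne\emptyset$, there exists a positive closed $(1,1)$ current $T_0$ on $X$ with local psh potentials such that $c_1(L_p,h_p)\le A_pT_0$ for all $p\ge1$. $H^0_{(2)}(X,L_p)$ is the finite dimensional space of holomorphic sections $S$ of $L_p$ with $\int_{X_{\rm reg}}|S|^2_{h_p}\omega^n/n!<\infty$. Here a singular Hermitian metric $h$ is given by $|e|_h=e^{-\varphi}$, $\varphi\in L^1_{loc}$, for local holomorphic frames $e$, and $c_1(L,h)=dd^c\varphi$ with $d^c=\frac1{2\pi i}(\partial-\overline\partial)$; a Kähler form on $X$ is a positive closed $(1,1)$ current with local psh potentials that extend to smooth strictly psh functions in local embeddings of $X$ to Euclidean spaces. Through an orthonormal basis $(S_j^p)_{j=1}^{d_p}$ of $H^0_{(2)}(X,L_p)$, $\sigma_p$ is the law of the random section $s_p=\sum_{j=1}^{d_p}a_j^pS_j^p$. *)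

theory Defs
  imports "HOL-Probability.Probability" "HOL-Library.Landau_Symbols" "HOL-Library.Function_Algebras"
begin

section \<open>Calculus in several complex variables\<close>

fun C_k_on :: "nat \<Rightarrow> 'a::real_normed_vector set \<Rightarrow> ('a \<Rightarrow> 'b::real_normed_vector) \<Rightarrow> bool" where
  "C_k_on 0 W f \<longleftrightarrow> continuous_on W f"
| "C_k_on (Suc k) W f \<longleftrightarrow>
     (\<forall>z\<in>W. f differentiable (at z)) \<and> (\<forall>v. C_k_on k W (\<lambda>z. frechet_derivative f (at z) v))"

text \<open>Meant for open \<open>W\<close>.\<close>

definition smooth_on :: "'a::real_normed_vector set \<Rightarrow> ('a \<Rightarrow> 'b::real_normed_vector) \<Rightarrow> bool" where
  "smooth_on W f \<longleftrightarrow> (\<forall>k. C_k_on k W f)"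

text \<open>The Wirtinger derivatives \<open>\<partial>/\<partial>z\<^sub>j\<close> and \<open>\<partial>/\<partial>(cnj z\<^sub>j)\<close>.\<close>

definition dz :: "'n::finite \<Rightarrow> (complex^'n \<Rightarrow> complex) \<Rightarrow> complex^'n \<Rightarrow> complex" where
  "dz j f z = (frechet_derivative f (at z) (axis j 1) - \<i> * frechet_derivative f (at z) (axis j \<i>)) / 2"

definition dzbar :: "'n::finite \<Rightarrow> (complex^'n \<Rightarrow> complex) \<Rightarrow> complex^'n \<Rightarrow> complex" where
  "dzbar j f z = (frechet_derivative f (at z) (axis j 1) + \<i> * frechet_derivative f (at z) (axis j \<i>)) / 2"

definition holo_on :: "(complex^'n) set \<Rightarrow> (complex^'n \<Rightarrow> complex) \<Rightarrow> bool" where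
  "holo_on W f \<longleftrightarrow> open W \<and> smooth_on W f \<and> (\<forall>z\<in>W. \<forall>j. dzbar j f z = 0)"

definition holo_map :: "(complex^'n) set \<Rightarrow> (complex^'n \<Rightarrow> complex^'k) \<Rightarrow> bool" where
  "holo_map W F \<longleftrightarrow> (\<forall>i. holo_on W (\<lambda>z. F z $ i))"

text \<open>With \<open>d\<^sup>c = (\<partial> - \<partial>bar) / (2 \<pi> i)\<close> one has \<open>dd\<^sup>c = (i/\<pi>) \<partial>\<partial>bar\<close>.  A real \<open>(1,1)\<close>-form is
  written \<open>i \<Sum>\<^sub>j\<^sub>k H\<^sub>j\<^sub>k dz\<^sub>j \<and> dzbar\<^sub>k\<close> and identified with its Hermitian matrix \<open>H\<close>; the matrix of
  \<open>dd\<^sup>c u\<close> for smooth \<open>u\<close> is therefore the following.\<close>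

definition ddc :: "(complex^'n \<Rightarrow> real) \<Rightarrow> complex^'n \<Rightarrow> complex^'n^'n" where
  "ddc u z = (\<chi> j k. dz j (dzbar k (\<lambda>x. complex_of_real (u x))) z / of_real pi)"

definition herm_form :: "complex^'n^'n \<Rightarrow> complex^'n \<Rightarrow> complex" where
  "herm_form H w = (\<Sum>j\<in>UNIV. \<Sum>k\<in>UNIV. H $ j $ k * w $ j * cnj (w $ k))"

definition smooth_strictly_psh_on :: "(complex^'n) set \<Rightarrow> (complex^'n \<Rightarrow> real) \<Rightarrow> bool" where
  "smooth_strictly_psh_on W u \<longleftrightarrow>
     open W \<and> smooth_on W u \<and> (\<forall>z\<in>W. \<forall>w. w \<noteq> 0 \<longrightarrow> Re (herm_form (ddc u z) w) > 0)"

text \<open>The last condition is the submean value inequality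
  \<open>v a \<le> (1/2\<pi>) \<integral> v (a + e\<^sup>i\<^sup>t b) dt\<close> on closed discs, written for the nonnegative function \<open>C - v\<close>
  with \<open>C\<close> an upper bound of \<open>v\<close> on the disc.\<close>

definition psh_on :: "(complex^'n) set \<Rightarrow> (complex^'n \<Rightarrow> ereal) \<Rightarrow> bool" where
  "psh_on W v \<longleftrightarrow> open W \<and> (\<forall>z\<in>W. v z < \<infinity>) \<and> (\<forall>c. open {z\<in>W. v z < c}) \<and>
     (\<forall>a b. \<forall>C::real. (\<forall>\<zeta>. cmod \<zeta> \<le> 1 \<longrightarrow> a + \<zeta> *s b \<in> W \<and> v (a + \<zeta> *s b) \<le> ereal C) \<longrightarrow>
        (\<integral>\<^sup>+ t. e2ennreal (ereal C - v (a + cis t *s b)) * indicator {0..2*pi} t \<partial>lborel)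
          \<le> ennreal (2 * pi) * e2ennreal (ereal C - v a))"

definition analytic_subset :: "(complex^'m) set \<Rightarrow> (complex^'m) set \<Rightarrow> bool" where
  "analytic_subset D A \<longleftrightarrow> open D \<and> A \<subseteq> D \<and>
     (\<forall>z\<in>D. \<exists>W fs. open W \<and> z \<in> W \<and> W \<subseteq> D \<and> finite fs \<and> (\<forall>f\<in>fs. holo_on W f) \<and>
        A \<inter> W = {w\<in>W. \<forall>f\<in>fs. f w = 0})"


section \<open>Reduced complex spaces\<close>

text \<open>A reduced complex space is given by an atlas of local embeddings \<open>(E, \<tau>)\<close> onto analytic
  subsets of open subsets of a complex number space, with holomorphic transition maps.  For a
  compact space finitely many charts suffice, so (padding by zero coordinates) one ambient space
  \<open>complex^'m\<close> for all charts is no restriction.\<close>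

type_synonym ('a, 'm) atlas = "('a set \<times> ('a \<Rightarrow> complex^'m)) set"

definition local_embedding :: "'a topology \<Rightarrow> 'a set \<Rightarrow> ('a \<Rightarrow> complex^'m) \<Rightarrow> bool" where
  "local_embedding X E \<tau> \<longleftrightarrow> openin X E \<and>
     homeomorphic_map (subtopology X E) (top_of_set (\<tau> ` E)) \<tau> \<and> (\<exists>D. analytic_subset D (\<tau> ` E))"

definition reduced_complex_space :: "'a topology \<Rightarrow> ('a, 'm::finite) atlas \<Rightarrow> bool" where
  "reduced_complex_space X \<A> \<longleftrightarrow> Hausdorff_space X \<and>
     (\<forall>(E, \<tau>)\<in>\<A>. local_embedding X E \<tau>) \<and> \<Union>(fst ` \<A>) = topspace X \<and>
     (\<forall>(E, \<tau>)\<in>\<A>. \<forall>(E', \<tau>')\<in>\<A>. \<forall>x\<in>E \<inter> E'.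
        \<exists>W F. holo_map W F \<and> \<tau> x \<in> W \<and> (\<forall>y\<in>E \<inter> E'. \<tau> y \<in> W \<longrightarrow> \<tau>' y = F (\<tau> y)))"

text \<open>\<open>f\<close> is, near every point of the open set \<open>V\<close>, the restriction of a function with property
  \<open>P\<close> on an open set of the ambient space of a local embedding.\<close>

definition locally_extends ::
  "'a topology \<Rightarrow> ('a, 'm::finite) atlas \<Rightarrow> ((complex^'m) set \<Rightarrow> (complex^'m \<Rightarrow> 'b) \<Rightarrow> bool)
     \<Rightarrow> 'a set \<Rightarrow> ('a \<Rightarrow> 'b) \<Rightarrow> bool" where
  "locally_extends X \<A> P V f \<longleftrightarrow> openin X V \<and>
     (\<forall>x\<in>V. \<exists>(E, \<tau>)\<in>\<A>. x \<in> E \<and>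
        (\<exists>W F. open W \<and> \<tau> x \<in> W \<and> P W F \<and> (\<forall>y\<in>V \<inter> E. \<tau> y \<in> W \<longrightarrow> f y = F (\<tau> y))))"

abbreviation holo_fun :: "'a topology \<Rightarrow> ('a, 'm::finite) atlas \<Rightarrow> 'a set \<Rightarrow> ('a \<Rightarrow> complex) \<Rightarrow> bool" where
  "holo_fun X \<A> \<equiv> locally_extends X \<A> holo_on"

text \<open>All biholomorphic coordinate maps from open subsets of \<open>X\<close> onto open subsets of \<open>complex^'n\<close>.
  The points of \<open>X\<close> covered by them are those near which \<open>X\<close> is an \<open>n\<close>-dimensional manifold.\<close>

definition coord_maps :: "'a topology \<Rightarrow> ('a, 'm::finite) atlas \<Rightarrow> ('a, 'n::finite) atlas" where
  "coord_maps X \<A> = {(V, \<psi>). openin X V \<and> open (\<psi> ` V) \<and>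
     homeomorphic_map (subtopology X V) (top_of_set (\<psi> ` V)) \<psi> \<and>
     (\<forall>i. holo_fun X \<A> V (\<lambda>x. \<psi> x $ i)) \<and>
     (\<forall>(E, \<tau>)\<in>\<A>. holo_map (\<psi> ` (V \<inter> E)) (\<lambda>z. \<tau> (inv_into V \<psi> z)))}"

definition covered :: "('a, 'n) atlas \<Rightarrow> 'a set" where
  "covered \<R> = \<Union>(fst ` \<R>)"

text \<open>Normality: weakly holomorphic functions (holomorphic on the regular part and locally bounded)
  are holomorphic.\<close>

definition normal_space_wrt :: "'a topology \<Rightarrow> ('a, 'm::finite) atlas \<Rightarrow> 'a set \<Rightarrow> bool" where
  "normal_space_wrt X \<A> Xreg \<longleftrightarrow>
     (\<forall>V f. openin X V \<and> holo_fun X \<A> (V \<inter> Xreg) f \<and>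
        (\<forall>x\<in>V. \<exists>V' C. openin X V' \<and> x \<in> V' \<and> V' \<subseteq> V \<and> (\<forall>y\<in>V' \<inter> Xreg. cmod (f y) \<le> C)) \<longrightarrow>
        (\<exists>g. holo_fun X \<A> V g \<and> (\<forall>x\<in>V \<inter> Xreg. g x = f x)))"


section \<open>Currents with local potentials\<close>

text \<open>A closed \<open>(1,1)\<close>-current which is locally \<open>dd\<^sup>c u\<close> with \<open>u\<close> locally integrable is given by a
  set of pairs \<open>(U, u)\<close> of local potentials.  Only the values of \<open>u\<close> on \<open>U\<close>, up to null sets, matter.
  Currents are tested in the coordinate maps \<open>\<R>\<close>, that is, on the regular part.  On a normal space
  this decides inequalities between them also on the whole space: if \<open>dd\<^sup>c (u - v) \<ge> 0\<close> on the
  regular part, then \<open>u - v\<close> is almost everywhere equal to a function which is psh on the regular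
  part, and such functions extend to psh functions (Grauert and Remmert).\<close>

type_synonym 'a potentials = "('a set \<times> ('a \<Rightarrow> real)) set"

definition in_coord :: "'a set \<Rightarrow> ('a \<Rightarrow> complex^'n) \<Rightarrow> ('a \<Rightarrow> 'b) \<Rightarrow> complex^'n \<Rightarrow> 'b" where
  "in_coord V \<psi> u = (\<lambda>z. u (inv_into V \<psi> z))"

definition compact_support_in :: "(complex^'n) set \<Rightarrow> (complex^'n \<Rightarrow> 'b::zero) \<Rightarrow> bool" where
  "compact_support_in W f \<longleftrightarrow> (\<exists>K. compact K \<and> K \<subseteq> W \<and> (\<forall>z. z \<notin> K \<longrightarrow> f z = 0))"

text \<open>Test forms of bidegree \<open>(n-1,n-1)\<close> are encoded by matrix functions \<open>B\<close>, such that the form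
  \<open>\<beta>\<close> corresponding to \<open>B\<close> satisfies \<open>(i \<Sum>\<^sub>j\<^sub>k H\<^sub>j\<^sub>k dz\<^sub>j \<and> dzbar\<^sub>k) \<and> \<beta> = (\<Sum>\<^sub>j\<^sub>k H\<^sub>j\<^sub>k B\<^sub>j\<^sub>k) d\<lambda>\<close>.
  Positivity of the form means that \<open>i \<alpha> \<and> cnj \<alpha> \<and> \<beta> \<ge> 0\<close> for every \<open>\<alpha> = \<Sum>\<^sub>j w\<^sub>j dz\<^sub>j\<close>.\<close>

definition positive_test_form :: "(complex^'n) set \<Rightarrow> (complex^'n \<Rightarrow> complex^'n^'n) \<Rightarrow> bool" where
  "positive_test_form W B \<longleftrightarrow> smooth_on UNIV B \<and> compact_support_in W B \<and>
     (\<forall>z w. herm_form (B z) w \<in> \<real> \<and> Re (herm_form (B z) w) \<ge> 0)"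

text \<open>\<open>\<langle>dd\<^sup>c u, B\<rangle>\<close>, the derivatives being moved to the test form.\<close>

definition ddc_pairing :: "(complex^'n \<Rightarrow> real) \<Rightarrow> (complex^'n \<Rightarrow> complex^'n^'n) \<Rightarrow> real" where
  "ddc_pairing u B =
     (\<integral>z. u z * Re (\<Sum>j\<in>UNIV. \<Sum>k\<in>UNIV. dz j (dzbar k (\<lambda>x. B x $ j $ k)) z) \<partial>lborel) / pi"

definition current_le :: "('a, 'n::finite) atlas \<Rightarrow> 'a potentials \<Rightarrow> 'a potentials \<Rightarrow> bool" where
  "current_le \<R> S T \<longleftrightarrow>
     (\<forall>(U, u)\<in>S. \<forall>(U', v)\<in>T. \<forall>(V, \<psi>)\<in>\<R>. \<forall>B.
        V \<subseteq> U \<inter> U' \<and> positive_test_form (\<psi> ` V) B \<longrightarrow>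
        ddc_pairing (in_coord V \<psi> u) B \<le> ddc_pairing (in_coord V \<psi> v) B)"

text \<open>The local potentials cover \<open>X\<close> and define the same current on overlaps; note that
  \<open>current_le \<R> T T\<close> compares any two members of \<open>T\<close>, in both directions.\<close>

definition consistent_potentials :: "'a topology \<Rightarrow> ('a, 'n::finite) atlas \<Rightarrow> 'a potentials \<Rightarrow> bool" where
  "consistent_potentials X \<R> T \<longleftrightarrow>
     (\<forall>(U, u)\<in>T. openin X U) \<and> \<Union>(fst ` T) = topspace X \<and> current_le \<R> T T"

definition scale_current :: "real \<Rightarrow> 'a potentials \<Rightarrow> 'a potentials" where
  "scale_current r T = (\<lambda>(U, u). (U, \<lambda>x. r * u x)) ` T"

definition kaehler_form ::
  "'a topology \<Rightarrow> ('a, 'm::finite) atlas \<Rightarrow> ('a, 'n::finite) atlas \<Rightarrow> 'a potentials \<Rightarrow> bool" where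
  "kaehler_form X \<A> \<R> \<omega> \<longleftrightarrow> consistent_potentials X \<R> \<omega> \<and>
     (\<forall>(U, \<rho>)\<in>\<omega>. locally_extends X \<A> smooth_strictly_psh_on U \<rho>)"

text \<open>Psh potentials may take the value \<open>-\<infinity>\<close>, but not identically on a nonempty open set; the
  real-valued representative is obtained by discarding this null set.\<close>

definition psh_current ::
  "'a topology \<Rightarrow> ('a, 'm::finite) atlas \<Rightarrow> ('a, 'n::finite) atlas \<Rightarrow> ('a set \<times> ('a \<Rightarrow> ereal)) set \<Rightarrow> bool" where
  "psh_current X \<A> \<R> T \<longleftrightarrow>
     consistent_potentials X \<R> ((\<lambda>(U, v). (U, \<lambda>x. real_of_ereal (v x))) ` T) \<and>
     (\<forall>(U, v)\<in>T. locally_extends X \<A> psh_on U v \<and>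
        (\<forall>V. openin X V \<and> V \<subseteq> U \<and> V \<noteq> {} \<longrightarrow> (\<exists>x\<in>V. v x \<noteq> -\<infinity>)))"


section \<open>Measures on the regular part\<close>

definition borel_reg :: "'a topology \<Rightarrow> 'a set \<Rightarrow> 'a measure" where
  "borel_reg X Xreg = sigma Xreg {V. openin X V \<and> V \<subseteq> Xreg}"

text \<open>\<open>\<omega>\<^sup>n / n! = 2\<^sup>n det (\<omega>\<^sub>j\<^sub>k) d\<lambda>\<close>, since \<open>i dz \<and> dzbar = 2 dx \<and> dy\<close>.\<close>

definition kaehler_volume ::
  "'a topology \<Rightarrow> ('a, 'n::finite) atlas \<Rightarrow> 'a potentials \<Rightarrow> 'a measure \<Rightarrow> bool" where
  "kaehler_volume X \<R> \<omega> vol \<longleftrightarrow>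
     space vol = covered \<R> \<and> sets vol = sets (borel_reg X (covered \<R>)) \<and>
     (\<forall>(U, \<rho>)\<in>\<omega>. \<forall>(V, \<psi>)\<in>\<R>. V \<subseteq> U \<longrightarrow>
        (\<forall>Q\<in>sets vol. Q \<subseteq> V \<longrightarrow>
           emeasure vol Q =
             (\<integral>\<^sup>+ z. ennreal (2 ^ CARD('n) * Re (det (ddc (in_coord V \<psi> \<rho>) z))) * indicator (\<psi> ` Q) z \<partial>lborel)))"

definition L1_loc :: "'a topology \<Rightarrow> 'a measure \<Rightarrow> 'a set \<Rightarrow> ('a \<Rightarrow> real) \<Rightarrow> bool" where
  "L1_loc X vol U u \<longleftrightarrow>
     (\<forall>K. compactin X K \<and> K \<subseteq> U \<longrightarrow> set_integrable vol (K \<inter> space vol) u)"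

definition cofactor_matrix :: "complex^'n^'n \<Rightarrow> complex^'n^'n" where
  "cofactor_matrix H = (\<chi> j k. det (\<chi> i. if i = j then axis k 1 else H $ i))"

text \<open>\<open>\<mu> = T \<and> \<omega>\<^sup>n\<^sup>-\<^sup>1\<close> as a measure on the regular part, for a positive current \<open>T\<close>: the test form
  \<open>\<eta> \<omega>\<^sup>n\<^sup>-\<^sup>1\<close> has the matrix \<open>(n-1)! 2\<^sup>n \<eta> cof (\<omega>\<^sub>j\<^sub>k)\<close> (for \<open>T = \<omega>\<close> one recovers \<open>n! 2\<^sup>n det (\<omega>\<^sub>j\<^sub>k)\<close>).\<close>

definition wedge_measure ::
  "'a topology \<Rightarrow> ('a, 'n::finite) atlas \<Rightarrow> 'a potentials \<Rightarrow> 'a potentials \<Rightarrow> 'a measure \<Rightarrow> bool" where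
  "wedge_measure X \<R> \<omega> T \<mu> \<longleftrightarrow>
     space \<mu> = covered \<R> \<and> sets \<mu> = sets (borel_reg X (covered \<R>)) \<and>
     (\<forall>(U, \<rho>)\<in>\<omega>. \<forall>(U', u)\<in>T. \<forall>(V, \<psi>)\<in>\<R>. \<forall>\<eta>::complex^'n \<Rightarrow> real.
        V \<subseteq> U \<inter> U' \<and> smooth_on UNIV \<eta> \<and> compact_support_in (\<psi> ` V) \<eta> \<and> (\<forall>z. \<eta> z \<ge> 0) \<longrightarrow>
        (\<integral>\<^sup>+ x. ennreal (\<eta> (\<psi> x)) * indicator V x \<partial>\<mu>) =
          ennreal (fact (CARD('n) - 1) * 2 ^ CARD('n) *
            ddc_pairing (in_coord V \<psi> u) (\<lambda>z. \<eta> z *\<^sub>R cofactor_matrix (ddc (in_coord V \<psi> \<rho>) z))))"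

text \<open>\<open>\<integral>\<^sub>X T \<and> \<omega>\<^sup>n\<^sup>-\<^sup>1 = r\<close>.  The singular locus of a normal space has codimension at least 2 and is not
  charged by \<open>T \<and> \<omega>\<^sup>n\<^sup>-\<^sup>1\<close>.\<close>

definition wedge_mass ::
  "'a topology \<Rightarrow> ('a, 'n::finite) atlas \<Rightarrow> 'a potentials \<Rightarrow> 'a potentials \<Rightarrow> real \<Rightarrow> bool" where
  "wedge_mass X \<R> \<omega> T r \<longleftrightarrow>
     0 \<le> r \<and> (\<exists>\<mu>. wedge_measure X \<R> \<omega> T \<mu> \<and> emeasure \<mu> (space \<mu>) = ennreal r)"


section \<open>Line bundles, singular metrics and square integrable sections\<close>

text \<open>A line bundle is given by holomorphic frames \<open>e\<^sub>i\<close> over \<open>U i\<close>, \<open>i \<in> I\<close>, with \<open>e\<^sub>j = g i j e\<^sub>i\<close>.\<close>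

definition line_bundle ::
  "'a topology \<Rightarrow> ('a, 'm::finite) atlas \<Rightarrow> 'i set \<Rightarrow> ('i \<Rightarrow> 'a set) \<Rightarrow> ('i \<Rightarrow> 'i \<Rightarrow> 'a \<Rightarrow> complex) \<Rightarrow> bool" where
  "line_bundle X \<A> I U g \<longleftrightarrow>
     (\<forall>i\<in>I. openin X (U i)) \<and> (\<Union>i\<in>I. U i) = topspace X \<and>
     (\<forall>i\<in>I. \<forall>j\<in>I. holo_fun X \<A> (U i \<inter> U j) (g i j) \<and> (\<forall>x\<in>U i \<inter> U j. g i j x \<noteq> 0)) \<and>
     (\<forall>i\<in>I. \<forall>x\<in>U i. g i i x = 1) \<and>
     (\<forall>i\<in>I. \<forall>j\<in>I. \<forall>k\<in>I. \<forall>x\<in>U i \<inter> U j \<inter> U k. g i j x * g j k x = g i k x)"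

text \<open>Weights \<open>|e\<^sub>i|\<^sub>h = exp (- \<phi> i)\<close>, represented by real-valued functions: being locally integrable
  they are finite almost everywhere, and only their classes modulo null sets are used below.\<close>

definition singular_metric ::
  "'a topology \<Rightarrow> 'a measure \<Rightarrow> 'i set \<Rightarrow> ('i \<Rightarrow> 'a set) \<Rightarrow> ('i \<Rightarrow> 'i \<Rightarrow> 'a \<Rightarrow> complex)
     \<Rightarrow> ('i \<Rightarrow> 'a \<Rightarrow> real) \<Rightarrow> bool" where
  "singular_metric X vol I U g \<phi> \<longleftrightarrow>
     (\<forall>i\<in>I. L1_loc X vol (U i) (\<phi> i)) \<and>
     (\<forall>i\<in>I. \<forall>j\<in>I. \<forall>x\<in>U i \<inter> U j. \<phi> j x = \<phi> i x - ln (cmod (g i j x)))"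

definition curvature :: "'i set \<Rightarrow> ('i \<Rightarrow> 'a set) \<Rightarrow> ('i \<Rightarrow> 'a \<Rightarrow> real) \<Rightarrow> 'a potentials" where
  "curvature I U \<phi> = (\<lambda>i. (U i, \<phi> i)) ` I"

text \<open>\<open>|s|\<^sub>h\<^sup>2\<close> for \<open>s = s\<^sub>i e\<^sub>i\<close>; the value does not depend on the frame chosen.\<close>

definition norm_sq ::
  "'i set \<Rightarrow> ('i \<Rightarrow> 'a set) \<Rightarrow> ('i \<Rightarrow> 'a \<Rightarrow> real) \<Rightarrow> ('i \<Rightarrow> 'a \<Rightarrow> complex) \<Rightarrow> 'a \<Rightarrow> real" where
  "norm_sq I U \<phi> s x = (let i = (SOME i. i \<in> I \<and> x \<in> U i) in (cmod (s i x))\<^sup>2 * exp (- 2 * \<phi> i x))"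

text \<open>A section is the family of its coefficients with respect to the frames; these are set to \<open>0\<close>
  outside their domains, so that the representation is unique.\<close>

definition L2_sections ::
  "'a topology \<Rightarrow> ('a, 'm::finite) atlas \<Rightarrow> 'a measure \<Rightarrow> 'i set \<Rightarrow> ('i \<Rightarrow> 'a set)
     \<Rightarrow> ('i \<Rightarrow> 'i \<Rightarrow> 'a \<Rightarrow> complex) \<Rightarrow> ('i \<Rightarrow> 'a \<Rightarrow> real) \<Rightarrow> ('i \<Rightarrow> 'a \<Rightarrow> complex) set" where
  "L2_sections X \<A> vol I U g \<phi> = {s.
     (\<forall>i\<in>I. holo_fun X \<A> (U i) (s i)) \<and>
     (\<forall>i\<in>I. \<forall>j\<in>I. \<forall>x\<in>U i \<inter> U j. s i x = g i j x * s j x) \<and>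
     (\<forall>i x. i \<notin> I \<or> x \<notin> U i \<longrightarrow> s i x = 0) \<and>
     (\<integral>\<^sup>+ x. ennreal (norm_sq I U \<phi> s x) \<partial>vol) < \<infinity>}"

definition complex_dim :: "('i \<Rightarrow> 'a \<Rightarrow> complex) set \<Rightarrow> nat" where
  "complex_dim = vector_space.dim (\<lambda>(c::complex) s i x. c * s i x)"

text \<open>The setting.  The dimension is \<open>n = CARD('n)\<close>; pure dimension \<open>n\<close> means that the
  \<open>n\<close>-dimensional manifold points are dense, and they then form the regular locus.\<close>

locale normal_kaehler_space =
  fixes X :: "'a topology"
    and \<A> :: "('a, 'm::finite) atlas"
    and \<R> :: "('a, 'n::finite) atlas"
    and \<omega> :: "'a potentials"
    and vol :: "'a measure"
  assumes complex_space: "reduced_complex_space X \<A>"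
    and compact: "compact_space X"
    and nonempty: "topspace X \<noteq> {}"
    and coord_maps: "\<R> = coord_maps X \<A>"
    and pure_dimension: "X closure_of covered \<R> = topspace X"
    and normal: "normal_space_wrt X \<A> (covered \<R>)"
    and kaehler: "kaehler_form X \<A> \<R> \<omega>"
    and volume: "kaehler_volume X \<R> \<omega> vol"

text \<open>The bundles \<open>(L\<^sub>p, h\<^sub>p)\<close>, \<open>p \<ge> 1\<close>, the numbers \<open>a\<^sub>p\<close>, the degrees
  \<open>A\<^sub>p = \<integral>\<^sub>X c\<^sub>1(L\<^sub>p, h\<^sub>p) \<and> \<omega>\<^sup>n\<^sup>-\<^sup>1\<close> and the dimensions \<open>d\<^sub>p\<close> of the spaces of square integrable
  holomorphic sections.\<close>

locale line_bundle_sequence = normal_kaehler_space X \<A> \<R> \<omega> vol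
  for X :: "'a topology"
    and \<A> :: "('a, 'm::finite) atlas"
    and \<R> :: "('a, 'n::finite) atlas"
    and \<omega> :: "'a potentials"
    and vol :: "'a measure" +
  fixes I :: "nat \<Rightarrow> 'i set"
    and U :: "nat \<Rightarrow> 'i \<Rightarrow> 'a set"
    and g :: "nat \<Rightarrow> 'i \<Rightarrow> 'i \<Rightarrow> 'a \<Rightarrow> complex"
    and \<phi> :: "nat \<Rightarrow> 'i \<Rightarrow> 'a \<Rightarrow> real"
    and a :: "nat \<Rightarrow> real"
    and A :: "nat \<Rightarrow> real"
    and d :: "nat \<Rightarrow> nat"
  assumes line_bundles: "p \<ge> 1 \<Longrightarrow> line_bundle X \<A> (I p) (U p) (g p)"
    and metric: "p \<ge> 1 \<Longrightarrow> singular_metric X vol (I p) (U p) (g p) (\<phi> p)"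
    and a_pos: "p \<ge> 1 \<Longrightarrow> a p > 0"
    and a_lim: "filterlim a at_top sequentially"
    and curvature_ge: "p \<ge> 1 \<Longrightarrow> current_le \<R> (scale_current (a p) \<omega>) (curvature (I p) (U p) (\<phi> p))"
    and A_eq: "p \<ge> 1 \<Longrightarrow> wedge_mass X \<R> \<omega> (curvature (I p) (U p) (\<phi> p)) (A p)"
    and curvature_le: "topspace X - covered \<R> \<noteq> {} \<Longrightarrow>
      \<exists>T\<^sub>0. psh_current X \<A> \<R> T\<^sub>0 \<and>
        (\<forall>p\<ge>1. current_le \<R> (curvature (I p) (U p) (\<phi> p))
           (scale_current (A p) ((\<lambda>(W, v). (W, \<lambda>x. real_of_ereal (v x))) ` T\<^sub>0)))"
    and d_eq: "p \<ge> 1 \<Longrightarrow> d p = complex_dim (L2_sections X \<A> vol (I p) (U p) (g p) (\<phi> p))"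


section \<open>The random coefficients\<close>

abbreviation law :: "(complex \<Rightarrow> real) \<Rightarrow> complex measure" where
  "law dens \<equiv> density lborel (\<lambda>z. ennreal (dens z))"

definition admissible_density :: "real \<Rightarrow> real \<Rightarrow> real \<Rightarrow> (complex \<Rightarrow> real) \<Rightarrow> bool" where
  "admissible_density M c \<rho> dens \<longleftrightarrow>
     dens \<in> borel_measurable borel \<and> (\<forall>z. 0 \<le> dens z \<and> dens z \<le> M) \<and> prob_space (law dens) \<and>
     (\<forall>R\<ge>1. measure (law dens) {z. ln (cmod z) > R} \<le> c / R powr \<rho>)"

definition iid_array ::
  "'w measure \<Rightarrow> (nat \<Rightarrow> nat \<Rightarrow> 'w \<Rightarrow> complex) \<Rightarrow> (nat \<Rightarrow> nat) \<Rightarrow> (complex \<Rightarrow> real) \<Rightarrow> bool" where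
  "iid_array \<Omega> Z d dens \<longleftrightarrow> prob_space \<Omega> \<and>
     prob_space.indep_vars \<Omega> (\<lambda>_. borel) (\<lambda>(p, j). Z p j) {(p, j). 1 \<le> p \<and> 1 \<le> j \<and> j \<le> d p} \<and>
     (\<forall>p\<ge>1. \<forall>j\<in>{1..d p}. distributed \<Omega> lborel (Z p j) (\<lambda>z. ennreal (dens z)))"

text \<open>Points of \<open>\<complex>\<^sup>d\<close> are functions on \<open>{1..d}\<close>.\<close>

definition coeff_measure :: "(complex \<Rightarrow> real) \<Rightarrow> nat \<Rightarrow> (nat \<Rightarrow> complex) measure" where
  "coeff_measure dens d = (\<Pi>\<^sub>M j\<in>{1..d}. law dens)"

definition unit_vector :: "nat \<Rightarrow> (nat \<Rightarrow> complex) \<Rightarrow> bool" where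
  "unit_vector d u \<longleftrightarrow> (\<Sum>j=1..d. (cmod (u j))\<^sup>2) = 1"

text \<open>In HOL \<open>ln 0 = 0\<close>; this affects the integrand only on the hyperplane \<open>\<langle>a, u\<rangle> = 0\<close>, which is a null
  set for \<open>u \<noteq> 0\<close>.\<close>

definition log_moment :: "(complex \<Rightarrow> real) \<Rightarrow> nat \<Rightarrow> real \<Rightarrow> (nat \<Rightarrow> complex) \<Rightarrow> ennreal" where
  "log_moment dens d \<nu> u =
     (\<integral>\<^sup>+ a. ennreal (\<bar>ln (cmod (\<Sum>j=1..d. a j * u j))\<bar> powr \<nu>) \<partial>coeff_measure dens d)"

end

theory Submission
  imports Defs
begin

text \<open>Moments: as \<open>\<parallel>u\<parallel> = 1\<close>, the event \<open>|\<langle>a,u\<rangle>| > \<surd>d e\<^sup>s\<close> forces \<open>|a\<^sub>j| > e\<^sup>s\<close> for some \<open>j\<close>; and some \<open>k\<close> has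
  \<open>|u\<^sub>k|\<^sup>2 \<ge> 1/d\<close>, so fixing all coordinates of \<open>a\<close> but \<open>a\<^sub>k\<close> gives \<open>P(|\<langle>a,u\<rangle>| < r) \<le> M \<pi> d r\<^sup>2\<close>.  Hence
  \<open>P(|log |\<langle>a,u\<rangle>|| > t) = O(d t\<^sup>-\<^sup>\<rho>)\<close> for \<open>t \<ge> R = (2 + \<rho>) d\<^sup>1\<^sup>/\<^sup>\<rho>\<close>, and summation over the dyadic levels
  \<open>2\<^sup>k R\<close> bounds the moment by a multiple of \<open>d\<^sup>\<nu>\<^sup>/\<^sup>\<rho>\<close>.

  The little-o claims also need \<open>A\<^sub>p \<longlonglongrightarrow> \<infinity>\<close>.  In a coordinate chart on which \<open>\<omega>\<close> has a potential, testing
  \<open>c\<^sub>1(L\<^sub>p, h\<^sub>p) \<ge> a\<^sub>p \<omega>\<close> against \<open>\<eta> \<omega>\<^sup>n\<^sup>-\<^sup>1\<close> and integrating by parts bounds the mass of \<open>c\<^sub>1 \<and> \<omega>\<^sup>n\<^sup>-\<^sup>1\<close> on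
  a small ball below by \<open>a\<^sub>p\<close> times its volume, up to a constant.  How small the ball must be depends
  on \<open>p\<close>, through the domains of the weights; the Vitali covering lemma provides disjoint small
  balls occupying a proportion of the chart that does not depend on \<open>p\<close>.\<close>

section \<open>Functions of class \<open>C\<^sup>k\<close>\<close>

text \<open>\<open>current_le\<close> and \<open>wedge_measure\<close> only speak of charts lying in
  one potential domain of each current, so no fixed bump function can serve all p. On disjoint balls
  the local bounds add up by additivity of the measure, without a partition of unity. A bound
  uniform in p then needs the density of \<omega> in the chart to stay away from 0. But \<omega> is
  known to be strictly psh only in the ambient space of an embedding, which is why the second order
  chain rule is set up for Levi forms and why the inverse of a chart must be an immersion. The
  calculus rests on directional derivatives because \<open>C_k_on\<close> is defined by them.

  In the moment estimate \<open>d powr (1 / \<rho>)\<close> is the scale at which d t^(-\<rho>)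
  becomes of order 1: below it the integrand is bounded trivially, above it the tail decays faster
  than t^(-\<nu>), and both parts contribute the order d^(\<nu>/\<rho>). The lower tail is even
  exponentially small, so it is absorbed into the polynomial one.\<close>

abbreviation dirderiv :: "'a::real_normed_vector \<Rightarrow> ('a \<Rightarrow> 'b::real_normed_vector) \<Rightarrow> 'a \<Rightarrow> 'b" where
  "dirderiv v f z \<equiv> frechet_derivative f (at z) v"

text \<open>\<open>frechet_derivative\<close> is a choice among all derivatives at the point. Both
  functions have the same derivatives there, so the choices agree even where none exists, and no
  differentiability has to be assumed.\<close>

lemma frechet_derivative_cong_open:
  assumes "open W" "z \<in> W" "\<And>x. x \<in> W \<Longrightarrow> f x = g x"
  shows "frechet_derivative f (at z) = frechet_derivative g (at z)"
proof -
  have "(f has_derivative D) (at z) \<longleftrightarrow> (g has_derivative D) (at z)" for D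
    using assms by (metis has_derivative_transform_within_open)
  then show ?thesis unfolding frechet_derivative_def by simp
qed

lemma differentiable_cong_open:
  assumes "open W" "z \<in> W" "\<And>x. x \<in> W \<Longrightarrow> f x = g x"
  shows "f differentiable (at z) \<longleftrightarrow> g differentiable (at z)"
  using assms unfolding differentiable_def by (metis has_derivative_transform_within_open)

lemma C_k_on_cong:
  assumes "open W" "\<And>x. x \<in> W \<Longrightarrow> f x = g x"
  shows "C_k_on k W f \<longleftrightarrow> C_k_on k W g"
  using assms(2)
proof (induction k arbitrary: f g)
  case 0 then show ?case by (simp cong: continuous_on_cong)
next
  case (Suc k)
  have "C_k_on k W (\<lambda>z. frechet_derivative f (at z) v) = C_k_on k W (\<lambda>z. frechet_derivative g (at z) v)" for v
    by (rule Suc.IH) (simp add: frechet_derivative_cong_open[OF assms(1) _ Suc.prems])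
  moreover have "f differentiable (at z) \<longleftrightarrow> g differentiable (at z)" if "z \<in> W" for z
    using differentiable_cong_open[OF assms(1) that Suc.prems] .
  ultimately show ?case by auto
qed

lemma C_k_on_imp_continuous_on: "C_k_on k W f \<Longrightarrow> continuous_on W f"
  by (cases k) (auto intro!: continuous_at_imp_continuous_on dest: differentiable_imp_continuous_within)

lemma C_k_on_SucD: "C_k_on (Suc k) W f \<Longrightarrow> C_k_on k W f"
proof (induction k arbitrary: f)
  case 0 then show ?case using C_k_on_imp_continuous_on by fastforce
next
  case (Suc k) then show ?case by (metis C_k_on.simps(2))
qed

lemma C_k_on_subset: "C_k_on k W f \<Longrightarrow> V \<subseteq> W \<Longrightarrow> C_k_on k V f"
  by (induction k arbitrary: f) (auto intro: continuous_on_subset)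

lemma C_k_on_local:
  assumes "\<And>z. z \<in> W \<Longrightarrow> \<exists>V. open V \<and> z \<in> V \<and> C_k_on k V f"
  shows "C_k_on k W f"
  using assms
proof (induction k arbitrary: f)
  case 0
  have "isCont f z" if "z \<in> W" for z
    using 0[OF that] by (metis C_k_on.simps(1) continuous_on_eq_continuous_at)
  then show ?case by (auto intro: continuous_at_imp_continuous_on)
next
  case (Suc k) then show ?case by (metis C_k_on.simps(2))
qed

text \<open>Lets the derivative be given by a formula, as the product or chain rule delivers it,
  instead of by the choice operator behind \<open>frechet_derivative\<close>. The closure properties
  below are inductions on k through this rule.\<close>

lemma C_k_on_SucI:
  assumes "open W" "\<And>z. z \<in> W \<Longrightarrow> (f has_derivative f' z) (at z)" "\<And>v. C_k_on k W (\<lambda>z. f' z v)"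
  shows "C_k_on (Suc k) W f"
proof -
  have "frechet_derivative f (at z) = f' z" if "z \<in> W" for z
    using frechet_derivative_at[OF assms(2)[OF that]] by simp
  then have "C_k_on k W (\<lambda>z. frechet_derivative f (at z) v)" for v
    using assms(3)[of v] C_k_on_cong[OF assms(1), of "\<lambda>z. frechet_derivative f (at z) v" "\<lambda>z. f' z v"]
    by simp
  then show ?thesis using assms(2) by (auto simp: differentiable_def)
qed

lemma C_k_on_const: "C_k_on k W (\<lambda>_. c)"
proof (induction k arbitrary: c)
  case (Suc k)
  have "frechet_derivative (\<lambda>_. c) (at z) = (\<lambda>_. 0)" for z :: 'a
    by (simp add: frechet_derivative_const)
  then show ?case using Suc[of 0] by simp
qed simp

lemma C_k_on_has_derivative:
  "C_k_on (Suc k) W f \<Longrightarrow> z \<in> W \<Longrightarrow> (f has_derivative frechet_derivative f (at z)) (at z)"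
  by (simp add: frechet_derivative_works)

lemma C_k_on_bounded_linear:
  assumes "bounded_linear L" shows "open W \<Longrightarrow> C_k_on k W L"
proof (cases k)
  case 0 then show ?thesis using assms by (simp add: linear_continuous_on)
next
  case (Suc k) assume "open W"
  then show ?thesis unfolding Suc
    by (rule C_k_on_SucI[where f' = "\<lambda>_. L"])
      (auto intro: bounded_linear_imp_has_derivative assms C_k_on_const)
qed

lemma C_k_on_linear_compose:
  assumes "bounded_linear L" "open W"
  shows "C_k_on k W f \<Longrightarrow> C_k_on k W (\<lambda>z. L (f z))"
proof (induction k arbitrary: f)
  case 0 then show ?case using assms(1) by (auto intro: bounded_linear.continuous_on)
next
  case (Suc k)
  show ?case
    by (rule C_k_on_SucI[where f' = "\<lambda>z v. L (frechet_derivative f (at z) v)"])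
      (use Suc assms in \<open>auto intro!: bounded_linear.has_derivative[OF assms(1)] C_k_on_has_derivative simp del: C_k_on.simps(2), simp\<close>)
qed

lemma C_k_on_add:
  assumes "open W"
  shows "C_k_on k W f \<Longrightarrow> C_k_on k W g \<Longrightarrow> C_k_on k W (\<lambda>z. f z + g z)"
proof (induction k arbitrary: f g)
  case 0 then show ?case by (auto intro: continuous_on_add)
next
  case (Suc k)
  show ?case
    by (rule C_k_on_SucI[where f' = "\<lambda>z v. frechet_derivative f (at z) v + frechet_derivative g (at z) v"])
      (use Suc assms in \<open>auto intro!: has_derivative_add C_k_on_has_derivative simp del: C_k_on.simps(2), simp\<close>)
qed

lemma C_k_on_sum:
  assumes "open W" "\<And>i. i \<in> I \<Longrightarrow> C_k_on k W (f i)"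
  shows "C_k_on k W (\<lambda>z. \<Sum>i\<in>I. f i z)"
  using assms(2)
  by (induction I rule: infinite_finite_induct) (auto intro: C_k_on_const C_k_on_add[OF assms(1)])

lemma C_k_on_bilinear:
  assumes "bounded_bilinear B" "open W"
  shows "C_k_on k W f \<Longrightarrow> C_k_on k W g \<Longrightarrow> C_k_on k W (\<lambda>z. B (f z) (g z))"
proof (induction k arbitrary: f g)
  case 0 then show ?case using assms(1) by (auto intro: bounded_bilinear.continuous_on)
next
  case (Suc k)
  note fg = C_k_on_SucD[OF Suc.prems(1)] C_k_on_SucD[OF Suc.prems(2)]
  show ?case
    by (rule C_k_on_SucI[where f' = "\<lambda>z v. B (f z) (frechet_derivative g (at z) v) + B (frechet_derivative f (at z) v) (g z)"])
      (use Suc fg assms in \<open>auto intro!: bounded_bilinear.FDERIV[OF assms(1)] C_k_on_has_derivative C_k_on_add simp del: C_k_on.simps(2), simp_all\<close>)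
qed

text \<open>\<open>C_k_on\<close> controls derivatives in fixed directions only, whereas in the
  chain rule the direction of the outer derivative moves with the point. Expanding that direction in
  the basis leaves fixed directions with moving coefficients.\<close>

lemma frechet_derivative_basis:
  fixes F :: "'b::euclidean_space \<Rightarrow> 'c::real_normed_vector"
  assumes "F differentiable (at y)"
  shows "frechet_derivative F (at y) w = (\<Sum>b\<in>Basis. (w \<bullet> b) *\<^sub>R frechet_derivative F (at y) b)"
proof -
  have "linear (frechet_derivative F (at y))" using assms by (rule linear_frechet_derivative)
  then have "frechet_derivative F (at y) (\<Sum>b\<in>Basis. (w \<bullet> b) *\<^sub>R b) = (\<Sum>b\<in>Basis. (w \<bullet> b) *\<^sub>R frechet_derivative F (at y) b)"
    by (simp add: linear_sum linear_cmul)
  then show ?thesis by (simp add: euclidean_representation)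
qed

lemma C_k_on_compose:
  fixes G :: "'a::real_normed_vector \<Rightarrow> 'b::euclidean_space" and F :: "'b \<Rightarrow> 'c::real_normed_vector"
  assumes "open W" "open W'" "G ` W \<subseteq> W'"
  shows "C_k_on k W' F \<Longrightarrow> C_k_on k W G \<Longrightarrow> C_k_on k W (\<lambda>z. F (G z))"
proof (induction k arbitrary: F)
  case 0 then show ?case using assms by (auto intro: continuous_on_compose2)
next
  case (Suc k)
  let ?f = "\<lambda>z v. (\<Sum>b\<in>Basis. (frechet_derivative G (at z) v \<bullet> b) *\<^sub>R frechet_derivative F (at (G z)) b)"
  show ?case
  proof (rule C_k_on_SucI[where f' = ?f])
    fix z assume z: "z \<in> W"
    then have Gz: "G z \<in> W'" using assms by auto
    have "((\<lambda>z. F (G z)) has_derivative (\<lambda>v. frechet_derivative F (at (G z)) (frechet_derivative G (at z) v))) (at z)"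
      by (rule has_derivative_compose) (use Gz z Suc.prems C_k_on_has_derivative in blast)+
    moreover have Fd: "F differentiable (at (G z))" using Suc.prems Gz by simp
    ultimately show "((\<lambda>z. F (G z)) has_derivative ?f z) (at z)"
      by (simp only: frechet_derivative_basis[OF Fd, symmetric])
  next
    fix v
    have "C_k_on k W (\<lambda>z. frechet_derivative F (at (G z)) b)" for b
      using Suc.IH[of "\<lambda>y. frechet_derivative F (at y) b"] Suc.prems C_k_on_SucD by auto
    moreover have "C_k_on k W (\<lambda>z. frechet_derivative G (at z) v \<bullet> b)" for b
      by (rule C_k_on_linear_compose) (use Suc.prems assms bounded_linear_inner_left in auto)
    ultimately show "C_k_on k W (\<lambda>z. ?f z v)"
      by (intro C_k_on_sum C_k_on_bilinear[OF bounded_bilinear_scaleR] assms)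
  qed (rule assms)
qed

section \<open>Closure properties of smooth functions\<close>

lemma smooth_on_cong:
  "open W \<Longrightarrow> (\<And>x. x \<in> W \<Longrightarrow> f x = g x) \<Longrightarrow> smooth_on W f \<longleftrightarrow> smooth_on W g"
  unfolding smooth_on_def using C_k_on_cong by blast

lemma smooth_on_subset: "smooth_on W f \<Longrightarrow> V \<subseteq> W \<Longrightarrow> smooth_on V f"
  unfolding smooth_on_def using C_k_on_subset by blast

lemma smooth_on_local:
  "(\<And>z. z \<in> W \<Longrightarrow> \<exists>V. open V \<and> z \<in> V \<and> smooth_on V f) \<Longrightarrow> smooth_on W f"
  unfolding smooth_on_def using C_k_on_local by meson

lemma smooth_on_const: "smooth_on W (\<lambda>_. c)"
  unfolding smooth_on_def using C_k_on_const by blast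

lemma smooth_on_bounded_linear: "bounded_linear L \<Longrightarrow> open W \<Longrightarrow> smooth_on W L"
  unfolding smooth_on_def using C_k_on_bounded_linear by blast

lemma smooth_on_linear_compose:
  "bounded_linear L \<Longrightarrow> open W \<Longrightarrow> smooth_on W f \<Longrightarrow> smooth_on W (\<lambda>z. L (f z))"
  unfolding smooth_on_def using C_k_on_linear_compose by blast

lemma smooth_on_bilinear:
  "bounded_bilinear B \<Longrightarrow> open W \<Longrightarrow> smooth_on W f \<Longrightarrow> smooth_on W g \<Longrightarrow> smooth_on W (\<lambda>z. B (f z) (g z))"
  unfolding smooth_on_def using C_k_on_bilinear by blast

lemma smooth_on_add: "open W \<Longrightarrow> smooth_on W f \<Longrightarrow> smooth_on W g \<Longrightarrow> smooth_on W (\<lambda>z. f z + g z)"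
  unfolding smooth_on_def using C_k_on_add by blast

lemma smooth_on_diff:
  assumes "open W" "smooth_on W f" "smooth_on W g"
  shows "smooth_on W (\<lambda>z. f z - g z)"
  using smooth_on_add[OF assms(1,2) smooth_on_linear_compose[OF bounded_linear_minus[OF bounded_linear_ident] assms(1,3)]]
  by simp

lemma smooth_on_sum:
  "open W \<Longrightarrow> (\<And>i. i \<in> I \<Longrightarrow> smooth_on W (f i)) \<Longrightarrow> smooth_on W (\<lambda>z. \<Sum>i\<in>I. f i z)"
  unfolding smooth_on_def by (intro allI C_k_on_sum) auto

lemma smooth_on_mult:
  fixes f g :: "'a::real_normed_vector \<Rightarrow> 'b::real_normed_algebra"
  shows "open W \<Longrightarrow> smooth_on W f \<Longrightarrow> smooth_on W g \<Longrightarrow> smooth_on W (\<lambda>z. f z * g z)"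
  by (rule smooth_on_bilinear[OF bounded_bilinear_mult])

lemma smooth_on_prod:
  fixes f :: "'i \<Rightarrow> 'a::real_normed_vector \<Rightarrow> 'b::{real_normed_algebra,comm_ring_1}"
  shows "open W \<Longrightarrow> (\<And>i. i \<in> I \<Longrightarrow> smooth_on W (f i)) \<Longrightarrow> smooth_on W (\<lambda>z. \<Prod>i\<in>I. f i z)"
  by (induction I rule: infinite_finite_induct) (auto intro: smooth_on_const smooth_on_mult)

lemma smooth_on_compose:
  fixes G :: "'a::real_normed_vector \<Rightarrow> 'b::euclidean_space" and F :: "'b \<Rightarrow> 'c::real_normed_vector"
  shows "open W \<Longrightarrow> open W' \<Longrightarrow> G ` W \<subseteq> W' \<Longrightarrow> smooth_on W' F \<Longrightarrow> smooth_on W G \<Longrightarrow> smooth_on W (\<lambda>z. F (G z))"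
  unfolding smooth_on_def by (simp add: C_k_on_compose[where W=W and W'=W'])

lemma smooth_on_dirderiv: "smooth_on W f \<Longrightarrow> smooth_on W (dirderiv v f)"
  unfolding smooth_on_def by (metis C_k_on.simps(2))

lemma smooth_on_differentiable: "smooth_on W f \<Longrightarrow> z \<in> W \<Longrightarrow> f differentiable (at z)"
  unfolding smooth_on_def by (metis C_k_on.simps(2))

lemma smooth_on_has_derivative:
  "smooth_on W f \<Longrightarrow> z \<in> W \<Longrightarrow> (f has_derivative frechet_derivative f (at z)) (at z)"
  using smooth_on_differentiable frechet_derivative_works by blast

lemma smooth_on_continuous_on: "smooth_on W f \<Longrightarrow> continuous_on W f"
  unfolding smooth_on_def by (metis C_k_on.simps(1))

lemma smooth_on_linear_frechet: "smooth_on W f \<Longrightarrow> z \<in> W \<Longrightarrow> linear (frechet_derivative f (at z))"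
  using smooth_on_differentiable linear_frechet_derivative by blast

lemma smooth_on_vec:
  fixes f :: "'a::real_normed_vector \<Rightarrow> 'b::euclidean_space^'n"
  assumes "open W" "\<And>i. smooth_on W (\<lambda>z. f z $ i)"
  shows "smooth_on W f"
proof -
  have "bounded_linear (\<lambda>x::'b. axis i x :: 'b^'n)" for i
    unfolding linear_conv_bounded_linear[symmetric] by (rule linearI) (simp_all add: vec_eq_iff axis_def)
  then have "smooth_on W (\<lambda>z. \<Sum>i\<in>UNIV. axis i (f z $ i))"
    by (intro smooth_on_sum assms smooth_on_linear_compose[where L="axis _"])
  moreover have "(\<Sum>i\<in>UNIV. axis i (f z $ i)) = f z" for z
    by (simp add: vec_eq_iff axis_def)
  ultimately show ?thesis by simp
qed

section \<open>Symmetry of second derivatives and bump functions\<close>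

lemma frechet_derivative_linear_compose:
  assumes "bounded_linear L" "f differentiable (at z)"
  shows "frechet_derivative (\<lambda>x. L (f x)) (at z) v = L (frechet_derivative f (at z) v)"
proof -
  have "((\<lambda>x. L (f x)) has_derivative (\<lambda>v. L (frechet_derivative f (at z) v))) (at z)"
    using assms bounded_linear.has_derivative frechet_derivative_works by blast
  then show ?thesis using frechet_derivative_at by metis
qed

lemma has_real_derivative_along_line:
  fixes f :: "'a::real_normed_vector \<Rightarrow> real"
  assumes "f differentiable (at (x + s *\<^sub>R a))"
  shows "((\<lambda>s. f (x + s *\<^sub>R a)) has_real_derivative dirderiv a f (x + s *\<^sub>R a)) (at s)"
proof -
  have "((\<lambda>s. f (x + s *\<^sub>R a)) has_derivative (\<lambda>t. frechet_derivative f (at (x + s *\<^sub>R a)) (t *\<^sub>R a))) (at s)"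
    by (rule has_derivative_compose[where f="\<lambda>s. x + s *\<^sub>R a"])
      (use assms frechet_derivative_works in \<open>auto intro!: derivative_eq_intros\<close>)
  moreover have "frechet_derivative f (at (x + s *\<^sub>R a)) (t *\<^sub>R a) = t * dirderiv a f (x + s *\<^sub>R a)" for t
    using linear_cmul[OF linear_frechet_derivative[OF assms], of t a] by simp
  ultimately show ?thesis by (simp add: has_field_derivative_def mult_commute_abs)
qed

text \<open>The mean value theorem is applied twice: along a to the difference of f on two opposite
  sides of the parallelogram, then along b to the derivative so obtained. The left side is symmetric
  in a and b although the right side is not.\<close>

lemma second_difference_mvt:
  fixes f :: "'a::real_normed_vector \<Rightarrow> real"
  assumes C: "C_k_on 2 W f" and "h > 0"
    and box: "\<And>s t. 0 \<le> s \<Longrightarrow> s \<le> h \<Longrightarrow> 0 \<le> t \<Longrightarrow> t \<le> h \<Longrightarrow> z + s *\<^sub>R a + t *\<^sub>R b \<in> W"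
  shows "\<exists>s t. 0 < s \<and> s < h \<and> 0 < t \<and> t < h \<and>
    f (z + h *\<^sub>R a + h *\<^sub>R b) - f (z + h *\<^sub>R a) - f (z + h *\<^sub>R b) + f z
      = h\<^sup>2 * dirderiv b (dirderiv a f) (z + s *\<^sub>R a + t *\<^sub>R b)"
proof -
  have df: "f differentiable (at y)" and ddf: "dirderiv a f differentiable (at y)" if "y \<in> W" for y
    using C that by (auto simp: numeral_2_eq_2)
  let ?g = "\<lambda>s. f ((z + h *\<^sub>R b) + s *\<^sub>R a) - f (z + s *\<^sub>R a)"
  have "\<exists>s. 0 < s \<and> s < h \<and> ?g h - ?g 0 = (h - 0) * (dirderiv a f ((z + h *\<^sub>R b) + s *\<^sub>R a) - dirderiv a f (z + s *\<^sub>R a))"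
  proof (rule MVT2[OF \<open>h > 0\<close>])
    fix s assume s: "0 \<le> s" "s \<le> h"
    have "(z + h *\<^sub>R b) + s *\<^sub>R a \<in> W" "z + s *\<^sub>R a \<in> W"
      using box[of s h] box[of s 0] s \<open>h > 0\<close> by (simp_all add: algebra_simps)
    then show "(?g has_real_derivative dirderiv a f ((z + h *\<^sub>R b) + s *\<^sub>R a) - dirderiv a f (z + s *\<^sub>R a)) (at s)"
      by (intro DERIV_diff has_real_derivative_along_line df)
  qed
  then obtain s where s: "0 < s" "s < h"
    and 1: "?g h - ?g 0 = h * (dirderiv a f ((z + h *\<^sub>R b) + s *\<^sub>R a) - dirderiv a f (z + s *\<^sub>R a))" by auto
  let ?k = "\<lambda>t. dirderiv a f ((z + s *\<^sub>R a) + t *\<^sub>R b)"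
  have "\<exists>t. 0 < t \<and> t < h \<and> ?k h - ?k 0 = (h - 0) * dirderiv b (dirderiv a f) ((z + s *\<^sub>R a) + t *\<^sub>R b)"
  proof (rule MVT2[OF \<open>h > 0\<close>])
    fix t assume t: "0 \<le> t" "t \<le> h"
    then show "(?k has_real_derivative dirderiv b (dirderiv a f) ((z + s *\<^sub>R a) + t *\<^sub>R b)) (at t)"
      by (intro has_real_derivative_along_line ddf box) (use s in auto)
  qed
  then obtain t where t: "0 < t" "t < h"
    and 2: "?k h - ?k 0 = h * dirderiv b (dirderiv a f) ((z + s *\<^sub>R a) + t *\<^sub>R b)" by auto
  have "?g h - ?g 0 = h * (?k h - ?k 0)" using 1 by (simp add: algebra_simps)
  then have "?g h - ?g 0 = h\<^sup>2 * dirderiv b (dirderiv a f) (z + s *\<^sub>R a + t *\<^sub>R b)"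
    using 2 by (simp add: power2_eq_square)
  moreover have "?g h - ?g 0 = f (z + h *\<^sub>R a + h *\<^sub>R b) - f (z + h *\<^sub>R a) - f (z + h *\<^sub>R b) + f z"
    by (simp add: algebra_simps)
  ultimately show ?thesis using s t by metis
qed

text \<open>The two orders of the mean value argument express one and the same second difference, so
  the two mixed derivatives agree at two possibly different points arbitrarily close to z. Their
  continuity gives equality at z.\<close>

lemma dirderiv_commute_real:
  fixes f :: "'a::real_normed_vector \<Rightarrow> real"
  assumes "open W" "z \<in> W" "C_k_on 2 W f"
  shows "dirderiv a (dirderiv b f) z = dirderiv b (dirderiv a f) z"
proof -
  let ?P = "dirderiv a (dirderiv b f)" and ?Q = "dirderiv b (dirderiv a f)"
  have cont: "isCont ?P z" "isCont ?Q z"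
    using assms by (auto simp: numeral_2_eq_2 continuous_on_eq_continuous_at)
  have "\<bar>?P z - ?Q z\<bar> \<le> e" if "e > 0" for e
  proof -
    have ev: "\<forall>\<^sub>F y in nhds z. y \<in> W \<and> \<bar>?P y - ?P z\<bar> < e/2 \<and> \<bar>?Q y - ?Q z\<bar> < e/2"
    proof (intro eventually_conj)
      show "\<forall>\<^sub>F y in nhds z. y \<in> W" using assms eventually_nhds_in_open by blast
      show "\<forall>\<^sub>F y in nhds z. \<bar>?P y - ?P z\<bar> < e/2"
        using tendstoD[OF cont(1)[unfolded isCont_def tendsto_at_iff_tendsto_nhds[where g="?P"]], of "e/2"] \<open>e > 0\<close>
        by (simp only: dist_real_def half_gt_zero)
      show "\<forall>\<^sub>F y in nhds z. \<bar>?Q y - ?Q z\<bar> < e/2"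
        using tendstoD[OF cont(2)[unfolded isCont_def tendsto_at_iff_tendsto_nhds[where g="?Q"]], of "e/2"] \<open>e > 0\<close>
        by (simp only: dist_real_def half_gt_zero)
    qed
    then obtain d where d: "d > 0"
      and dd: "\<And>y. dist y z < d \<Longrightarrow> y \<in> W \<and> \<bar>?P y - ?P z\<bar> < e/2 \<and> \<bar>?Q y - ?Q z\<bar> < e/2"
      unfolding eventually_nhds_metric by blast
    \<comment> \<open>Chosen so that the parallelogram spanned by h a and h b at z stays in the
      d-ball; the summand 1 covers a = b = 0 and makes the inequality strict.\<close>
    define h where "h = d / (norm a + norm b + 1)"
    have pos: "norm a + norm b + 1 > 0" using norm_ge_zero[of a] norm_ge_zero[of b] by linarith
    have h: "h > 0" using d pos by (simp add: h_def)
    have box: "dist (z + s *\<^sub>R a + t *\<^sub>R b) z < d" if "0 \<le> s" "s \<le> h" "0 \<le> t" "t \<le> h" for s t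
    proof -
      have "dist (z + s *\<^sub>R a + t *\<^sub>R b) z = norm (s *\<^sub>R a + t *\<^sub>R b)" by (simp add: dist_norm)
      also have "\<dots> \<le> s * norm a + t * norm b"
        using that by (metis norm_triangle_ineq norm_scaleR abs_of_nonneg)
      also have "\<dots> \<le> h * norm a + h * norm b"
        using that by (intro add_mono mult_right_mono) auto
      also have "\<dots> < h * (norm a + norm b + 1)" using h by (simp add: algebra_simps)
      also have "\<dots> = d" using pos by (simp add: h_def)
      finally show ?thesis .
    qed
    have box': "dist (z + s *\<^sub>R b + t *\<^sub>R a) z < d" if "0 \<le> s" "s \<le> h" "0 \<le> t" "t \<le> h" for s t
      using box[of t s] that by (simp add: algebra_simps)
    let ?\<Delta> = "f (z + h *\<^sub>R a + h *\<^sub>R b) - f (z + h *\<^sub>R a) - f (z + h *\<^sub>R b) + f z"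
    obtain s t where 1: "dist (z + s *\<^sub>R a + t *\<^sub>R b) z < d" "?\<Delta> = h\<^sup>2 * ?Q (z + s *\<^sub>R a + t *\<^sub>R b)"
      using second_difference_mvt[OF assms(3) h, of z a b] box dd by (metis less_imp_le)
    obtain s' t' where 2: "dist (z + s' *\<^sub>R b + t' *\<^sub>R a) z < d"
      "f (z + h *\<^sub>R b + h *\<^sub>R a) - f (z + h *\<^sub>R b) - f (z + h *\<^sub>R a) + f z = h\<^sup>2 * ?P (z + s' *\<^sub>R b + t' *\<^sub>R a)"
      using second_difference_mvt[OF assms(3) h, of z b a] box' dd by (metis less_imp_le)
    have "h\<^sup>2 * ?P (z + s' *\<^sub>R b + t' *\<^sub>R a) = ?\<Delta>" unfolding 2(2)[symmetric] by (simp add: algebra_simps)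
    with 1(2) have "?P (z + s' *\<^sub>R b + t' *\<^sub>R a) = ?Q (z + s *\<^sub>R a + t *\<^sub>R b)" using h by simp
    then show ?thesis using dd[OF 1(1)] dd[OF 2(1)] by linarith
  qed
  then show ?thesis using field_le_epsilon[of "\<bar>?P z - ?Q z\<bar>" 0] by simp
qed

lemma dirderiv_commute:
  fixes f :: "'a::real_normed_vector \<Rightarrow> 'b::euclidean_space"
  assumes "open W" "z \<in> W" "smooth_on W f"
  shows "dirderiv a (dirderiv b f) z = dirderiv b (dirderiv a f) z"
proof (rule euclidean_eqI)
  fix i :: 'b
  have L: "bounded_linear (\<lambda>x. x \<bullet> i)" by (rule bounded_linear_inner_left)
  have 1: "dirderiv v (\<lambda>x. f x \<bullet> i) y = dirderiv v f y \<bullet> i" if "y \<in> W" for v y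
    using frechet_derivative_linear_compose[OF L smooth_on_differentiable[OF assms(3) that]] .
  have 2: "dirderiv v (dirderiv w (\<lambda>x. f x \<bullet> i)) z = dirderiv v (dirderiv w f) z \<bullet> i" for v w
  proof -
    have "dirderiv v (dirderiv w (\<lambda>x. f x \<bullet> i)) z = dirderiv v (\<lambda>y. dirderiv w f y \<bullet> i) z"
      by (rule fun_cong[OF frechet_derivative_cong_open[OF assms(1,2) 1]])
    also have "\<dots> = dirderiv v (dirderiv w f) z \<bullet> i"
      by (rule frechet_derivative_linear_compose[OF L smooth_on_differentiable[OF smooth_on_dirderiv[OF assms(3)] assms(2)]])
    finally show ?thesis .
  qed
  have "C_k_on 2 W (\<lambda>x. f x \<bullet> i)"
    using smooth_on_linear_compose[OF L assms(1,3)] unfolding smooth_on_def by blast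
  from dirderiv_commute_real[OF assms(1,2) this]
  show "dirderiv a (dirderiv b f) z \<bullet> i = dirderiv b (dirderiv a f) z \<bullet> i" by (simp add: 2)
qed

text \<open>Allowing a polynomial factor in \<open>1/t\<close> makes this class of functions closed under differentiation.\<close>

definition exp_bump :: "real poly \<Rightarrow> real \<Rightarrow> real" where
  "exp_bump p t = (if t > 0 then poly p (1 / t) * exp (- (1 / t)) else 0)"

lemma poly_times_exp_tendsto_0: "((\<lambda>x::real. poly p x * exp (- x)) \<longlongrightarrow> 0) at_top"
proof -
  have "((\<lambda>x::real. \<Sum>i\<le>degree p. coeff p i * (x ^ i / exp x)) \<longlongrightarrow> (\<Sum>i\<le>degree p. coeff p i * 0)) at_top"
    by (intro tendsto_sum tendsto_mult tendsto_const tendsto_power_div_exp_0)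
  then show ?thesis
    by (simp add: poly_altdef exp_minus sum_distrib_right sum_divide_distrib divide_inverse mult.assoc)
qed

text \<open>With x = 1/t one has dx/dt = -x^2, so p(x) exp(-x) has the t-derivative x^2 (p(x) -
  p'(x)) exp(-x); this is the polynomial in the statement. At 0 both sides vanish because the
  exponential beats every polynomial.\<close>

lemma exp_bump_has_real_derivative:
  "(exp_bump p has_real_derivative exp_bump ([:0, 0, 1:] * (p - pderiv p)) t) (at t)"
proof -
  consider "t > 0" | "t < 0" | "t = 0" by linarith
  then show ?thesis
  proof cases
    case 1
    have "((\<lambda>t. poly p (1 / t) * exp (- (1 / t))) has_real_derivative
      exp_bump ([:0, 0, 1:] * (p - pderiv p)) t) (at t)"
      using 1 by (auto intro!: derivative_eq_intros DERIV_chain'[OF _ poly_DERIV]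
          simp: exp_bump_def power2_eq_square field_simps)
    then show ?thesis
      by (rule has_field_derivative_transform_within_open[where S="{0<..}"]) (use 1 in \<open>auto simp: exp_bump_def\<close>)
  next
    case 2
    have "((\<lambda>t. 0) has_real_derivative exp_bump ([:0, 0, 1:] * (p - pderiv p)) t) (at t)"
      using 2 by (simp add: exp_bump_def)
    then show ?thesis
      by (rule has_field_derivative_transform_within_open[where S="{..<0}"]) (use 2 in \<open>auto simp: exp_bump_def\<close>)
  next
    case 3
    have "((\<lambda>h. exp_bump p h / h) \<longlongrightarrow> 0) (at 0)"
    proof (rule filterlim_split_at_real)
      have "\<forall>\<^sub>F h in at_left 0. exp_bump p h / h = 0"
        by (auto simp: eventually_at_filter exp_bump_def)
      then show "((\<lambda>h. exp_bump p h / h) \<longlongrightarrow> 0) (at_left 0)" by (rule tendsto_eventually)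
      \<comment> \<open>With x = 1/h the difference quotient is x p(x) exp(-x): the division by h is
        absorbed into the polynomial.\<close>
      have "((\<lambda>h. poly ([:0, 1:] * p) (inverse h) * exp (- inverse h)) \<longlongrightarrow> 0) (at_right (0::real))"
        by (rule filterlim_compose[OF poly_times_exp_tendsto_0 filterlim_inverse_at_top_right])
      moreover have "\<forall>\<^sub>F h in at_right 0. poly ([:0, 1:] * p) (inverse h) * exp (- inverse h) = exp_bump p h / h"
        by (auto simp: eventually_at_filter exp_bump_def field_simps)
      ultimately show "((\<lambda>h. exp_bump p h / h) \<longlongrightarrow> 0) (at_right 0)"
        using tendsto_cong by fast
    qed
    then show ?thesis using 3 by (simp add: DERIV_def exp_bump_def)
  qed
qed

lemma smooth_on_exp_bump: "smooth_on UNIV (exp_bump p)"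
proof -
  have "C_k_on k UNIV (exp_bump p)" for k
  proof (induction k arbitrary: p)
    case 0
    then show ?case using exp_bump_has_real_derivative DERIV_isCont
      by (metis C_k_on.simps(1) continuous_at_imp_continuous_on)
  next
    case (Suc k)
    show ?case
      by (rule C_k_on_SucI[where f'="\<lambda>t v. exp_bump ([:0, 0, 1:] * (p - pderiv p)) t * v"])
        (use exp_bump_has_real_derivative in \<open>auto simp only: has_field_derivative_def open_UNIV
          intro!: C_k_on_bilinear[OF bounded_bilinear_mult] C_k_on_const Suc.IH\<close>)
  qed
  then show ?thesis by (simp add: smooth_on_def)
qed

text \<open>The squared distance is used because it is smooth at the centre too.
  \<open>exp_bump 1\<close> is the classical function exp(-1/t) for t > 0, extended by 0.\<close>

definition ball_bump :: "'a::euclidean_space \<Rightarrow> real \<Rightarrow> 'a \<Rightarrow> real" where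
  "ball_bump x r z = exp_bump 1 (1 - (z - x) \<bullet> (z - x) / r\<^sup>2)"

lemma smooth_on_ball_bump: "smooth_on UNIV (ball_bump x r)"
proof -
  have l: "smooth_on UNIV (\<lambda>z. z - x)"
    by (intro smooth_on_diff smooth_on_const smooth_on_bounded_linear[where L="\<lambda>z. z"] bounded_linear_ident open_UNIV)
  have "smooth_on UNIV (\<lambda>z. 1 - (z - x) \<bullet> (z - x) / r\<^sup>2)"
    by (intro smooth_on_diff[OF open_UNIV] smooth_on_const
      smooth_on_linear_compose[OF bounded_linear_divide] smooth_on_bilinear[OF bounded_bilinear_inner] l open_UNIV)
  then have "smooth_on UNIV (\<lambda>z. exp_bump 1 (1 - (z - x) \<bullet> (z - x) / r\<^sup>2))"
    by (rule smooth_on_compose[OF open_UNIV open_UNIV subset_UNIV smooth_on_exp_bump])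
  then show ?thesis by (simp add: ball_bump_def[abs_def])
qed

lemma ball_bump_nonneg: "0 \<le> ball_bump x r z"
  by (simp add: ball_bump_def exp_bump_def)

lemma ball_bump_le_1: "ball_bump x r z \<le> 1"
  by (simp add: ball_bump_def exp_bump_def)

lemma ball_bump_eq_0:
  assumes "r > 0" "z \<notin> cball x r" shows "ball_bump x r z = 0"
proof -
  have "r\<^sup>2 \<le> (norm (z - x))\<^sup>2" using assms by (intro power_mono) (auto simp: dist_norm norm_minus_commute)
  then have "1 \<le> (z - x) \<bullet> (z - x) / r\<^sup>2" using assms by (simp add: power2_norm_eq_inner)
  then show ?thesis by (simp add: ball_bump_def exp_bump_def)
qed

text \<open>On the ball of half the radius the argument of \<open>exp_bump 1\<close> is at least 1 -
  1/4 = 3/4, whence the exponent -4/3.\<close>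

lemma ball_bump_ge:
  assumes "r > 0" "z \<in> ball x (r / 2)" shows "ball_bump x r z \<ge> exp (- (4 / 3))"
proof -
  have "(norm (z - x))\<^sup>2 \<le> (r / 2)\<^sup>2" using assms by (intro power_mono) (auto simp: dist_norm norm_minus_commute)
  then have "(z - x) \<bullet> (z - x) / r\<^sup>2 \<le> 1 / 4"
    using assms by (simp add: power2_norm_eq_inner field_simps)
  then have "3 / 4 \<le> 1 - (z - x) \<bullet> (z - x) / r\<^sup>2" by simp
  then show ?thesis unfolding ball_bump_def exp_bump_def by (simp add: field_simps)
qed

section \<open>Levi forms and holomorphic maps\<close>

lemma frechet_derivative_eq: "(f has_derivative D) (at z) \<Longrightarrow> frechet_derivative f (at z) = D"
  using frechet_derivative_at by metis

section \<open>Complex linear, antilinear and sesquilinear expansions\<close>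

lemma axis_ii: "axis j \<i> = \<i> *s (axis j 1 :: complex^'n)"
  by (simp add: vec_eq_iff axis_def)

lemma bounded_linear_cscale: "bounded_linear (\<lambda>v::complex^'n. c *s v)"
  unfolding linear_conv_bounded_linear[symmetric]
  by (rule linearI) (simp_all add: vec_eq_iff algebra_simps)

lemma cscale_eq_scaleR: "c *s v = Re c *\<^sub>R v + Im c *\<^sub>R (\<i> *s (v::complex^'n))"
  by (simp add: vec_eq_iff complex_eq_iff)

lemma complex_linear_cscale:
  fixes f :: "complex^'n \<Rightarrow> complex^'m"
  assumes "linear f" "\<And>v. f (\<i> *s v) = \<i> *s f v"
  shows "f (c *s v) = c *s f v"
  unfolding cscale_eq_scaleR[of c] using assms by (simp add: linear_add linear_cmul)

lemma complex_linear_expand: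
  fixes f :: "complex^'n \<Rightarrow> complex"
  assumes "linear f" "\<And>v. f (\<i> *s v) = \<i> * f v"
  shows "f w = (\<Sum>j\<in>UNIV. w $ j * f (axis j 1))"
proof -
  have c: "f (c *s v) = c * f v" for c v
  proof -
    have "f (c *s v) = complex_of_real (Re c) * f v + complex_of_real (Im c) * (\<i> * f v)"
      unfolding cscale_eq_scaleR[of c]
      by (simp add: linear_add[OF assms(1)] linear_cmul[OF assms(1)] assms(2) scaleR_conv_of_real[where 'a=complex])
    also have "\<dots> = (complex_of_real (Re c) + \<i> * complex_of_real (Im c)) * f v" by (simp add: algebra_simps)
    also have "\<dots> = c * f v" using complex_eq[of c] by simp
    finally show ?thesis .
  qed
  have "f w = f (\<Sum>j\<in>UNIV. w $ j *s axis j 1)" by (simp add: basis_expansion)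
  also have "\<dots> = (\<Sum>j\<in>UNIV. w $ j * f (axis j 1))" by (simp add: linear_sum[OF assms(1)] c)
  finally show ?thesis .
qed

lemma complex_antilinear_expand:
  fixes f :: "complex^'n \<Rightarrow> complex"
  assumes "linear f" "\<And>v. f (\<i> *s v) = - \<i> * f v"
  shows "f w = (\<Sum>j\<in>UNIV. cnj (w $ j) * f (axis j 1))"
proof -
  have "linear (\<lambda>v. cnj (f v))"
    using linear_compose[OF assms(1) bounded_linear.linear[OF bounded_linear_cnj]] by (simp add: o_def)
  then have "cnj (f w) = (\<Sum>j\<in>UNIV. w $ j * cnj (f (axis j 1)))"
    by (rule complex_linear_expand) (simp add: assms(2))
  then have "cnj (cnj (f w)) = cnj (\<Sum>j\<in>UNIV. w $ j * cnj (f (axis j 1)))" by simp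
  then show ?thesis by (simp add: cnj_sum)
qed

text \<open>The \<open>Q\<close> of the proof is, up to a factor, the sesquilinear part of the real
  symmetric form T: complex linear in the first argument, antilinear in the second. On the diagonal
  its imaginary part cancels by symmetry. For T the real Hessian, its values on the axes are 4 times
  the entries of the complex Hessian.\<close>

lemma sesquilinear_part:
  fixes T :: "complex^'n \<Rightarrow> complex^'n \<Rightarrow> real"
  assumes l: "\<And>b. linear (\<lambda>a. T a b)" and sym: "\<And>a b. T a b = T b a"
  shows "(\<Sum>j\<in>UNIV. \<Sum>k\<in>UNIV. (of_real (T (axis j 1) (axis k 1) + T (axis j \<i>) (axis k \<i>))
      + \<i> * of_real (T (axis j 1) (axis k \<i>) - T (axis j \<i>) (axis k 1))) * w $ j * cnj (w $ k))
    = complex_of_real (T w w + T (\<i> *s w) (\<i> *s w))"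
proof -
  define Q where "Q a b = complex_of_real (T a b + T (\<i> *s a) (\<i> *s b)) + \<i> * of_real (T a (\<i> *s b) - T (\<i> *s a) b)" for a b
  have l2: "linear (T a)" for a using l[of a] by (subst (asm) sym) simp
  have ii: "\<i> *s (\<i> *s v) = - v" for v :: "complex^'n" by (simp add: vec_eq_iff)
  have add: "\<i> *s (u + v) = \<i> *s u + \<i> *s v" and sc: "\<i> *s (r *\<^sub>R v) = r *\<^sub>R (\<i> *s v)" for u v :: "complex^'n" and r
    by (simp_all add: vec_eq_iff algebra_simps)
  note Tl = linear_add[OF l] linear_cmul[OF l] linear_neg[OF l] linear_add[OF l2] linear_cmul[OF l2] linear_neg[OF l2]
  have "linear (\<lambda>a. Q a b)" for b
    by (rule linearI) (simp_all add: Q_def add sc Tl scaleR_conv_of_real[where 'a=complex] algebra_simps)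
  moreover have "Q (\<i> *s a) b = \<i> * Q a b" for a b
    by (simp add: Q_def ii Tl algebra_simps)
  ultimately have 1: "Q w b = (\<Sum>j\<in>UNIV. w $ j * Q (axis j 1) b)" for b
    by (rule complex_linear_expand)
  have "linear (Q a)" for a
    by (rule linearI) (simp_all add: Q_def add sc Tl scaleR_conv_of_real[where 'a=complex] algebra_simps)
  moreover have "Q a (\<i> *s b) = - \<i> * Q a b" for a b
    by (simp add: Q_def ii Tl algebra_simps)
  ultimately have 2: "Q a w = (\<Sum>k\<in>UNIV. cnj (w $ k) * Q a (axis k 1))" for a
    by (rule complex_antilinear_expand)
  have "Q w w = (\<Sum>j\<in>UNIV. \<Sum>k\<in>UNIV. Q (axis j 1) (axis k 1) * w $ j * cnj (w $ k))"
    unfolding 1[of w] by (subst 2) (simp add: sum_distrib_left mult_ac)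
  moreover have "Q w w = complex_of_real (T w w + T (\<i> *s w) (\<i> *s w))"
    by (simp add: Q_def sym[of "\<i> *s w" w])
  ultimately show ?thesis by (simp add: Q_def axis_ii)
qed

section \<open>Wirtinger derivatives in terms of real directional derivatives\<close>

lemma dz_cong_open:
  assumes "open W" "z \<in> W" "\<And>x. x \<in> W \<Longrightarrow> f x = g x"
  shows "dz j f z = dz j g z" "dzbar j f z = dzbar j g z"
proof -
  have "frechet_derivative f (at z) = frechet_derivative g (at z)"
    by (rule frechet_derivative_cong_open[OF assms])
  then show "dz j f z = dz j g z" "dzbar j f z = dzbar j g z" by (simp_all only: dz_def dzbar_def)
qed

lemma smooth_on_dz:
  assumes "open W" "smooth_on W f"
  shows "smooth_on W (dz j f)" "smooth_on W (dzbar j f)"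
  unfolding dz_def[abs_def] dzbar_def[abs_def]
  by (intro smooth_on_linear_compose[OF bounded_linear_divide] smooth_on_add smooth_on_diff smooth_on_mult
      smooth_on_const smooth_on_dirderiv assms)+

lemma dirderiv_of_real:
  assumes "u differentiable (at z)"
  shows "dirderiv v (\<lambda>x. complex_of_real (u x)) z = of_real (dirderiv v u z)"
  by (rule frechet_derivative_linear_compose[OF bounded_linear_of_real assms])

lemma dirderiv_dirderiv_of_real:
  assumes "open W" "z \<in> W" "smooth_on W u"
  shows "dirderiv a (dirderiv b (\<lambda>x. complex_of_real (u x))) z = of_real (dirderiv a (dirderiv b u) z)"
proof -
  have "dirderiv a (dirderiv b (\<lambda>x. complex_of_real (u x))) z = dirderiv a (\<lambda>x. complex_of_real (dirderiv b u x)) z"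
    by (rule fun_cong[OF frechet_derivative_cong_open[OF assms(1,2)]])
      (rule dirderiv_of_real[OF smooth_on_differentiable[OF assms(3)]])
  then show ?thesis
    by (simp only: dirderiv_of_real[OF smooth_on_differentiable[OF smooth_on_dirderiv[OF assms(3)] assms(2)]])
qed

lemma smooth_on_of_real: "open W \<Longrightarrow> smooth_on W u \<Longrightarrow> smooth_on W (\<lambda>x. complex_of_real (u x))"
  by (rule smooth_on_linear_compose[OF bounded_linear_of_real])

lemma dirderiv_complex_comb:
  assumes "f differentiable (at z)" "g differentiable (at z)"
  shows "dirderiv v (\<lambda>x. (f x + c * g x) / 2) z = (dirderiv v f z + c * dirderiv v g z) / (2::complex)"
proof -
  have "((\<lambda>x. (f x + c * g x) / 2) has_derivative (\<lambda>v. (dirderiv v f z + c * dirderiv v g z) / 2)) (at z)"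
    using assms unfolding frechet_derivative_works
    by (intro bounded_linear.has_derivative[OF bounded_linear_divide] has_derivative_add has_derivative_mult_right)
  from frechet_derivative_eq[OF this] show ?thesis by (rule fun_cong)
qed

lemma dz_dzbar_smooth:
  assumes "open W" "z \<in> W" "smooth_on W f"
  shows "dz j (dzbar k f) z =
    ((dirderiv (axis j 1) (dirderiv (axis k 1) f) z + dirderiv (axis j \<i>) (dirderiv (axis k \<i>) f) z)
      + \<i> * (dirderiv (axis j 1) (dirderiv (axis k \<i>) f) z - dirderiv (axis j \<i>) (dirderiv (axis k 1) f) z)) / 4"
proof -
  have "dirderiv v (dzbar k f) z = (dirderiv v (dirderiv (axis k 1) f) z + \<i> * dirderiv v (dirderiv (axis k \<i>) f) z) / 2" for v
    unfolding dzbar_def[abs_def]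
    by (rule dirderiv_complex_comb) (rule smooth_on_differentiable[OF smooth_on_dirderiv[OF assms(3)] assms(2)])+
  then show ?thesis by (simp add: dz_def algebra_simps add_divide_distrib diff_divide_distrib)
qed

lemma dzbar_dz_commute:
  assumes "open W" "z \<in> W" "smooth_on W f"
  shows "dzbar k (dz j f) z = dz j (dzbar k f) z"
proof -
  have "dz j f = (\<lambda>x. (dirderiv (axis j 1) f x + (- \<i>) * dirderiv (axis j \<i>) f x) / 2)"
    by (simp add: dz_def[abs_def])
  moreover have "dirderiv v (\<lambda>x. (dirderiv (axis j 1) f x + (- \<i>) * dirderiv (axis j \<i>) f x) / 2) z
      = (dirderiv v (dirderiv (axis j 1) f) z + (- \<i>) * dirderiv v (dirderiv (axis j \<i>) f) z) / 2" for v
    by (rule dirderiv_complex_comb) (rule smooth_on_differentiable[OF smooth_on_dirderiv[OF assms(3)] assms(2)])+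
  ultimately have "dzbar k (dz j f) z =
    ((dirderiv (axis k 1) (dirderiv (axis j 1) f) z + (- \<i>) * dirderiv (axis k 1) (dirderiv (axis j \<i>) f) z) / 2
     + \<i> * ((dirderiv (axis k \<i>) (dirderiv (axis j 1) f) z + (- \<i>) * dirderiv (axis k \<i>) (dirderiv (axis j \<i>) f) z) / 2)) / 2"
    by (simp only: dzbar_def)
  then show ?thesis
    by (simp add: dz_dzbar_smooth[OF assms] dirderiv_commute[OF assms, of "axis j _"]
      algebra_simps add_divide_distrib diff_divide_distrib)
qed

lemma linear_second_dirderiv:
  fixes f :: "'a::real_normed_vector \<Rightarrow> 'b::real_normed_vector"
  assumes "smooth_on W f" "z \<in> W"
  shows "linear (\<lambda>a. dirderiv a (dirderiv b f) z)"
  using smooth_on_linear_frechet[OF smooth_on_dirderiv[OF assms(1)] assms(2)] by simp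

text \<open>The Levi form in direction w is the Laplacian of u along the complex line of w. The 4
  comes from the two halves in \<open>dz\<close> and \<open>dzbar\<close>, the \<pi> from the
  normalisation of dd^c. In this real form it is open to the chain rule.\<close>

lemma herm_form_ddc:
  fixes u :: "complex^'n \<Rightarrow> real"
  assumes "open W" "z \<in> W" "smooth_on W u"
  shows "herm_form (ddc u z) w =
    of_real ((dirderiv w (dirderiv w u) z + dirderiv (\<i> *s w) (dirderiv (\<i> *s w) u) z) / (4 * pi))"
proof -
  let ?T = "\<lambda>a b. dirderiv a (dirderiv b u) z"
  note 2 = dirderiv_dirderiv_of_real[OF assms]
  have "ddc u z $ j $ k = (of_real (?T (axis j 1) (axis k 1) + ?T (axis j \<i>) (axis k \<i>))
      + \<i> * of_real (?T (axis j 1) (axis k \<i>) - ?T (axis j \<i>) (axis k 1))) / (4 * of_real pi)" for j k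
    by (simp add: ddc_def 2 dz_dzbar_smooth[OF assms(1,2) smooth_on_of_real[OF assms(1,3)]])
  then have "herm_form (ddc u z) w = (\<Sum>j\<in>UNIV. \<Sum>k\<in>UNIV. (of_real (?T (axis j 1) (axis k 1) + ?T (axis j \<i>) (axis k \<i>))
      + \<i> * of_real (?T (axis j 1) (axis k \<i>) - ?T (axis j \<i>) (axis k 1))) * w $ j * cnj (w $ k)) / (4 * of_real pi)"
    by (simp add: herm_form_def sum_divide_distrib del: of_real_add of_real_diff)
  also have "\<dots> = of_real (?T w w + ?T (\<i> *s w) (\<i> *s w)) / (4 * of_real pi)"
    by (subst sesquilinear_part) (use linear_second_dirderiv[OF assms(3,2)] dirderiv_commute[OF assms] in auto)
  finally show ?thesis by simp
qed

text \<open>The first term is the Hessian of u along the image directions. The second, first order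
  in u, is the one that spoils positivity in general; for holomorphic G it will drop out of the Levi
  form.\<close>

lemma second_dirderiv_compose:
  fixes G :: "'a::real_normed_vector \<Rightarrow> 'b::euclidean_space" and u :: "'b \<Rightarrow> real"
  assumes "open W" "open W'" "G ` W \<subseteq> W'" "smooth_on W' u" "smooth_on W G" "z \<in> W"
  shows "dirderiv a (dirderiv b (\<lambda>x. u (G x))) z =
    dirderiv (dirderiv a G z) (dirderiv (dirderiv b G z) u) (G z)
      + frechet_derivative u (at (G z)) (dirderiv a (dirderiv b G) z)"
proof -
  have G: "G y \<in> W'" if "y \<in> W" for y using that assms(3) by auto
  \<comment> \<open>The direction \<open>dirderiv b G y\<close> varies with y, so the derivative of
    u is expanded in fixed basis directions before it is differentiated again.\<close>
  have 1: "dirderiv b (\<lambda>x. u (G x)) y = (\<Sum>e\<in>Basis. (dirderiv b G y \<bullet> e) * dirderiv e u (G y))" if y: "y \<in> W" for y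
  proof -
    have "((\<lambda>x. u (G x)) has_derivative (\<lambda>v. frechet_derivative u (at (G y)) (frechet_derivative G (at y) v))) (at y)"
      by (rule has_derivative_compose) (rule smooth_on_has_derivative[OF assms(5) y] smooth_on_has_derivative[OF assms(4) G[OF y]])+
    then have "dirderiv b (\<lambda>x. u (G x)) y = frechet_derivative u (at (G y)) (dirderiv b G y)"
      using frechet_derivative_at by metis
    also have "\<dots> = (\<Sum>e\<in>Basis. (dirderiv b G y \<bullet> e) * dirderiv e u (G y))"
      by (simp only: frechet_derivative_basis[OF smooth_on_differentiable[OF assms(4) G[OF y]], of "dirderiv b G y"] real_scaleR_def)
    finally show ?thesis .
  qed
  let ?D = "\<lambda>v. \<Sum>e\<in>Basis. (dirderiv b G z \<bullet> e) * dirderiv (dirderiv v G z) (dirderiv e u) (G z)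
      + (dirderiv v (dirderiv b G) z \<bullet> e) * dirderiv e u (G z)"
  have "((\<lambda>y. \<Sum>e\<in>Basis. (dirderiv b G y \<bullet> e) * dirderiv e u (G y)) has_derivative ?D) (at z)"
  proof (intro has_derivative_sum has_derivative_mult)
    fix e
    show "((\<lambda>y. dirderiv b G y \<bullet> e) has_derivative (\<lambda>v. dirderiv v (dirderiv b G) z \<bullet> e)) (at z)"
      by (rule bounded_linear.has_derivative[OF bounded_linear_inner_left])
        (rule smooth_on_has_derivative[OF smooth_on_dirderiv[OF assms(5)] assms(6)])
    show "((\<lambda>y. dirderiv e u (G y)) has_derivative (\<lambda>v. dirderiv (dirderiv v G z) (dirderiv e u) (G z))) (at z)"
      by (rule has_derivative_compose)
        (rule smooth_on_has_derivative[OF assms(5,6)] smooth_on_has_derivative[OF smooth_on_dirderiv[OF assms(4)] G[OF assms(6)]])+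
  qed
  then have D: "frechet_derivative (\<lambda>y. \<Sum>e\<in>Basis. (dirderiv b G y \<bullet> e) * dirderiv e u (G y)) (at z) = ?D"
    by (rule frechet_derivative_eq)
  have "dirderiv a (dirderiv b (\<lambda>x. u (G x))) z
      = dirderiv a (\<lambda>y. \<Sum>e\<in>Basis. (dirderiv b G y \<bullet> e) * dirderiv e u (G y)) z"
    by (rule fun_cong[OF frechet_derivative_cong_open[OF assms(1,6) 1]])
  also have "\<dots> = ?D a" by (rule fun_cong[OF D])
  also have "\<dots> = (\<Sum>e\<in>Basis. (dirderiv b G z \<bullet> e) *\<^sub>R dirderiv e (dirderiv (dirderiv a G z) u) (G z))
      + (\<Sum>e\<in>Basis. (dirderiv a (dirderiv b G) z \<bullet> e) *\<^sub>R dirderiv e u (G z))"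
    by (simp add: sum.distrib dirderiv_commute[OF assms(2) G[OF assms(6)] assms(4), of "dirderiv a G z"])
  also have "\<dots> = dirderiv (dirderiv b G z) (dirderiv (dirderiv a G z) u) (G z)
      + frechet_derivative u (at (G z)) (dirderiv a (dirderiv b G) z)"
    unfolding frechet_derivative_basis[OF smooth_on_differentiable[OF assms(4) G[OF assms(6)]], symmetric]
      frechet_derivative_basis[OF smooth_on_differentiable[OF smooth_on_dirderiv[OF assms(4)] G[OF assms(6)]], symmetric]
    by simp
  finally show ?thesis
    by (simp add: dirderiv_commute[OF assms(2) G[OF assms(6)] assms(4), of "dirderiv a G z"])
qed

section \<open>Holomorphic maps and the pullback of Levi forms\<close>

lemma holo_map_smooth_on: "holo_map W F \<Longrightarrow> smooth_on W F"
  by (rule smooth_on_vec) (auto simp: holo_map_def holo_on_def)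

text \<open>The Cauchy-Riemann equations are complex linearity on the coordinate axes. Every vector
  is a real combination of \<open>axis j 1\<close> and \<open>axis j \<i>\<close>, so real linearity
  does the rest.\<close>

lemma holo_map_dirderiv_cscale:
  assumes "holo_map W F" "z \<in> W"
  shows "frechet_derivative F (at z) (c *s w) = c *s frechet_derivative F (at z) w"
proof -
  have sm: "smooth_on W F" by (rule holo_map_smooth_on[OF assms(1)])
  have lin: "linear (frechet_derivative F (at z))" using smooth_on_linear_frechet[OF sm assms(2)] .
  have comp: "frechet_derivative F (at z) v $ i = frechet_derivative (\<lambda>x. F x $ i) (at z) v" for v i
    using frechet_derivative_linear_compose[OF bounded_linear_vec_nth smooth_on_differentiable[OF sm assms(2)]] by metis
  have "frechet_derivative F (at z) (axis j \<i>) $ i = \<i> * frechet_derivative F (at z) (axis j 1) $ i" for i j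
  proof -
    have "dzbar j (\<lambda>x. F x $ i) z = 0" using assms by (auto simp: holo_map_def holo_on_def)
    then have "frechet_derivative F (at z) (axis j 1) $ i + \<i> * frechet_derivative F (at z) (axis j \<i>) $ i = 0"
      by (simp add: dzbar_def comp)
    then have "\<i> * (frechet_derivative F (at z) (axis j 1) $ i + \<i> * frechet_derivative F (at z) (axis j \<i>) $ i) = 0" by simp
    then show ?thesis by (simp add: algebra_simps)
  qed
  then have ax: "frechet_derivative F (at z) (axis j \<i>) = \<i> *s frechet_derivative F (at z) (axis j 1)" for j
    by (simp add: vec_eq_iff)
  have "frechet_derivative F (at z) (\<i> *s v) = \<i> *s frechet_derivative F (at z) v" for v
  proof -
    have e1: "\<i> *s v = (\<Sum>j\<in>UNIV. Re (v $ j) *\<^sub>R axis j \<i> - Im (v $ j) *\<^sub>R axis j 1)"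
      by (simp add: vec_eq_iff axis_def complex_eq_iff if_distrib[of Re] if_distrib[of Im] if_distrib[of "\<lambda>x. _ * x"] sum_subtractf cong: if_cong)
    have e2: "v = (\<Sum>j\<in>UNIV. Re (v $ j) *\<^sub>R axis j 1 + Im (v $ j) *\<^sub>R axis j \<i>)"
      by (simp add: vec_eq_iff axis_def complex_eq_iff if_distrib[of Re] if_distrib[of Im] if_distrib[of "\<lambda>x. _ * x"] sum.distrib cong: if_cong)
    have "frechet_derivative F (at z) v = (\<Sum>j\<in>UNIV. Re (v $ j) *\<^sub>R frechet_derivative F (at z) (axis j 1) + Im (v $ j) *\<^sub>R frechet_derivative F (at z) (axis j \<i>))"
      by (subst e2) (simp add: linear_sum[OF lin] linear_add[OF lin] linear_cmul[OF lin])
    then have "\<i> *s frechet_derivative F (at z) v = (\<Sum>j\<in>UNIV. Re (v $ j) *\<^sub>R (\<i> *s frechet_derivative F (at z) (axis j 1)) + Im (v $ j) *\<^sub>R (\<i> *s frechet_derivative F (at z) (axis j \<i>)))"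
      by (simp add: vec_eq_iff sum_distrib_left algebra_simps)
    moreover have "frechet_derivative F (at z) (\<i> *s v) = (\<Sum>j\<in>UNIV. Re (v $ j) *\<^sub>R frechet_derivative F (at z) (axis j \<i>) - Im (v $ j) *\<^sub>R frechet_derivative F (at z) (axis j 1))"
      by (subst e1) (simp add: linear_sum[OF lin] linear_diff[OF lin] linear_cmul[OF lin])
    ultimately show ?thesis by (simp add: ax vec_eq_iff)
  qed
  then show ?thesis by (rule complex_linear_cscale[OF lin])
qed

text \<open>Complex linearity extracts \<i> from the inner derivative only; after exchanging the
  order the other \<i> is inner as well, and the two multiply to -1.\<close>

lemma holo_map_second_dirderiv_ii:
  assumes "holo_map W G" "open W" "z \<in> W"
  shows "dirderiv (\<i> *s w) (dirderiv (\<i> *s w) G) z = - dirderiv w (dirderiv w G) z"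
proof -
  have sm: "smooth_on W G" by (rule holo_map_smooth_on[OF assms(1)])
  have 1: "dirderiv v (dirderiv (\<i> *s w) G) z = \<i> *s dirderiv v (dirderiv w G) z" for v
  proof -
    have "dirderiv v (dirderiv (\<i> *s w) G) z = dirderiv v (\<lambda>x. \<i> *s dirderiv w G x) z"
      by (rule fun_cong[OF frechet_derivative_cong_open[OF assms(2,3)]]) (rule holo_map_dirderiv_cscale[OF assms(1)])
    also have "\<dots> = \<i> *s dirderiv v (dirderiv w G) z"
      by (rule frechet_derivative_linear_compose[OF bounded_linear_cscale smooth_on_differentiable[OF smooth_on_dirderiv[OF sm] assms(3)]])
    finally show ?thesis .
  qed
  have "dirderiv (\<i> *s w) (dirderiv (\<i> *s w) G) z = \<i> *s dirderiv (\<i> *s w) (dirderiv w G) z"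
    by (rule 1)
  also have "\<dots> = \<i> *s dirderiv w (dirderiv (\<i> *s w) G) z"
    by (simp only: dirderiv_commute[OF assms(2,3) sm, of "\<i> *s w" w])
  also have "\<dots> = - dirderiv w (dirderiv w G) z" unfolding 1 by (simp add: vec_eq_iff)
  finally show ?thesis .
qed

text \<open>The terms containing second derivatives of G cancel between w and \<i> w, and complex
  linearity turns the remaining ones into the Levi form of u at the image of w.\<close>

lemma herm_form_ddc_compose:
  fixes u :: "complex^'m \<Rightarrow> real" and G :: "complex^'n \<Rightarrow> complex^'m"
  assumes "open W" "open W'" "G ` W \<subseteq> W'" "smooth_on W' u" "holo_map W G" "z \<in> W"
  shows "herm_form (ddc (\<lambda>x. u (G x)) z) w = herm_form (ddc u (G z)) (frechet_derivative G (at z) w)"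
proof -
  have sm: "smooth_on W G" by (rule holo_map_smooth_on[OF assms(5)])
  have Gz: "G z \<in> W'" using assms by auto
  have lin: "linear (frechet_derivative u (at (G z)))" using smooth_on_linear_frechet[OF assms(4) Gz] .
  have smc: "smooth_on W (\<lambda>x. u (G x))" by (rule smooth_on_compose[OF assms(1-4) sm])
  show ?thesis
    unfolding herm_form_ddc[OF assms(1,6) smc] herm_form_ddc[OF assms(2) Gz assms(4)]
      second_dirderiv_compose[OF assms(1-4) sm assms(6)] holo_map_dirderiv_cscale[OF assms(5,6)]
      holo_map_second_dirderiv_ii[OF assms(5,1,6)] linear_neg[OF lin] by simp
qed

section \<open>Integration by parts\<close>

lemma integrable_compact_support:
  fixes f :: "'a::euclidean_space \<Rightarrow> 'b::{banach, second_countable_topology}"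
  assumes "continuous_on UNIV f" "compact K" "\<And>x. x \<notin> K \<Longrightarrow> f x = 0"
  shows "integrable lborel f"
proof -
  have "integrable lborel (\<lambda>x. indicator K x *\<^sub>R f x)"
    using assms(1,2) by (intro borel_integrable_compact) (auto intro: continuous_on_subset)
  moreover have "(\<lambda>x. indicator K x *\<^sub>R f x) = f" using assms(3) by (auto simp: indicator_def)
  ultimately show ?thesis by simp
qed

lemma dirderiv_zero_off:
  assumes "closed K" "\<And>x. x \<notin> K \<Longrightarrow> f x = 0" "x \<notin> K"
  shows "dirderiv v f x = 0"
proof -
  have "frechet_derivative f (at x) = frechet_derivative (\<lambda>_. 0) (at x)"
    by (rule frechet_derivative_cong_open[of "- K"]) (use assms in auto)
  then show ?thesis by (simp add: frechet_derivative_const)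
qed

text \<open>By translation invariance of Lebesgue measure every difference quotient of f has
  integral 0; dominated convergence carries this over to the derivative.\<close>

lemma integral_dirderiv_eq_0_real:
  fixes f :: "'a::euclidean_space \<Rightarrow> real"
  assumes sm: "smooth_on UNIV f" and K: "compact K" and off: "\<And>x. x \<notin> K \<Longrightarrow> f x = 0"
  shows "(\<integral>x. dirderiv v f x \<partial>lborel) = 0"
proof -
  let ?F = "dirderiv v f"
  have Fc: "continuous_on UNIV ?F" by (rule smooth_on_continuous_on[OF smooth_on_dirderiv[OF sm]])
  have fc: "continuous_on UNIV f" by (rule smooth_on_continuous_on[OF sm])
  have Foff: "?F x = 0" if "x \<notin> K" for x
    by (rule dirderiv_zero_off[OF compact_imp_closed[OF K] off that])
  have der: "((\<lambda>s. f (x + s *\<^sub>R v)) has_real_derivative ?F (x + s *\<^sub>R v)) (at s)" for x s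
    by (rule has_real_derivative_along_line[OF smooth_on_differentiable[OF sm UNIV_I]])
  have "bounded (?F ` K)"
    by (intro compact_imp_bounded compact_continuous_image continuous_on_subset[OF Fc] K subset_UNIV)
  then obtain B where B: "B > 0" "\<And>x. x \<in> K \<Longrightarrow> norm (?F x) \<le> B" unfolding bounded_pos by auto
  then have B': "norm (?F x) \<le> B" for x using Foff[of x] by (cases "x \<in> K") auto
  obtain R where R: "\<And>x. x \<in> K \<Longrightarrow> norm x \<le> R" using compact_imp_bounded[OF K] unfolding bounded_iff by auto
  define t where "t n = inverse (real (Suc n))" for n
  have t: "0 < t n" "t n \<le> 1" for n by (auto simp: t_def field_simps)
  define s where "s n x = (f (x + t n *\<^sub>R v) - f x) / t n" for n x
  have fm[measurable]: "f \<in> borel_measurable borel" using fc by (rule borel_measurable_continuous_onI)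
  have Fm[measurable]: "?F \<in> borel_measurable borel" using Fc by (rule borel_measurable_continuous_onI)
  have fi: "integrable lborel f" by (rule integrable_compact_support[OF fc K off])
  have s0: "(\<integral>x. s n x \<partial>lborel) = 0" for n
  proof -
    have d: "distr lborel borel ((+) (t n *\<^sub>R v)) = lborel" by (rule lborel_distr_plus)
    have "integrable (distr lborel borel ((+) (t n *\<^sub>R v))) f" using fi d by simp
    then have i1: "integrable lborel (\<lambda>x. f (t n *\<^sub>R v + x))" by (subst (asm) integrable_distr_eq) auto
    have "(\<integral>x. f x \<partial>lborel) = (\<integral>x. f x \<partial>distr lborel borel ((+) (t n *\<^sub>R v)))" by (simp add: d)
    also have "\<dots> = (\<integral>x. f (t n *\<^sub>R v + x) \<partial>lborel)" by (subst integral_distr) auto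
    finally show ?thesis using i1 fi by (simp add: s_def add.commute)
  qed
  have "(\<lambda>n. \<integral>x. s n x \<partial>lborel) \<longlonglongrightarrow> (\<integral>x. ?F x \<partial>lborel)"
  proof (rule integral_dominated_convergence)
    show "?F \<in> borel_measurable lborel" by simp
    show "s n \<in> borel_measurable lborel" for n unfolding s_def by measurable
    \<comment> \<open>The steps \<open>t n\<close> are at most 1, so all difference quotients vanish
      outside one ball containing K and its translates; by the mean value theorem they are bounded
      by the supremum B of the derivative.\<close>
    let ?w = "\<lambda>x. indicator (cball 0 (R + norm v)) x *\<^sub>R B"
    show "integrable lborel ?w" by (intro borel_integrable_compact) auto
    show "AE x in lborel. (\<lambda>n. s n x) \<longlonglongrightarrow> ?F x"
    proof (rule AE_I2)
      fix x
      have "((\<lambda>h. (f (x + (0 + h) *\<^sub>R v) - f (x + 0 *\<^sub>R v)) / h) \<longlongrightarrow> ?F x) (at 0)"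
        using der[of x 0] by (simp add: DERIV_def)
      moreover have "filterlim t (at 0) sequentially"
        unfolding filterlim_at t_def using LIMSEQ_inverse_real_of_nat by auto
      ultimately show "(\<lambda>n. s n x) \<longlonglongrightarrow> ?F x"
        unfolding s_def by (auto dest: filterlim_compose)
    qed
    show "AE x in lborel. norm (s n x) \<le> ?w x" for n
    proof (rule AE_I2)
      fix x
      show "norm (s n x) \<le> ?w x"
      proof (cases "x \<in> cball 0 (R + norm v)")
        case True
        have "norm (f (x + t n *\<^sub>R v) - f (x + 0 *\<^sub>R v)) \<le> B * norm (t n - 0)"
        proof (rule differentiable_bound[of UNIV])
          fix h show "((\<lambda>s. f (x + s *\<^sub>R v)) has_derivative (*) (?F (x + h *\<^sub>R v))) (at h within UNIV)"
            using der[of x h] by (simp add: has_field_derivative_def)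
          show "onorm ((*) (?F (x + h *\<^sub>R v))) \<le> B"
            by (rule onorm_le) (use B' in \<open>simp add: abs_mult mult_right_mono\<close>)
        qed auto
        then show ?thesis using True t[of n] by (simp add: s_def field_simps)
      next
        case False
        then have x: "norm x > R + norm v" by (simp add: dist_norm)
        have "norm (x + t n *\<^sub>R v) \<ge> norm x - norm (t n *\<^sub>R v)" by (metis norm_diff_ineq)
        moreover have "norm (t n *\<^sub>R v) \<le> norm v" using t[of n] by (simp add: mult_left_le_one_le)
        ultimately have "x + t n *\<^sub>R v \<notin> K" using R x by fastforce
        moreover have "x \<notin> K" using R[of x] x norm_ge_zero[of v] by linarith
        ultimately show ?thesis using False off by (simp add: s_def)
      qed
    qed
  qed
  then have "(\<lambda>n. 0) \<longlonglongrightarrow> (\<integral>x. ?F x \<partial>lborel)" by (simp add: s0)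
  then show ?thesis using LIMSEQ_unique tendsto_const by blast
qed

text \<open>Whatever f does outside W is harmless: W and the complement of K cover the space, and on
  the latter the product is 0. This extends objects defined in a chart to the whole space once they
  are multiplied by a bump function.\<close>

lemma smooth_on_UNIV_bilinear:
  assumes P: "bounded_bilinear P" and "open W" "closed K" "K \<subseteq> W" "smooth_on W f" "smooth_on UNIV g"
    and off: "\<And>x. x \<notin> K \<Longrightarrow> g x = 0"
  shows "smooth_on UNIV (\<lambda>x. P (f x) (g x))"
proof (rule smooth_on_local)
  fix z
  show "\<exists>V. open V \<and> z \<in> V \<and> smooth_on V (\<lambda>x. P (f x) (g x))"
  proof (cases "z \<in> W")
    case True
    have "smooth_on W (\<lambda>x. P (f x) (g x))"
      by (rule smooth_on_bilinear[OF assms(1,2,5) smooth_on_subset[OF assms(6) subset_UNIV]])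
    with True assms(2) show ?thesis by blast
  next
    case False
    have "smooth_on (- K) (\<lambda>x. P (f x) (g x))"
      by (subst smooth_on_cong[where g="\<lambda>_. 0"])
        (use assms(3) bounded_bilinear.zero_right[OF P] in \<open>simp_all add: off smooth_on_const open_Compl\<close>)
    then show ?thesis using False assms by (intro exI[of _ "- K"]) auto
  qed
qed

lemmas smooth_on_UNIV_mult = smooth_on_UNIV_bilinear[OF bounded_bilinear_mult]

lemma integral_dirderiv_eq_0:
  fixes f :: "'a::euclidean_space \<Rightarrow> complex"
  assumes sm: "smooth_on UNIV f" and K: "compact K" and off: "\<And>x. x \<notin> K \<Longrightarrow> f x = 0"
  shows "integrable lborel (dirderiv v f)" "(\<integral>x. dirderiv v f x \<partial>lborel) = 0"
proof -
  show i: "integrable lborel (dirderiv v f)"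
    by (rule integrable_compact_support[OF smooth_on_continuous_on[OF smooth_on_dirderiv[OF sm]] K])
      (rule dirderiv_zero_off[OF compact_imp_closed[OF K] off])
  have L: "dirderiv v (\<lambda>x. L (f x)) = (\<lambda>x. L (dirderiv v f x))" if "bounded_linear L" for L :: "complex \<Rightarrow> real"
    using frechet_derivative_linear_compose[OF that smooth_on_differentiable[OF sm UNIV_I]] by auto
  have Z: "(\<integral>x. L (dirderiv v f x) \<partial>lborel) = 0" if "bounded_linear L" for L :: "complex \<Rightarrow> real"
    using integral_dirderiv_eq_0_real[OF smooth_on_linear_compose[OF that open_UNIV sm] K, of v]
    by (simp add: L[OF that] off linear_0[OF bounded_linear.linear[OF that]])
  show "(\<integral>x. dirderiv v f x \<partial>lborel) = 0"
    using Z[OF bounded_linear_Re] Z[OF bounded_linear_Im] i by (simp add: complex_eq_iff)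
qed

lemma dirderiv_mult:
  fixes f g :: "'a::real_normed_vector \<Rightarrow> complex"
  assumes "f differentiable (at x)" "g differentiable (at x)"
  shows "dirderiv v (\<lambda>x. f x * g x) x = f x * dirderiv v g x + dirderiv v f x * g x"
proof -
  have "((\<lambda>x. f x * g x) has_derivative (\<lambda>v. f x * dirderiv v g x + dirderiv v f x * g x)) (at x)"
    using assms unfolding frechet_derivative_works by (rule has_derivative_mult)
  from frechet_derivative_eq[OF this] show ?thesis by (rule fun_cong)
qed

lemma integration_by_parts_dirderiv:
  fixes f g :: "complex^'n \<Rightarrow> complex"
  assumes W: "open W" and K: "compact K" "K \<subseteq> W" and f: "smooth_on W f" and g: "smooth_on UNIV g"
    and off: "\<And>x. x \<notin> K \<Longrightarrow> g x = 0"
  shows "integrable lborel (\<lambda>x. f x * dirderiv v g x)" "integrable lborel (\<lambda>x. dirderiv v f x * g x)"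
    "(\<integral>x. f x * dirderiv v g x \<partial>lborel) = - (\<integral>x. dirderiv v f x * g x \<partial>lborel)"
proof -
  note cl = compact_imp_closed[OF K(1)]
  have goff: "dirderiv v g x = 0" if "x \<notin> K" for x by (rule dirderiv_zero_off[OF cl off that])
  have "smooth_on UNIV (\<lambda>x. f x * dirderiv v g x)"
    by (rule smooth_on_UNIV_mult[OF W cl K(2) f smooth_on_dirderiv[OF g] goff])
  from integrable_compact_support[OF smooth_on_continuous_on[OF this] K(1)]
  show i1: "integrable lborel (\<lambda>x. f x * dirderiv v g x)" using goff by simp
  have "smooth_on UNIV (\<lambda>x. dirderiv v f x * g x)"
    by (rule smooth_on_UNIV_mult[OF W cl K(2) smooth_on_dirderiv[OF f] g off])
  from integrable_compact_support[OF smooth_on_continuous_on[OF this] K(1)]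
  show i2: "integrable lborel (\<lambda>x. dirderiv v f x * g x)" using off by simp
  have fg: "smooth_on UNIV (\<lambda>x. f x * g x)" by (rule smooth_on_UNIV_mult[OF W cl K(2) f g off])
  have "dirderiv v (\<lambda>x. f x * g x) x = f x * dirderiv v g x + dirderiv v f x * g x" for x
  proof (cases "x \<in> W")
    case True
    then show ?thesis
      by (intro dirderiv_mult smooth_on_differentiable[OF f] smooth_on_differentiable[OF g] UNIV_I)
  next
    \<comment> \<open>Here f need not be differentiable, but near x the product is identically
      0.\<close>
    case False
    then have x: "x \<notin> K" using K by auto
    have "dirderiv v (\<lambda>x. f x * g x) x = 0" by (rule dirderiv_zero_off[OF cl _ x]) (simp add: off)
    then show ?thesis using goff[OF x] off[OF x] by simp
  qed
  moreover have "(\<integral>x. dirderiv v (\<lambda>x. f x * g x) x \<partial>lborel) = 0"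
    by (rule integral_dirderiv_eq_0(2)[OF fg K(1)]) (simp add: off)
  ultimately have "(\<integral>x. f x * dirderiv v g x + dirderiv v f x * g x \<partial>lborel) = 0" by simp
  then show "(\<integral>x. f x * dirderiv v g x \<partial>lborel) = - (\<integral>x. dirderiv v f x * g x \<partial>lborel)"
    using i1 i2 by (simp add: add_eq_0_iff)
qed

lemma integration_by_parts_dz:
  fixes f g :: "complex^'n \<Rightarrow> complex"
  assumes "open W" "compact K" "K \<subseteq> W" "smooth_on W f" "smooth_on UNIV g" "\<And>x. x \<notin> K \<Longrightarrow> g x = 0"
  shows "integrable lborel (\<lambda>x. f x * dz j g x)" "integrable lborel (\<lambda>x. dz j f x * g x)"
    "(\<integral>x. f x * dz j g x \<partial>lborel) = - (\<integral>x. dz j f x * g x \<partial>lborel)"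
    "integrable lborel (\<lambda>x. f x * dzbar j g x)" "integrable lborel (\<lambda>x. dzbar j f x * g x)"
    "(\<integral>x. f x * dzbar j g x \<partial>lborel) = - (\<integral>x. dzbar j f x * g x \<partial>lborel)"
proof -
  note P = integration_by_parts_dirderiv[OF assms]
  have e: "(\<lambda>x. f x * dz j g x) = (\<lambda>x. (f x * dirderiv (axis j 1) g x - \<i> * (f x * dirderiv (axis j \<i>) g x)) / 2)"
    "(\<lambda>x. dz j f x * g x) = (\<lambda>x. (dirderiv (axis j 1) f x * g x - \<i> * (dirderiv (axis j \<i>) f x * g x)) / 2)"
    "(\<lambda>x. f x * dzbar j g x) = (\<lambda>x. (f x * dirderiv (axis j 1) g x + \<i> * (f x * dirderiv (axis j \<i>) g x)) / 2)"
    "(\<lambda>x. dzbar j f x * g x) = (\<lambda>x. (dirderiv (axis j 1) f x * g x + \<i> * (dirderiv (axis j \<i>) f x * g x)) / 2)"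
    by (auto simp: dz_def dzbar_def fun_eq_iff algebra_simps)
  show "integrable lborel (\<lambda>x. f x * dz j g x)" "integrable lborel (\<lambda>x. dz j f x * g x)"
    "integrable lborel (\<lambda>x. f x * dzbar j g x)" "integrable lborel (\<lambda>x. dzbar j f x * g x)"
    unfolding e using P(1,2) by auto
  show "(\<integral>x. f x * dz j g x \<partial>lborel) = - (\<integral>x. dz j f x * g x \<partial>lborel)"
    "(\<integral>x. f x * dzbar j g x \<partial>lborel) = - (\<integral>x. dzbar j f x * g x \<partial>lborel)"
    unfolding e using P by (simp_all add: algebra_simps diff_divide_distrib add_divide_distrib)
qed

lemma integral_mult_dz_dzbar:
  fixes f g :: "complex^'n \<Rightarrow> complex"
  assumes W: "open W" and K: "compact K" "K \<subseteq> W" and f: "smooth_on W f" and g: "smooth_on UNIV g"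
    and off: "\<And>x. x \<notin> K \<Longrightarrow> g x = 0"
  shows "integrable lborel (\<lambda>x. f x * dz j (dzbar k g) x)" "integrable lborel (\<lambda>x. dz j (dzbar k f) x * g x)"
    "(\<integral>x. f x * dz j (dzbar k g) x \<partial>lborel) = (\<integral>x. dz j (dzbar k f) x * g x \<partial>lborel)"
proof -
  have off': "dzbar k g x = 0" if "x \<notin> K" for x
    using dirderiv_zero_off[OF compact_imp_closed[OF K(1)] off that] by (simp add: dzbar_def)
  note P = integration_by_parts_dz[OF W K f smooth_on_dz(2)[OF open_UNIV g] off', of j]
  note Q = integration_by_parts_dz[OF W K smooth_on_dz(1)[OF W f, of j] g off, of k]
  \<comment> \<open>Integrating by parts first in \<open>dz\<close> and then in \<open>dzbar\<close>
    leaves the derivatives of f in the wrong order. They commute in W, and off K the factor g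
    vanishes.\<close>
  have e: "(\<lambda>x. dzbar k (dz j f) x * g x) = (\<lambda>x. dz j (dzbar k f) x * g x)"
  proof
    fix x
    show "dzbar k (dz j f) x * g x = dz j (dzbar k f) x * g x"
      by (cases "x \<in> K") (use dzbar_dz_commute[OF W _ f] K off in auto)
  qed
  show "integrable lborel (\<lambda>x. f x * dz j (dzbar k g) x)" by (rule P(1))
  show "integrable lborel (\<lambda>x. dz j (dzbar k f) x * g x)" using Q(5) unfolding e by blast
  show "(\<integral>x. f x * dz j (dzbar k g) x \<partial>lborel) = (\<integral>x. dz j (dzbar k f) x * g x \<partial>lborel)"
    using P(3) Q(6) unfolding e by simp
qed

lemma smooth_on_matrix_entry:
  fixes B :: "'a::real_normed_vector \<Rightarrow> complex^'n^'m"
  assumes "open W" "smooth_on W B" shows "smooth_on W (\<lambda>z. B z $ j $ k)"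
  by (rule smooth_on_linear_compose[OF bounded_linear_compose[OF bounded_linear_vec_nth bounded_linear_vec_nth] assms])

text \<open>For a smooth potential the derivatives can be moved back from the test form. This is
  meant for \<omega>; the weights of the metrics are not smooth, and their pairing is only ever
  compared with that of \<omega>.\<close>

lemma ddc_pairing_eq:
  fixes u :: "complex^'n \<Rightarrow> real"
  assumes W: "open W" and u: "smooth_on W u" and B: "smooth_on UNIV B" "compact_support_in W B"
  shows "ddc_pairing u B = (\<integral>z. Re (\<Sum>j\<in>UNIV. \<Sum>k\<in>UNIV. ddc u z $ j $ k * B z $ j $ k) \<partial>lborel)"
proof -
  obtain K where K: "compact K" "K \<subseteq> W" and off: "\<And>z. z \<notin> K \<Longrightarrow> B z = 0"
    using B(2) unfolding compact_support_in_def by auto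
  let ?u = "\<lambda>x. complex_of_real (u x)"
  let ?b = "\<lambda>j k x. B x $ j $ k"
  note P = integral_mult_dz_dzbar[OF W K smooth_on_of_real[OF W u] smooth_on_matrix_entry[OF open_UNIV B(1)]]
  have P1: "integrable lborel (\<lambda>x. ?u x * dz j (dzbar k (?b j k)) x)"
    and P2: "integrable lborel (\<lambda>x. dz j (dzbar k ?u) x * ?b j k x)"
    and P3: "(\<integral>x. ?u x * dz j (dzbar k (?b j k)) x \<partial>lborel) = (\<integral>x. dz j (dzbar k ?u) x * ?b j k x \<partial>lborel)" for j k
    using P[of j k j k] off by simp_all
  have "ddc_pairing u B = (\<integral>z. Re (\<Sum>j\<in>UNIV. \<Sum>k\<in>UNIV. ?u z * dz j (dzbar k (?b j k)) z) \<partial>lborel) / pi"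
    by (simp add: ddc_pairing_def sum_distrib_left)
  also have "(\<integral>z. Re (\<Sum>j\<in>UNIV. \<Sum>k\<in>UNIV. ?u z * dz j (dzbar k (?b j k)) z) \<partial>lborel)
    = Re (\<Sum>j\<in>UNIV. \<Sum>k\<in>UNIV. \<integral>z. ?u z * dz j (dzbar k (?b j k)) z \<partial>lborel)"
    using P1 by (subst integral_Re) (auto simp: Bochner_Integration.integral_sum)
  also have "\<dots> = Re (\<Sum>j\<in>UNIV. \<Sum>k\<in>UNIV. \<integral>z. dz j (dzbar k ?u) z * ?b j k z \<partial>lborel)" by (simp only: P3)
  also have "\<dots> = (\<integral>z. Re (\<Sum>j\<in>UNIV. \<Sum>k\<in>UNIV. dz j (dzbar k ?u) z * ?b j k z) \<partial>lborel)"
    using P2 by (subst integral_Re) (auto simp: Bochner_Integration.integral_sum)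
  also have "\<dots> / pi = (\<integral>z. Re (\<Sum>j\<in>UNIV. \<Sum>k\<in>UNIV. dz j (dzbar k ?u) z * ?b j k z) / pi \<partial>lborel)" by simp
  also have "\<dots> = (\<integral>z. Re (\<Sum>j\<in>UNIV. \<Sum>k\<in>UNIV. ddc u z $ j $ k * B z $ j $ k) \<partial>lborel)"
    by (intro Bochner_Integration.integral_cong refl)
      (simp add: ddc_def sum_divide_distrib mult.commute)
  finally show ?thesis .
qed

section \<open>Positive Hermitian matrices\<close>

text \<open>The real part of \<open>herm_form\<close> sees only the Hermitian part of H, so the
  symmetry has to be demanded separately.\<close>

definition herm_pos :: "complex^'n^'n \<Rightarrow> bool" where
  "herm_pos H \<longleftrightarrow> (\<forall>j k. H $ k $ j = cnj (H $ j $ k)) \<and> (\<forall>w. w \<noteq> 0 \<longrightarrow> Re (herm_form H w) > 0)"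

lemma herm_pos_hermitian: "herm_pos H \<Longrightarrow> H $ k $ j = cnj (H $ j $ k)"
  unfolding herm_pos_def by blast

lemma herm_form_real:
  assumes "\<And>j k. H $ k $ j = cnj (H $ j $ k)"
  shows "herm_form H w \<in> \<real>"
proof -
  have "cnj (herm_form H w) = (\<Sum>j\<in>UNIV. \<Sum>k\<in>UNIV. H $ k $ j * w $ k * cnj (w $ j))"
    by (simp add: herm_form_def cnj_sum assms[symmetric] mult_ac)
  also have "\<dots> = herm_form H w" unfolding herm_form_def by (rule sum.swap)
  finally show ?thesis by (metis Reals_cnj_iff)
qed

lemma det_cnj: "cnj (det A) = det (\<chi> i j. cnj (A $ i $ j))"
  by (simp add: det_def cnj_sum cnj_prod)

lemma det_hermitian_real:
  assumes "\<And>j k. H $ k $ j = cnj (H $ j $ k)"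
  shows "det H \<in> \<real>"
proof -
  have "(\<chi> i j. cnj (H $ i $ j)) = transpose H"
    by (simp add: vec_eq_iff transpose_def assms[symmetric])
  then have "cnj (det H) = det H" by (simp add: det_cnj)
  then show ?thesis by (metis Reals_cnj_iff)
qed

lemma herm_pos_det_nz:
  assumes "herm_pos H" shows "det H \<noteq> 0"
proof
  assume "det H = 0"
  \<comment> \<open>\<open>herm_form\<close> contracts the first index of H with w, so the kernel
    vector that makes the form vanish is one of the transpose.\<close>
  then have "\<not> invertible (transpose H)" by (simp add: invertible_det_nz)
  then obtain w where w: "w \<noteq> 0" "transpose H *v w = 0"
    unfolding invertible_left_inverse matrix_left_invertible_ker by auto
  have "herm_form H w = (\<Sum>k\<in>UNIV. (transpose H *v w) $ k * cnj (w $ k))"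
    unfolding herm_form_def
    by (subst sum.swap) (simp add: matrix_vector_mult_def transpose_def sum_distrib_right)
  then have "herm_form H w = 0" using w by simp
  then show False using assms w unfolding herm_pos_def by force
qed

lemma herm_pos_segment:
  assumes "herm_pos H" "0 \<le> t" "t \<le> 1"
  shows "herm_pos ((1 - t) *\<^sub>R mat 1 + t *\<^sub>R H)"
proof -
  have f: "herm_form ((1 - t) *\<^sub>R mat 1 + t *\<^sub>R H) w
      = of_real (1 - t) * (\<Sum>j\<in>UNIV. w $ j * cnj (w $ j)) + of_real t * herm_form H w" for w
  proof -
    have "herm_form ((1 - t) *\<^sub>R mat 1 + t *\<^sub>R H) w =
      (\<Sum>j\<in>UNIV. \<Sum>k\<in>UNIV. of_real (1 - t) * ((if j = k then w $ j * cnj (w $ k) else 0)) + of_real t * (H $ j $ k * w $ j * cnj (w $ k)))"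
      unfolding herm_form_def by (intro sum.cong refl) (simp add: mat_def scaleR_conv_of_real[where 'a=complex] algebra_simps)
    also have "\<dots> = of_real (1 - t) * (\<Sum>j\<in>UNIV. \<Sum>k\<in>UNIV. if j = k then w $ j * cnj (w $ k) else 0) + of_real t * herm_form H w"
      unfolding herm_form_def sum.distrib sum_distrib_left by simp
    also have "(\<Sum>j\<in>UNIV. \<Sum>k\<in>UNIV. if j = k then w $ j * cnj (w $ k) else 0) = (\<Sum>j\<in>UNIV. w $ j * cnj (w $ j))"
      by simp
    finally show ?thesis .
  qed
  have "Re (herm_form ((1 - t) *\<^sub>R mat 1 + t *\<^sub>R H) w) > 0" if w: "w \<noteq> 0" for w
  proof -
    have s: "(\<Sum>j\<in>UNIV. w $ j * cnj (w $ j)) = of_real ((norm w)\<^sup>2)"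
      by (simp add: complex_norm_square[symmetric] norm_vec_def L2_set_def sum_nonneg)
    have h: "Re (herm_form H w) > 0" using assms(1) w unfolding herm_pos_def by blast
    have n: "(norm w)\<^sup>2 > 0" using w by simp
    have "Re (herm_form ((1 - t) *\<^sub>R mat 1 + t *\<^sub>R H) w) = (1 - t) * (norm w)\<^sup>2 + t * Re (herm_form H w)"
      unfolding f s by (simp del: of_real_diff of_real_power)
    moreover have "\<dots> > 0"
    proof (cases "t = 0")
      case False
      then have "t * Re (herm_form H w) > 0" using assms h by simp
      moreover have "(1 - t) * (norm w)\<^sup>2 \<ge> 0" using assms by simp
      ultimately show ?thesis by linarith
    qed (use n in simp)
    ultimately show ?thesis by simp
  qed
  moreover have "((1 - t) *\<^sub>R mat 1 + t *\<^sub>R H) $ k $ j = cnj (((1 - t) *\<^sub>R mat 1 + t *\<^sub>R H) $ j $ k)" for j k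
    using herm_pos_hermitian[OF assms(1), of k j] by (simp add: mat_def)
  ultimately show ?thesis unfolding herm_pos_def by blast
qed

lemma continuous_on_det:
  fixes A :: "'a::topological_space \<Rightarrow> complex^'n^'n"
  assumes "continuous_on S A" shows "continuous_on S (\<lambda>x. det (A x))"
  unfolding det_def by (intro continuous_intros assms)

text \<open>The determinant is real and does not vanish on the segment from the identity to \<open>H\<close>, so it keeps
  the sign it has at the identity.\<close>

lemma herm_pos_det_pos:
  assumes "herm_pos H" shows "det H \<in> \<real>" "Re (det H) > 0"
proof -
  show r: "det H \<in> \<real>" by (rule det_hermitian_real[OF herm_pos_hermitian[OF assms]])
  let ?A = "\<lambda>t::real. (1 - t) *\<^sub>R mat 1 + t *\<^sub>R H"
  have nz: "Re (det (?A t)) \<noteq> 0" if "0 \<le> t" "t \<le> 1" for t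
  proof -
    have "herm_pos (?A t)" by (rule herm_pos_segment[OF assms that])
    then have "det (?A t) \<noteq> 0" "det (?A t) \<in> \<real>"
      by (rule herm_pos_det_nz, rule det_hermitian_real[OF herm_pos_hermitian])
    then show ?thesis by (metis complex_is_Real_iff complex_eqI zero_complex.sel)
  qed
  have c: "continuous_on {0..1} (\<lambda>t. Re (det (?A t)))"
    by (intro continuous_intros continuous_on_det)
  show "Re (det H) > 0"
  proof (rule ccontr)
    assume "\<not> Re (det H) > 0"
    then have "\<exists>t\<ge>0. t \<le> 1 \<and> Re (det (?A t)) = 0"
      by (intro IVT2' c) auto
    then show False using nz by blast
  qed
qed

text \<open>By linearity in row j the sum is the determinant of H with row j replaced by row l, a
  matrix with two equal rows unless l = j.\<close>

lemma cofactor_expansion: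
  fixes H :: "complex^'n^'n"
  shows "(\<Sum>k\<in>UNIV. H $ l $ k * cofactor_matrix H $ j $ k) = (if l = j then det H else 0)"
proof -
  have "(\<Sum>k\<in>UNIV. H $ l $ k * cofactor_matrix H $ j $ k)
      = (\<Sum>k\<in>UNIV. det (\<chi> i. if i = j then H $ l $ k *s axis k 1 else H $ i))"
    by (simp add: cofactor_matrix_def det_row_mul)
  also have "\<dots> = det (\<chi> i. if i = j then (\<Sum>k\<in>UNIV. H $ l $ k *s axis k 1) else H $ i)"
    by (rule det_linear_row_sum[symmetric]) simp
  also have "\<dots> = det (\<chi> i. if i = j then H $ l else H $ i)" by (simp add: basis_expansion cong: if_cong)
  also have "\<dots> = (if l = j then det H else 0)"
  proof (cases "l = j")
    case True
    then have "(\<chi> i. if i = j then H $ l else H $ i) = H" by (simp add: vec_eq_iff)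
    then show ?thesis using True by simp
  next
    case False
    then show ?thesis by (simp add: det_identical_rows[OF False] row_def)
  qed
  finally show ?thesis .
qed

lemma sum_mult_cofactor_matrix:
  fixes H :: "complex^'n^'n"
  shows "(\<Sum>j\<in>UNIV. \<Sum>k\<in>UNIV. H $ j $ k * cofactor_matrix H $ j $ k) = of_nat CARD('n) * det H"
  by (simp add: cofactor_expansion)

text \<open>If \<open>v\<close> is the image of \<open>w\<close> under the transposed cofactor matrix, then \<open>H v = det H w\<close>, so up to the
  factor \<open>det H\<close> the form of the cofactor matrix at \<open>w\<close> is the form of \<open>H\<close> at the conjugate of \<open>v\<close>.\<close>

lemma herm_form_cofactor:
  fixes H :: "complex^'n^'n"
  assumes "herm_pos H"
  shows "herm_form (cofactor_matrix H) w \<in> \<real>" "Re (herm_form (cofactor_matrix H) w) \<ge> 0"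
proof -
  have herm: "\<And>j k. H $ k $ j = cnj (H $ j $ k)" by (rule herm_pos_hermitian[OF assms])
  obtain D where D: "det H = of_real D" "D > 0"
    using herm_pos_det_pos[OF assms] by (metis Reals_cases Re_complex_of_real)
  define v where "v = (\<chi> k. \<Sum>j\<in>UNIV. cofactor_matrix H $ j $ k * w $ j)"
  have Hv: "(\<Sum>k\<in>UNIV. H $ l $ k * v $ k) = of_real D * w $ l" for l
  proof -
    have "(\<Sum>k\<in>UNIV. H $ l $ k * v $ k) = (\<Sum>k\<in>UNIV. \<Sum>j\<in>UNIV. w $ j * (H $ l $ k * cofactor_matrix H $ j $ k))"
      by (simp add: v_def sum_distrib_left mult_ac)
    also have "\<dots> = (\<Sum>j\<in>UNIV. w $ j * (\<Sum>k\<in>UNIV. H $ l $ k * cofactor_matrix H $ j $ k))"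
      by (subst sum.swap) (simp add: sum_distrib_left)
    also have "\<dots> = of_real D * w $ l"
      by (simp add: cofactor_expansion D if_distrib[of "\<lambda>x. _ * x"] cong: if_cong)
    finally show ?thesis .
  qed
  define x where "x = (\<chi> k. cnj (v $ k))"
  have "of_real D * herm_form (cofactor_matrix H) w = of_real D * (\<Sum>l\<in>UNIV. v $ l * cnj (w $ l))"
    unfolding herm_form_def by (subst sum.swap) (simp add: v_def sum_distrib_right)
  also have "\<dots> = (\<Sum>l\<in>UNIV. v $ l * cnj (of_real D * w $ l))" by (simp add: sum_distrib_left mult_ac)
  also have "\<dots> = (\<Sum>l\<in>UNIV. v $ l * (\<Sum>k\<in>UNIV. H $ k $ l * cnj (v $ k)))"
    by (simp add: Hv[symmetric] cnj_sum herm[symmetric])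
  also have "\<dots> = herm_form H x"
    unfolding herm_form_def by (subst sum.swap) (simp add: x_def sum_distrib_left mult_ac)
  finally have e: "herm_form (cofactor_matrix H) w = of_real (1 / D) * herm_form H x"
    using D by (simp add: field_simps)
  have "Re (herm_form H x) \<ge> 0"
  proof (cases "x = 0")
    case True then show ?thesis by (simp add: herm_form_def)
  next
    case False then show ?thesis using assms unfolding herm_pos_def by force
  qed
  moreover have "herm_form H x \<in> \<real>" by (rule herm_form_real[OF herm])
  ultimately show "herm_form (cofactor_matrix H) w \<in> \<real>" "Re (herm_form (cofactor_matrix H) w) \<ge> 0"
    unfolding e using D by (auto intro!: Reals_mult Reals_of_real simp del: of_real_divide)
qed

section \<open>Smoothness and positivity of the cofactor form\<close>

lemma smooth_on_det:
  fixes A :: "'a::real_normed_vector \<Rightarrow> complex^'n^'n"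
  assumes "open W" "smooth_on W A" shows "smooth_on W (\<lambda>z. det (A z))"
  unfolding det_def
  by (intro smooth_on_sum smooth_on_mult smooth_on_const smooth_on_prod smooth_on_matrix_entry assms)

lemma smooth_on_cofactor_matrix:
  fixes A :: "'a::real_normed_vector \<Rightarrow> complex^'n^'n"
  assumes "open W" "smooth_on W A" shows "smooth_on W (\<lambda>z. cofactor_matrix (A z))"
proof (intro smooth_on_vec assms(1))
  fix j k
  have "smooth_on W (\<lambda>z. \<chi> i. if i = j then axis k 1 else A z $ i)"
  proof (rule smooth_on_vec[OF assms(1)])
    fix i
    show "smooth_on W (\<lambda>z. (\<chi> i. if i = j then axis k 1 else A z $ i) $ i)"
      by (cases "i = j") (simp_all add: smooth_on_const smooth_on_linear_compose[OF bounded_linear_vec_nth assms])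
  qed
  from smooth_on_det[OF assms(1) this] show "smooth_on W (\<lambda>z. cofactor_matrix (A z) $ j $ k)"
    by (simp add: cofactor_matrix_def)
qed

lemma smooth_on_ddc:
  assumes "open W" "smooth_on W u" shows "smooth_on W (ddc u)"
proof (intro smooth_on_vec assms(1))
  fix j k
  show "smooth_on W (\<lambda>z. ddc u z $ j $ k)"
    unfolding ddc_def vec_lambda_beta
    by (intro smooth_on_linear_compose[OF bounded_linear_divide] smooth_on_dz smooth_on_of_real assms)
qed

lemma ddc_hermitian:
  fixes u :: "complex^'n \<Rightarrow> real"
  assumes "open W" "z \<in> W" "smooth_on W u"
  shows "ddc u z $ k $ j = cnj (ddc u z $ j $ k)"
  by (simp add: ddc_def dirderiv_dirderiv_of_real[OF assms]
    dz_dzbar_smooth[OF assms(1,2) smooth_on_of_real[OF assms(1,3)]]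
    dirderiv_commute[OF assms, of "axis k _"] algebra_simps)

text \<open>For \<omega> = dd^c u the matrix is that of \<eta> \<omega>^(n-1) up to the factor
  (n-1)! 2^n. Pairing it with \<omega> itself gives \<eta> times the volume density, the factor n
  coming from the n rows along which the determinant can be expanded.\<close>

lemma positive_test_form_cofactor:
  fixes u \<eta> :: "complex^'n \<Rightarrow> real"
  assumes W: "open W" and u: "smooth_on W u" and pos: "\<And>z. z \<in> W \<Longrightarrow> herm_pos (ddc u z)"
    and \<eta>: "smooth_on UNIV \<eta>" "compact_support_in W \<eta>" "\<And>z. \<eta> z \<ge> 0"
  shows "positive_test_form W (\<lambda>z. \<eta> z *\<^sub>R cofactor_matrix (ddc u z))"
    and "ddc_pairing u (\<lambda>z. \<eta> z *\<^sub>R cofactor_matrix (ddc u z))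
      = (\<integral>z. real CARD('n) * \<eta> z * Re (det (ddc u z)) \<partial>lborel)"
proof -
  let ?B = "\<lambda>z. \<eta> z *\<^sub>R cofactor_matrix (ddc u z)"
  obtain K where K: "compact K" "K \<subseteq> W" and off: "\<And>z. z \<notin> K \<Longrightarrow> \<eta> z = 0"
    using \<eta>(2) unfolding compact_support_in_def by auto
  have sm: "smooth_on UNIV ?B"
    by (rule smooth_on_UNIV_bilinear[OF bounded_bilinear.flip[OF bounded_bilinear_scaleR] W compact_imp_closed[OF K(1)] K(2)
          smooth_on_cofactor_matrix[OF W smooth_on_ddc[OF W u]] \<eta>(1) off])
  have cs: "compact_support_in W ?B" unfolding compact_support_in_def using K off by auto
  have hf: "herm_form (?B z) w = of_real (\<eta> z) * herm_form (cofactor_matrix (ddc u z)) w" for z w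
    by (simp add: herm_form_def sum_distrib_left scaleR_conv_of_real[where 'a=complex] mult_ac)
  have "herm_form (?B z) w \<in> \<real> \<and> Re (herm_form (?B z) w) \<ge> 0" for z w
  proof (cases "z \<in> W")
    case True
    then show ?thesis unfolding hf using herm_form_cofactor[OF pos[OF True], of w] \<eta>(3)[of z] by auto
  next
    case False
    then have "\<eta> z = 0" using off K by auto
    then show ?thesis unfolding hf by simp
  qed
  with sm cs show "positive_test_form W ?B" by (simp add: positive_test_form_def)
  have "(\<Sum>j\<in>UNIV. \<Sum>k\<in>UNIV. ddc u z $ j $ k * ?B z $ j $ k) = of_real (\<eta> z) * (of_nat CARD('n) * det (ddc u z))" for z
    unfolding sum_mult_cofactor_matrix[symmetric] by (simp add: sum_distrib_left scaleR_conv_of_real[where 'a=complex] mult_ac)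
  then show "ddc_pairing u ?B = (\<integral>z. real CARD('n) * \<eta> z * Re (det (ddc u z)) \<partial>lborel)"
    by (simp add: ddc_pairing_eq[OF W u sm cs] mult_ac)
qed

section \<open>Coordinate maps\<close>

lemma holo_on_subset_cong:
  assumes "holo_on W f" "open W'" "W' \<subseteq> W" "\<And>z. z \<in> W' \<Longrightarrow> f z = g z"
  shows "holo_on W' g"
proof -
  have "smooth_on W' f" using assms(1,3) by (auto simp: holo_on_def intro: smooth_on_subset)
  then have "smooth_on W' g" using smooth_on_cong[of W' f g] assms(2,4) by blast
  moreover have "dzbar j g z = 0" if "z \<in> W'" for z j
    using dz_cong_open(2)[of W' z f g j] assms that by (auto simp: holo_on_def)
  ultimately show ?thesis using assms(2) by (simp add: holo_on_def)
qed

lemma locally_extends_subset: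
  assumes "locally_extends X \<A> P V f" "openin X V'" "V' \<subseteq> V"
  shows "locally_extends X \<A> P V' f"
  unfolding locally_extends_def
proof (intro conjI ballI)
  fix x assume "x \<in> V'"
  then have "x \<in> V" using assms(3) by auto
  then obtain E \<tau> W F where "(E, \<tau>) \<in> \<A>" "x \<in> E" "open W" "\<tau> x \<in> W" "P W F"
    "\<And>y. y \<in> V \<inter> E \<Longrightarrow> \<tau> y \<in> W \<Longrightarrow> f y = F (\<tau> y)"
    using assms(1) unfolding locally_extends_def by fast
  then show "\<exists>(E, \<tau>)\<in>\<A>. x \<in> E \<and> (\<exists>W F. open W \<and> \<tau> x \<in> W \<and> P W F \<and> (\<forall>y\<in>V' \<inter> E. \<tau> y \<in> W \<longrightarrow> f y = F (\<tau> y)))"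
    using assms(3) by (intro bexI[of _ "(E, \<tau>)"]) auto
qed (rule assms(2))

lemma coord_maps_props:
  assumes "(V, \<psi>) \<in> coord_maps X \<A>"
  shows "openin X V" "open (\<psi> ` V)" "inj_on \<psi> V"
    "\<And>V'. openin X V' \<Longrightarrow> V' \<subseteq> V \<Longrightarrow> open (\<psi> ` V')"
    "\<And>S. open S \<Longrightarrow> openin X {x \<in> V. \<psi> x \<in> S}"
proof -
  have V: "openin X V" and o: "open (\<psi> ` V)"
    and h: "homeomorphic_map (subtopology X V) (top_of_set (\<psi> ` V)) \<psi>"
    using assms by (auto simp: coord_maps_def)
  have top: "topspace (subtopology X V) = V" using openin_subset[OF V] by (simp add: Int_absorb1)
  show "openin X V" "open (\<psi> ` V)" by (fact V o)+
  show "inj_on \<psi> V" using homeomorphic_imp_injective_map[OF h] by (simp only: top)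
  show "open (\<psi> ` V')" if V': "openin X V'" "V' \<subseteq> V" for V'
  proof -
    have "openin (subtopology X V) V'" using that V by (simp add: openin_open_subtopology)
    then have "openin (top_of_set (\<psi> ` V)) (\<psi> ` V')"
      using homeomorphic_imp_open_map[OF h] by (simp add: open_map_def)
    then show ?thesis using o openin_open_trans by blast
  qed
  show "openin X {x \<in> V. \<psi> x \<in> S}" if "open S" for S
  proof -
    have "openin (top_of_set (\<psi> ` V)) (\<psi> ` V \<inter> S)" using that by (simp add: openin_open_Int)
    from openin_continuous_map_preimage[OF homeomorphic_imp_continuous_map[OF h] this]
    have "openin (subtopology X V) {x \<in> V. \<psi> x \<in> \<psi> ` V \<inter> S}" by (simp only: top)
    moreover have "{x \<in> V. \<psi> x \<in> \<psi> ` V \<inter> S} = {x \<in> V. \<psi> x \<in> S}" by auto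
    ultimately show ?thesis using V by (simp add: openin_open_subtopology)
  qed
qed

lemma inv_into_subset_eq:
  assumes "inj_on \<psi> V" "V' \<subseteq> V" "z \<in> \<psi> ` V'"
  shows "inv_into V' \<psi> z = inv_into V \<psi> z"
  using assms by (auto simp: inv_into_f_f inj_on_subset subset_iff)

text \<open>Currents are tested only in charts contained in the domains of the potentials involved,
  so charts must be free to shrink.\<close>

lemma coord_maps_restrict:
  assumes c: "(V, \<psi>) \<in> coord_maps X \<A>" and A: "reduced_complex_space X \<A>"
    and V': "openin X V'" "V' \<subseteq> V"
  shows "(V', \<psi>) \<in> coord_maps X \<A>"
proof -
  note P = coord_maps_props[OF c]
  have h: "homeomorphic_map (subtopology X V) (top_of_set (\<psi> ` V)) \<psi>"
    and holo: "\<And>i. holo_fun X \<A> V (\<lambda>x. \<psi> x $ i)"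
    and inv: "\<And>E \<tau>. (E, \<tau>) \<in> \<A> \<Longrightarrow> holo_map (\<psi> ` (V \<inter> E)) (\<lambda>z. \<tau> (inv_into V \<psi> z))"
    using c by (auto simp: coord_maps_def)
  have o: "open (\<psi> ` V')" by (rule P(4)[OF V'])
  have "homeomorphic_map (subtopology (subtopology X V) V') (subtopology (top_of_set (\<psi> ` V)) (\<psi> ` V')) \<psi>"
    by (rule homeomorphic_map_subtopologies[OF h]) (use V' openin_subset[OF P(1)] in auto)
  then have "homeomorphic_map (subtopology X V') (top_of_set (\<psi> ` V')) \<psi>"
    using V'(2) by (simp add: subtopology_subtopology Int_absorb1 image_mono)
  moreover have "holo_fun X \<A> V' (\<lambda>x. \<psi> x $ i)" for i by (rule locally_extends_subset[OF holo V'])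
  moreover have "holo_map (\<psi> ` (V' \<inter> E)) (\<lambda>z. \<tau> (inv_into V' \<psi> z))" if E: "(E, \<tau>) \<in> \<A>" for E \<tau>
    unfolding holo_map_def
  proof
    fix i
    have "openin X E" using A E by (auto simp: reduced_complex_space_def local_embedding_def)
    then have "open (\<psi> ` (V' \<inter> E))" using V' by (intro P(4)) auto
    then show "holo_on (\<psi> ` (V' \<inter> E)) (\<lambda>z. \<tau> (inv_into V' \<psi> z) $ i)"
      by (rule holo_on_subset_cong[OF inv[OF E, unfolded holo_map_def, rule_format]])
        (use V'(2) inv_into_subset_eq[OF P(3) V'(2)] in auto)
  qed
  ultimately show ?thesis using V'(1) o by (auto simp: coord_maps_def)
qed

text \<open>Near each point the components of \<open>\<psi>\<close> are holomorphic functions of \<open>\<tau>\<close>, after a change of the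
  embedding; so \<open>\<tau> \<circ> \<psi>\<^sup>-\<^sup>1\<close> has a differentiable left inverse.\<close>

lemma coord_map_inverse_immersion:
  fixes \<tau> :: "'a \<Rightarrow> complex^'m::finite" and \<psi> :: "'a \<Rightarrow> complex^'n::finite"
  assumes c: "(V, \<psi>) \<in> coord_maps X \<A>" and A: "reduced_complex_space X \<A>"
    and E: "(E, \<tau>) \<in> \<A>" and z: "z \<in> \<psi> ` (V \<inter> E)"
    and zero: "frechet_derivative (\<lambda>z. \<tau> (inv_into V \<psi> z)) (at z) w = 0"
  shows "w = 0"
proof -
  note P = coord_maps_props[OF c]
  let ?G = "\<lambda>z. \<tau> (inv_into V \<psi> z)"
  define x where "x = inv_into V \<psi> z"
  have x: "x \<in> V" "x \<in> E" "\<psi> x = z" using z P(3) by (auto simp: x_def inv_into_f_f)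
  have openE: "openin X E'" if "(E', \<tau>') \<in> \<A>" for E' \<tau>'
    using A that by (auto simp: reduced_complex_space_def local_embedding_def)
  have G: "holo_map (\<psi> ` (V \<inter> E)) ?G" using c E by (auto simp: coord_maps_def)
  have oVE: "open (\<psi> ` (V \<inter> E))" using openE[OF E] P(1) by (intro P(4)) auto
  note Gsm = holo_map_smooth_on[OF G]
  have "w $ i = 0" for i
  proof -
    have "holo_fun X \<A> V (\<lambda>x. \<psi> x $ i)" using c by (auto simp: coord_maps_def)
    then obtain E' \<tau>' W F where E': "(E', \<tau>') \<in> \<A>" "x \<in> E'" and W: "open W" "\<tau>' x \<in> W" and F: "holo_on W F"
      and eq: "\<And>y. y \<in> V \<inter> E' \<Longrightarrow> \<tau>' y \<in> W \<Longrightarrow> \<psi> y $ i = F (\<tau>' y)"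
      using x(1) unfolding locally_extends_def by fast
    \<comment> \<open>The function F extending the coordinate may belong to another embedding
      \<open>\<tau>'\<close>; the transition map \<open>F1\<close> rewrites it in terms of
      \<open>\<tau>\<close> near x.\<close>
    have "\<forall>(E, \<tau>)\<in>\<A>. \<forall>(E', \<tau>')\<in>\<A>. \<forall>x\<in>E \<inter> E'.
        \<exists>W F. holo_map W F \<and> \<tau> x \<in> W \<and> (\<forall>y\<in>E \<inter> E'. \<tau> y \<in> W \<longrightarrow> \<tau>' y = F (\<tau> y))"
      using A unfolding reduced_complex_space_def by (elim conjE)
    from bspec[OF this E] have "\<forall>(E', \<tau>')\<in>\<A>. \<forall>x\<in>E \<inter> E'.
        \<exists>W F. holo_map W F \<and> \<tau> x \<in> W \<and> (\<forall>y\<in>E \<inter> E'. \<tau> y \<in> W \<longrightarrow> \<tau>' y = F (\<tau> y))" by simp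
    from bspec[OF this E'(1)] have "\<exists>W F. holo_map W F \<and> \<tau> x \<in> W \<and> (\<forall>y\<in>E \<inter> E'. \<tau> y \<in> W \<longrightarrow> \<tau>' y = F (\<tau> y))"
      using x(2) E'(2) by simp
    then obtain W1 F1 where F1: "holo_map W1 F1" "\<tau> x \<in> W1" and eq1: "\<And>y. y \<in> E \<inter> E' \<Longrightarrow> \<tau> y \<in> W1 \<Longrightarrow> \<tau>' y = F1 (\<tau> y)"
      by blast
    have W1: "open W1" using F1(1) by (auto simp: holo_map_def holo_on_def)
    note F1sm = holo_map_smooth_on[OF F1(1)]
    define W2 where "W2 = {v \<in> W1. F1 v \<in> W}"
    have W2: "open W2"
      using continuous_open_preimage[OF smooth_on_continuous_on[OF F1sm] W1 W(1)]
      by (simp add: W2_def vimage_def Int_def)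
    have xW2: "?G z \<in> W2" using F1(2) W(2) eq1[of x] x E' by (auto simp: W2_def x_def[symmetric])
    define N where "N = {y \<in> \<psi> ` (V \<inter> E \<inter> E'). ?G y \<in> W2}"
    have oVEE: "open (\<psi> ` (V \<inter> E \<inter> E'))" using openE E E' P(1) by (intro P(4)) auto
    have N: "open N"
      using continuous_open_preimage[OF continuous_on_subset[OF smooth_on_continuous_on[OF Gsm]] oVEE W2]
      by (auto simp: N_def vimage_def Int_def)
    have zN: "z \<in> N" using x E' xW2 by (auto simp: N_def)
    have zi: "y $ i = F (F1 (?G y))" if yN: "y \<in> N" for y
    proof -
      obtain t where t: "t \<in> V" "t \<in> E" "t \<in> E'" "y = \<psi> t" using yN by (auto simp: N_def)
      then have it: "inv_into V \<psi> y = t" using P(3) by (simp add: inv_into_f_f)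
      have 1: "\<tau> t \<in> W1" "F1 (\<tau> t) \<in> W" using yN it t by (auto simp: N_def W2_def)
      then show ?thesis using eq1[of t] eq[of t] t it by simp
    qed
    have "(\<lambda>v. F (F1 v)) differentiable (at (?G z))"
    proof -
      have 1: "(F1 has_derivative frechet_derivative F1 (at (?G z))) (at (?G z))"
        using xW2 by (intro smooth_on_has_derivative[OF F1sm]) (auto simp: W2_def)
      have 2: "(F has_derivative frechet_derivative F (at (F1 (?G z)))) (at (F1 (?G z)))"
        using xW2 F by (intro smooth_on_has_derivative[of W]) (auto simp: W2_def holo_on_def)
      show ?thesis using has_derivative_compose[OF 1 2] by (auto simp: differentiable_def)
    qed
    then obtain D where D: "((\<lambda>v. F (F1 v)) has_derivative D) (at (?G z))" by (auto simp: differentiable_def)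
    have "(?G has_derivative frechet_derivative ?G (at z)) (at z)" by (rule smooth_on_has_derivative[OF Gsm z])
    from has_derivative_compose[OF this D]
    have "((\<lambda>y. F (F1 (?G y))) has_derivative (\<lambda>v. D (frechet_derivative ?G (at z) v))) (at z)" .
    then have "((\<lambda>y. y $ i) has_derivative (\<lambda>v. D (frechet_derivative ?G (at z) v))) (at z)"
      by (rule has_derivative_transform_within_open[OF _ N zN]) (simp add: zi)
    \<comment> \<open>The coordinate function now has two derivatives at z: one factors through that
      of \<open>?G\<close>, which kills w; the other reads off the component i of w.\<close>
    moreover have "((\<lambda>y. y $ i) has_derivative (\<lambda>v. v $ i)) (at z)"
      by (rule bounded_linear_imp_has_derivative[OF bounded_linear_vec_nth])
    ultimately have "(\<lambda>v. D (frechet_derivative ?G (at z) v)) = (\<lambda>v. v $ i)" by (rule has_derivative_unique)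
    from fun_cong[OF this, of w] have "w $ i = D 0" by (simp add: zero)
    then show ?thesis using linear_0[OF has_derivative_linear[OF D]] by simp
  qed
  then show ?thesis by (simp add: vec_eq_iff)
qed

lemma ddc_cong_open:
  assumes "open N" "z \<in> N" "\<And>y. y \<in> N \<Longrightarrow> u y = v y"
  shows "ddc u z = ddc v z"
proof -
  have "dzbar k (\<lambda>x. complex_of_real (u x)) y = dzbar k (\<lambda>y. complex_of_real (v y)) y" if "y \<in> N" for y k
    by (rule dz_cong_open(2)[OF assms(1) that]) (simp add: assms(3))
  then have "dz j (dzbar k (\<lambda>x. complex_of_real (u x))) z = dz j (dzbar k (\<lambda>y. complex_of_real (v y))) z" for j k
    by (rule dz_cong_open(1)[OF assms(1,2)])
  then show ?thesis by (simp add: ddc_def)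
qed

text \<open>The Levi form at w is that of the ambient function at the image of w under the
  derivative of the inverse chart. Strictness survives because this image is nonzero for w
  nonzero.\<close>

lemma strictly_psh_in_coord:
  fixes \<A> :: "('a, 'm::finite) atlas" and \<psi> :: "'a \<Rightarrow> complex^'n::finite"
  assumes c: "(V, \<psi>) \<in> coord_maps X \<A>" and A: "reduced_complex_space X \<A>"
    and \<rho>: "locally_extends X \<A> smooth_strictly_psh_on U \<rho>" and VU: "V \<subseteq> U"
  shows "smooth_on (\<psi> ` V) (in_coord V \<psi> \<rho>)"
    and "\<And>z. z \<in> \<psi> ` V \<Longrightarrow> herm_pos (ddc (in_coord V \<psi> \<rho>) z)"
proof -
  note P = coord_maps_props[OF c]
  let ?u = "in_coord V \<psi> \<rho>"
  have loc: "\<exists>N. open N \<and> z \<in> N \<and> smooth_on N ?u \<and> (\<forall>w. w \<noteq> 0 \<longrightarrow> Re (herm_form (ddc ?u z) w) > 0)"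
    if z: "z \<in> \<psi> ` V" for z
  proof -
    define x where "x = inv_into V \<psi> z"
    have x: "x \<in> V" "\<psi> x = z" using z P(3) by (auto simp: x_def inv_into_f_f)
    then have "x \<in> U" using VU by auto
    then obtain E \<tau> W F where E: "(E, \<tau>) \<in> \<A>" "x \<in> E" and W: "open W" "\<tau> x \<in> W"
      and F: "smooth_strictly_psh_on W F" and eq: "\<And>y. y \<in> U \<inter> E \<Longrightarrow> \<tau> y \<in> W \<Longrightarrow> \<rho> y = F (\<tau> y)"
      using \<rho> unfolding locally_extends_def by fast
    have Fsm: "smooth_on W F" using F by (auto simp: smooth_strictly_psh_on_def)
    let ?G = "\<lambda>z. \<tau> (inv_into V \<psi> z)"
    have G: "holo_map (\<psi> ` (V \<inter> E)) ?G" using c E by (auto simp: coord_maps_def)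
    have openE: "openin X E" using A E by (auto simp: reduced_complex_space_def local_embedding_def)
    have oVE: "open (\<psi> ` (V \<inter> E))" using openE P(1) by (intro P(4)) auto
    note Gsm = holo_map_smooth_on[OF G]
    define N where "N = {y \<in> \<psi> ` (V \<inter> E). ?G y \<in> W}"
    have N: "open N"
      using continuous_open_preimage[OF smooth_on_continuous_on[OF Gsm] oVE W(1)]
      by (simp add: N_def vimage_def Int_def)
    have zVE: "z \<in> \<psi> ` (V \<inter> E)" using x E by auto
    have zN: "z \<in> N" using zVE W by (auto simp: N_def x_def)
    have GN: "holo_map N ?G"
      unfolding holo_map_def
      by (intro allI holo_on_subset_cong[OF G[unfolded holo_map_def, rule_format] N]) (auto simp: N_def)
    have NW: "?G ` N \<subseteq> W" by (auto simp: N_def)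
    have ueq: "F (?G y) = ?u y" if yN: "y \<in> N" for y
    proof -
      obtain t where t: "t \<in> V" "t \<in> E" "y = \<psi> t" using yN by (auto simp: N_def)
      then have it: "inv_into V \<psi> y = t" using P(3) by (simp add: inv_into_f_f)
      have "\<tau> t \<in> W" using yN it t by (auto simp: N_def)
      then show ?thesis using eq[of t] t it VU by (auto simp: in_coord_def)
    qed
    have "smooth_on N (\<lambda>y. F (?G y))" by (rule smooth_on_compose[OF N W(1) NW Fsm holo_map_smooth_on[OF GN]])
    then have sm: "smooth_on N ?u" using smooth_on_cong[of N "\<lambda>y. F (?G y)" ?u] N ueq by blast
    have ddceq: "ddc ?u z = ddc (\<lambda>y. F (?G y)) z" by (rule ddc_cong_open[OF N zN]) (simp add: ueq)
    have "Re (herm_form (ddc ?u z) w) > 0" if w: "w \<noteq> 0" for w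
    proof -
      have "frechet_derivative ?G (at z) w \<noteq> 0"
        using coord_map_inverse_immersion[OF c A E(1) zVE] w by blast
      then have "Re (herm_form (ddc F (?G z)) (frechet_derivative ?G (at z) w)) > 0"
        using F zN unfolding smooth_strictly_psh_on_def N_def by blast
      then show ?thesis unfolding ddceq herm_form_ddc_compose[OF N W(1) NW Fsm GN zN] .
    qed
    with N zN sm show ?thesis by blast
  qed
  show sm: "smooth_on (\<psi> ` V) ?u" by (rule smooth_on_local) (use loc in blast)
  show "herm_pos (ddc ?u z)" if "z \<in> \<psi> ` V" for z
    unfolding herm_pos_def using ddc_hermitian[OF P(2) that sm] loc[OF that] by blast
qed

section \<open>Growth of the degrees\<close>

text \<open>With the test form \<eta> \<omega>^(n-1), a times the pairing of \<omega> is at most the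
  pairing of T. The latter is, up to normalisation, the \<mu>-integral of \<eta>, which \<eta> \<le>
  1 bounds by the measure of the chart.\<close>

lemma (in normal_kaehler_space) coord_measure_ge:
  fixes \<psi> :: "'a \<Rightarrow> complex^'n" and \<eta> :: "complex^'n \<Rightarrow> real"
  assumes V: "(V, \<psi>) \<in> \<R>" and U: "(U, \<rho>) \<in> \<omega>" and U': "(U', \<phi>) \<in> T" and VU: "V \<subseteq> U \<inter> U'"
    and le: "current_le \<R> (scale_current a \<omega>) T" and \<mu>: "wedge_measure X \<R> \<omega> T \<mu>"
    and \<eta>: "smooth_on UNIV \<eta>" "compact_support_in (\<psi> ` V) \<eta>" "\<And>z. 0 \<le> \<eta> z" "\<And>z. \<eta> z \<le> 1"
  shows "ennreal (fact (CARD('n) - 1) * 2 ^ CARD('n) * (a *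
      (\<integral>z. real CARD('n) * \<eta> z * Re (det (ddc (in_coord V \<psi> \<rho>) z)) \<partial>lborel))) \<le> emeasure \<mu> V"
proof -
  have c: "(V, \<psi>) \<in> coord_maps X \<A>" using V coord_maps by simp
  have \<rho>: "locally_extends X \<A> smooth_strictly_psh_on U \<rho>" using kaehler U by (auto simp: kaehler_form_def)
  have VU1: "V \<subseteq> U" using VU by auto
  note P = coord_maps_props[OF c]
  let ?u = "in_coord V \<psi> \<rho>"
  let ?B = "\<lambda>z. \<eta> z *\<^sub>R cofactor_matrix (ddc ?u z)"
  let ?C = "fact (CARD('n) - 1) * 2 ^ CARD('n) :: real"
  note psh = strictly_psh_in_coord[OF c complex_space \<rho> VU1]
  have B: "positive_test_form (\<psi> ` V) ?B"
    by (rule positive_test_form_cofactor(1)[OF P(2) psh(1) _ \<eta>(1,2,3)]) (rule psh(2))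
  have pair: "ddc_pairing ?u ?B = (\<integral>z. real CARD('n) * \<eta> z * Re (det (ddc ?u z)) \<partial>lborel)"
    by (rule positive_test_form_cofactor(2)[OF P(2) psh(1) _ \<eta>(1,2,3)]) (rule psh(2))
  have "in_coord V \<psi> (\<lambda>x. a * \<rho> x) = (\<lambda>z. a * ?u z)" by (simp add: in_coord_def)
  then have scaled: "ddc_pairing (in_coord V \<psi> (\<lambda>x. a * \<rho> x)) ?B = a * ddc_pairing ?u ?B"
    by (simp add: ddc_pairing_def mult.assoc)
  have mem: "(U, \<lambda>x. a * \<rho> x) \<in> scale_current a \<omega>"
    using U unfolding scale_current_def by force
  have le': "ddc_pairing (in_coord V \<psi> (\<lambda>x. a * \<rho> x)) ?B \<le> ddc_pairing (in_coord V \<psi> \<phi>) ?B"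
    using le mem U' V VU B unfolding current_le_def by fast
  have Vm: "V \<in> sets \<mu>"
  proof -
    have "V \<subseteq> covered \<R>" using V by (auto simp: covered_def)
    then have "V \<in> sets (borel_reg X (covered \<R>))"
      using P(1) unfolding borel_reg_def by (subst sets_measure_of) auto
    then show ?thesis using \<mu> by (simp add: wedge_measure_def)
  qed
  have "ennreal (?C * (a * (\<integral>z. real CARD('n) * \<eta> z * Re (det (ddc ?u z)) \<partial>lborel)))
      \<le> ennreal (?C * ddc_pairing (in_coord V \<psi> \<phi>) ?B)"
    using le' unfolding scaled pair by (intro ennreal_leI mult_left_mono) auto
  also have "\<dots> = (\<integral>\<^sup>+ x. ennreal (\<eta> (\<psi> x)) * indicator V x \<partial>\<mu>)"
    using \<mu> U U' V VU \<eta>(1-3) unfolding wedge_measure_def by fastforce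
  also have "\<dots> \<le> (\<integral>\<^sup>+ x. indicator V x \<partial>\<mu>)"
    by (intro nn_integral_mono) (auto simp: indicator_def intro!: \<eta>(4))
  also have "\<dots> = emeasure \<mu> V" using Vm by simp
  finally show ?thesis .
qed

text \<open>The constant 20 combines the factor 5 of the Vitali covering lemma with the quarter radii, on which
  the bump functions used below are bounded away from 0.\<close>

lemma finite_disjoint_balls_volume:
  fixes z0 :: "'a::euclidean_space"
  assumes "r > 0" and loc: "\<And>x. x \<in> ball z0 r \<Longrightarrow> \<exists>s>0. good (ball x s)"
    and mono: "\<And>S S'. good S \<Longrightarrow> S' \<subseteq> S \<Longrightarrow> good S'"
  shows "\<exists>C. finite C \<and> (\<forall>(x, s)\<in>C. 0 < s \<and> ball x s \<subseteq> ball z0 r \<and> good (ball x s)) \<and>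
    disjoint_family_on (\<lambda>(x, s). ball x s) C \<and>
    measure lborel (cball z0 (r / 2)) / 20 ^ DIM('a) \<le> (\<Sum>(x, s)\<in>C. measure lborel (ball x (s / 4)))"
proof -
  let ?K = "{(x, s). 0 < s \<and> s \<le> 1 \<and> ball x s \<subseteq> ball z0 r \<and> good (ball x s)}"
  have cov: "ball z0 r \<subseteq> (\<Union>i\<in>?K. ball (fst i) (snd i))"
  proof
    fix x assume x: "x \<in> ball z0 r"
    obtain s where s: "s > 0" "good (ball x s)" using loc[OF x] by blast
    obtain t where t: "t > 0" "ball x t \<subseteq> ball z0 r" using open_ball x by (metis open_contains_ball)
    \<comment> \<open>The cap at 1 provides the bounded radii that the Vitali lemma
      requires.\<close>
    let ?s = "min 1 (min s t)"
    have "ball x ?s \<subseteq> ball x t" "ball x ?s \<subseteq> ball x s" by auto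
    then have "ball x ?s \<subseteq> ball z0 r" "good (ball x ?s)" using t(2) mono[OF s(2)] by blast+
    then have "(x, ?s) \<in> ?K" using s(1) t(1) by simp
    moreover have "x \<in> ball (fst (x, ?s)) (snd (x, ?s))" using s t by simp
    ultimately show "x \<in> (\<Union>i\<in>?K. ball (fst i) (snd i))" by (rule UN_I)
  qed
  obtain C where C: "countable C" "C \<subseteq> ?K" "pairwise (\<lambda>i j. disjnt (ball (fst i) (snd i)) (ball (fst j) (snd j))) C"
    "ball z0 r \<subseteq> (\<Union>i\<in>C. ball (fst i) (5 * snd i))"
  proof (rule Vitali_covering_lemma_balls[OF cov, of 1])
    show "0 < snd i \<and> snd i \<le> 1" if "i \<in> ?K" for i using that by auto
  qed
  \<comment> \<open>Passing to a finite subfamily needs a compact set, hence the smaller closed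
    ball; disjointness is inherited by the subfamily.\<close>
  have "cball z0 (r / 2) \<subseteq> ball z0 r" using assms(1) by auto
  then have "cball z0 (r / 2) \<subseteq> \<Union>((\<lambda>i. ball (fst i) (5 * snd i)) ` C)" using C(4) by auto
  then obtain C' where C': "C' \<subseteq> C" "finite C'" "cball z0 (r / 2) \<subseteq> (\<Union>i\<in>C'. ball (fst i) (5 * snd i))"
    using compactE_image[OF compact_cball, of C "\<lambda>i. ball (fst i) (5 * snd i)" z0 "r / 2"] open_ball by blast
  have fmb: "ball x s \<in> fmeasurable lborel" for x :: 'a and s
    using emeasure_lborel_ball_finite[of x s] by (intro fmeasurableI) auto
  have "measure lborel (cball z0 (r / 2)) \<le> measure lborel (\<Union>i\<in>C'. ball (fst i) (5 * snd i))"
    by (rule measure_mono_fmeasurable[OF C'(3)]) (use C'(2) fmb in \<open>auto intro!: fmeasurable.finite_UN\<close>)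
  also have "\<dots> \<le> (\<Sum>i\<in>C'. measure lborel (ball (fst i) (5 * snd i)))"
    using C'(2) fmb by (intro measure_UNION_le) auto
  also have "\<dots> = (\<Sum>i\<in>C'. 20 ^ DIM('a) * measure lborel (ball (fst i) (snd i / 4)))"
  proof (rule sum.cong)
    fix i assume "i \<in> C'"
    then have "snd i > 0" using C'(1) C(2) by auto
    then have "measure lborel (ball (fst i) (5 * snd i)) = unit_ball_vol (real DIM('a)) * (5 * snd i) ^ DIM('a)"
      and "measure lborel (ball (fst i) (snd i / 4)) = unit_ball_vol (real DIM('a)) * (snd i / 4) ^ DIM('a)"
      by (simp_all add: content_ball)
    moreover have "(5 * snd i) ^ DIM('a) = 20 ^ DIM('a) * (snd i / 4) ^ DIM('a)"
      unfolding power_mult_distrib[symmetric] by simp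
    ultimately show "measure lborel (ball (fst i) (5 * snd i)) = 20 ^ DIM('a) * measure lborel (ball (fst i) (snd i / 4))" by simp
  qed simp
  finally have vol: "measure lborel (cball z0 (r / 2)) / 20 ^ DIM('a) \<le> (\<Sum>(x, s)\<in>C'. measure lborel (ball x (s / 4)))"
    by (simp add: sum_distrib_left[symmetric] case_prod_unfold field_simps)
  have "disjoint_family_on (\<lambda>(x, s). ball x s) C'"
    using C(3) C'(1) unfolding disjoint_family_on_def pairwise_def disjnt_def case_prod_unfold by blast
  moreover have "\<forall>(x, s)\<in>C'. 0 < s \<and> ball x s \<subseteq> ball z0 r \<and> good (ball x s)"
    using C'(1) C(2) by auto
  ultimately show ?thesis using C'(2) vol by blast
qed

text \<open>Three radii play together: the ball of radius s comes from the disjoint family, the bump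
  function of radius s/2 has compact support in it, and on the ball of radius s/4 this function is
  at least exp(-4/3).\<close>

lemma integral_ball_bump_ge:
  fixes f :: "complex^'n \<Rightarrow> real"
  assumes "s > 0" "open W" "cball x (s / 2) \<subseteq> W" and f: "smooth_on W f" and "c \<ge> 0"
    and ge: "\<And>z. z \<in> cball x (s / 2) \<Longrightarrow> c \<le> f z"
  shows "exp (- (4 / 3)) * c * measure lborel (ball x (s / 4)) \<le> (\<integral>z. ball_bump x (s / 2) z * f z \<partial>lborel)"
proof -
  let ?\<eta> = "ball_bump x (s / 2)"
  have off: "?\<eta> z = 0" if "z \<notin> cball x (s / 2)" for z using that assms(1) by (intro ball_bump_eq_0) auto
  have "smooth_on UNIV (\<lambda>z. f z * ?\<eta> z)"
    by (rule smooth_on_UNIV_bilinear[OF bounded_bilinear_mult assms(2) closed_cball assms(3) f smooth_on_ball_bump off])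
  from integrable_compact_support[OF smooth_on_continuous_on[OF this] compact_cball[of x "s / 2"]]
  have int: "integrable lborel (\<lambda>z. ?\<eta> z * f z)" using off by (simp add: mult.commute)
  have "exp (- (4 / 3)) * c * measure lborel (ball x (s / 4)) = (\<integral>z. indicator (ball x (s / 4)) z * (exp (- (4 / 3)) * c) \<partial>lborel)"
    using emeasure_lborel_ball_finite[of x "s / 4"] by simp
  also have "\<dots> \<le> (\<integral>z. ?\<eta> z * f z \<partial>lborel)"
  proof (rule integral_mono)
    show "integrable lborel (\<lambda>z. indicator (ball x (s / 4)) z * (exp (- (4 / 3)) * c))"
      using emeasure_lborel_ball_finite[of x "s / 4"] by simp
    show "integrable lborel (\<lambda>z. ?\<eta> z * f z)" by (rule int)
    fix z
    show "indicator (ball x (s / 4)) z * (exp (- (4 / 3)) * c) \<le> ?\<eta> z * f z"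
    proof (cases "z \<in> ball x (s / 4)")
      case True
      then have "exp (- (4 / 3)) \<le> ?\<eta> z" using assms(1) by (intro ball_bump_ge) auto
      moreover have "c \<le> f z" using True assms(1) by (intro ge) auto
      ultimately show ?thesis using True assms(5) by (auto intro!: mult_mono ball_bump_nonneg)
    next
      case False
      have "0 \<le> ?\<eta> z * f z"
      proof (cases "z \<in> cball x (s / 2)")
        case True
        then show ?thesis using ge[OF True] assms(5) by (intro mult_nonneg_nonneg ball_bump_nonneg) linarith
      qed (simp add: off)
      then show ?thesis using False by simp
    qed
  qed
  finally show ?thesis .
qed

lemma (in normal_kaehler_space) wedge_mass_lower_bound:
  shows "\<exists>\<kappa>>0. \<forall>T a r. (\<forall>(U, u)\<in>T. openin X U) \<and> \<Union>(fst ` T) = topspace X \<and> a \<ge> 0 \<and>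
    current_le \<R> (scale_current a \<omega>) T \<and> wedge_mass X \<R> \<omega> T r \<longrightarrow> \<kappa> * a \<le> r"
proof -
  \<comment> \<open>The manifold points are dense in a nonempty space, so there is one; the whole
    estimate takes place near it.\<close>
  have "covered \<R> \<noteq> {}" using pure_dimension nonempty closure_of_empty[of X] by metis
  then obtain V1 \<psi> x0 where V1: "(V1, \<psi>) \<in> \<R>" "x0 \<in> V1" by (auto simp: covered_def)
  have c1: "(V1, \<psi>) \<in> coord_maps X \<A>" using V1 coord_maps by simp
  note P1 = coord_maps_props[OF c1]
  have "x0 \<in> topspace X" using V1(2) openin_subset[OF P1(1)] by auto
  moreover have "\<Union>(fst ` \<omega>) = topspace X" and \<omega>open: "\<And>U \<rho>. (U, \<rho>) \<in> \<omega> \<Longrightarrow> openin X U"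
    using kaehler by (auto simp: kaehler_form_def consistent_potentials_def)
  ultimately obtain U \<rho> where U: "(U, \<rho>) \<in> \<omega>" "x0 \<in> U" by fastforce
  define V0 where "V0 = V1 \<inter> U"
  have oV0: "openin X V0" using P1(1) \<omega>open[OF U(1)] by (auto simp: V0_def)
  have c0: "(V0, \<psi>) \<in> coord_maps X \<A>"
    by (rule coord_maps_restrict[OF c1 complex_space oV0]) (simp add: V0_def)
  note P = coord_maps_props[OF c0]
  have \<rho>: "locally_extends X \<A> smooth_strictly_psh_on U \<rho>" using kaehler U by (auto simp: kaehler_form_def)
  have V0U: "V0 \<subseteq> U" by (simp add: V0_def)
  note psh = strictly_psh_in_coord[OF c0 complex_space \<rho> V0U]
  define u where "u = in_coord V0 \<psi> \<rho>"
  define f where "f z = Re (det (ddc u z))" for z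
  have fsm: "smooth_on (\<psi> ` V0) f"
    unfolding f_def[abs_def]
    by (rule smooth_on_linear_compose[OF bounded_linear_Re P(2) smooth_on_det[OF P(2) smooth_on_ddc[OF P(2) psh(1)]], folded u_def])
  have fpos: "f z > 0" if "z \<in> \<psi> ` V0" for z
    using herm_pos_det_pos(2)[OF psh(2)[OF that]] by (simp add: f_def u_def)
  have "\<psi> x0 \<in> \<psi> ` V0" using V1 U by (auto simp: V0_def)
  then obtain r where r: "r > 0" "cball (\<psi> x0) r \<subseteq> \<psi> ` V0" using P(2) open_contains_cball by metis
  have "\<exists>m\<in>cball (\<psi> x0) r. \<forall>z\<in>cball (\<psi> x0) r. f m \<le> f z"
    by (rule continuous_attains_inf) (use r continuous_on_subset[OF smooth_on_continuous_on[OF fsm]] in auto)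
  then obtain m where m: "m \<in> cball (\<psi> x0) r" "\<And>z. z \<in> cball (\<psi> x0) r \<Longrightarrow> f m \<le> f z" by blast
  define c where "c = f m"
  have c: "c > 0" using fpos m(1) r(2) by (auto simp: c_def)
  let ?C = "fact (CARD('n) - 1) * 2 ^ CARD('n) :: real"
  \<comment> \<open>Collects the normalisation of \<open>wedge_measure\<close>, the factor n of the
    pairing, the lower bound of the bump functions and the minimum c of the determinant.
    \<open>\<kappa>\<close> adds the Vitali bound for the total volume of the quarter balls.\<close>
  define \<kappa>1 where "\<kappa>1 = ?C * (real CARD('n) * (exp (- (4 / 3)) * c))"
  define D where "D = DIM(complex^'n)"
  define \<kappa> where "\<kappa> = \<kappa>1 * (measure lborel (cball (\<psi> x0) (r / 2)) / 20 ^ D)"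
  have \<kappa>1: "\<kappa>1 > 0" using c by (simp add: \<kappa>1_def)
  have "measure lborel (cball (\<psi> x0) (r / 2)) > 0" using r by (simp add: content_cball)
  then have \<kappa>: "\<kappa> > 0" using \<kappa>1 by (simp add: \<kappa>_def)
  \<comment> \<open>All choices so far precede T and a, so \<open>\<kappa>\<close> is uniform in
    both. From here on T enters through the choice of balls.\<close>
  have "\<kappa> * a \<le> A"
    if T: "\<forall>(U, u)\<in>T. openin X U" "\<Union>(fst ` T) = topspace X" and a: "a \<ge> 0"
      and le: "current_le \<R> (scale_current a \<omega>) T" and mass: "wedge_mass X \<R> \<omega> T A" for T a A
  proof -
    obtain \<mu> where \<mu>: "wedge_measure X \<R> \<omega> T \<mu>" "emeasure \<mu> (space \<mu>) = ennreal A" and A: "A \<ge> 0"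
      using mass by (auto simp: wedge_mass_def)
    define pre where "pre S = {x \<in> V0. \<psi> x \<in> S}" for S
    \<comment> \<open>The part of the chart over S lies in the domain of a single potential of T,
      which is what permits testing T over S.\<close>
    define good where "good S \<longleftrightarrow> (\<exists>(U', \<phi>)\<in>T. pre S \<subseteq> U')" for S
    have loc: "\<exists>s>0. good (ball z s)" if z: "z \<in> ball (\<psi> x0) r" for z
    proof -
      have "z \<in> \<psi> ` V0" using z r(2) by auto
      then obtain x where x: "x \<in> V0" "\<psi> x = z" by auto
      then have "x \<in> topspace X" using openin_subset[OF oV0] by auto
      then obtain U' \<phi> where U': "(U', \<phi>) \<in> T" "x \<in> U'" using T(2) by fastforce
      have "openin X (V0 \<inter> U')" using T(1) U' oV0 by auto
      then have "open (\<psi> ` (V0 \<inter> U'))" by (intro P(4)) auto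
      moreover have "z \<in> \<psi> ` (V0 \<inter> U')" using x U' by auto
      ultimately obtain s where s: "s > 0" "ball z s \<subseteq> \<psi> ` (V0 \<inter> U')" using open_contains_ball by metis
      have "pre (ball z s) \<subseteq> U'"
      proof
        fix y assume "y \<in> pre (ball z s)"
        then have y: "y \<in> V0" "\<psi> y \<in> \<psi> ` (V0 \<inter> U')" using s(2) by (auto simp: pre_def)
        then obtain t where "t \<in> V0 \<inter> U'" "\<psi> y = \<psi> t" by auto
        then show "y \<in> U'" using P(3) y(1) by (metis Int_iff inj_onD)
      qed
      then show ?thesis using s(1) U'(1) by (auto simp: good_def)
    qed
    have mono: "good S'" if "good S" "S' \<subseteq> S" for S S'
    proof -
      have "pre S' \<subseteq> pre S" using that(2) by (auto simp: pre_def)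
      then show ?thesis using that(1) unfolding good_def by (auto split: prod.splits intro: subset_trans)
    qed
    have "\<exists>C. finite C \<and> (\<forall>(x, s)\<in>C. 0 < s \<and> ball x s \<subseteq> ball (\<psi> x0) r \<and> good (ball x s)) \<and>
      disjoint_family_on (\<lambda>(x, s). ball x s) C \<and>
      measure lborel (cball (\<psi> x0) (r / 2)) / 20 ^ D \<le> (\<Sum>(x, s)\<in>C. measure lborel (ball x (s / 4)))"
      unfolding D_def
    proof (rule finite_disjoint_balls_volume[of r "\<psi> x0" good, OF r(1)])
      show "\<exists>s>0. good (ball x s)" if "x \<in> ball (\<psi> x0) r" for x by (rule loc[OF that])
      show "good S'" if "good S" "S' \<subseteq> S" for S S' by (rule mono[OF that])
    qed
    then obtain C where C: "finite C" "\<forall>(x, s)\<in>C. 0 < s \<and> ball x s \<subseteq> ball (\<psi> x0) r \<and> good (ball x s)"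
      "disjoint_family_on (\<lambda>(x, s). ball x s) C"
      "measure lborel (cball (\<psi> x0) (r / 2)) / 20 ^ D \<le> (\<Sum>(x, s)\<in>C. measure lborel (ball x (s / 4)))"
      by (elim exE conjE)
    have prechart: "(pre S, \<psi>) \<in> \<R>" if "open S" for S
      unfolding coord_maps by (rule coord_maps_restrict[OF c0 complex_space]) (use P(5)[OF that] in \<open>auto simp: pre_def\<close>)
    have pim: "\<psi> ` pre S = S" if "S \<subseteq> ball (\<psi> x0) r" for S
      using that r(2) by (force simp: pre_def)
    have sub: "ennreal (\<kappa>1 * a * measure lborel (ball x (s / 4))) \<le> emeasure \<mu> (pre (ball x s))" if xs: "(x, s) \<in> C" for x s
    proof -
      have s: "0 < s" "ball x s \<subseteq> ball (\<psi> x0) r" "good (ball x s)" using bspec[OF C(2) xs] by auto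
      obtain U' \<phi> where U': "(U', \<phi>) \<in> T" "pre (ball x s) \<subseteq> U'" using s(3) by (auto simp: good_def)
      have cb: "cball x (s / 2) \<subseteq> ball x s" using s(1) by auto
      let ?\<eta> = "ball_bump x (s / 2)"
      have off: "?\<eta> z = 0" if "z \<notin> cball x (s / 2)" for z using that s(1) by (intro ball_bump_eq_0) auto
      have supp: "compact_support_in (\<psi> ` pre (ball x s)) ?\<eta>"
        unfolding compact_support_in_def pim[OF s(2)]
        by (intro exI[of _ "cball x (s / 2)"]) (use cb off in auto)
      have preV: "pre (ball x s) \<subseteq> V0" by (auto simp: pre_def)
      \<comment> \<open>Restricting the chart changes the set on which \<open>inv_into\<close>
        inverts. Over the ball both inverses agree, and outside it the bump function
        vanishes.\<close>
      have "in_coord (pre (ball x s)) \<psi> \<rho> z = u z" if "z \<in> ball x s" for z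
      proof -
        have "z \<in> \<psi> ` pre (ball x s)" using that pim[OF s(2)] by simp
        then show ?thesis by (simp add: in_coord_def u_def inv_into_subset_eq[OF P(3) preV])
      qed
      then have ddceq: "ddc (in_coord (pre (ball x s)) \<psi> \<rho>) z = ddc u z" if "z \<in> ball x s" for z
        by (rule ddc_cong_open[OF open_ball that])
      have "(\<integral>z. real CARD('n) * ?\<eta> z * Re (det (ddc (in_coord (pre (ball x s)) \<psi> \<rho>) z)) \<partial>lborel)
          = (\<integral>z. real CARD('n) * (?\<eta> z * f z) \<partial>lborel)"
      proof (rule Bochner_Integration.integral_cong)
        fix z
        show "real CARD('n) * ?\<eta> z * Re (det (ddc (in_coord (pre (ball x s)) \<psi> \<rho>) z)) = real CARD('n) * (?\<eta> z * f z)"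
        proof (cases "z \<in> ball x s")
          case False
          then have "?\<eta> z = 0" using cb by (intro off) auto
          then show ?thesis by simp
        qed (simp add: f_def ddceq)
      qed simp
      also have "\<dots> = real CARD('n) * (\<integral>z. ?\<eta> z * f z \<partial>lborel)" by simp
      finally have i: "(\<integral>z. real CARD('n) * ?\<eta> z * Re (det (ddc (in_coord (pre (ball x s)) \<psi> \<rho>) z)) \<partial>lborel)
          = real CARD('n) * (\<integral>z. ?\<eta> z * f z \<partial>lborel)" .
      have ge: "exp (- (4 / 3)) * c * measure lborel (ball x (s / 4)) \<le> (\<integral>z. ?\<eta> z * f z \<partial>lborel)"
      proof (rule integral_ball_bump_ge[OF s(1) P(2) _ fsm])
        show "cball x (s / 2) \<subseteq> \<psi> ` V0" using cb s(2) r(2) by (meson ball_subset_cball subset_trans)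
        show "c \<le> f z" if "z \<in> cball x (s / 2)" for z
          unfolding c_def by (rule m(2)) (use that cb s(2) ball_subset_cball in blast)
      qed (use c in simp)
      have "\<kappa>1 * a * measure lborel (ball x (s / 4)) = ?C * (a * (real CARD('n) * (exp (- (4 / 3)) * c * measure lborel (ball x (s / 4)))))"
        by (simp add: \<kappa>1_def)
      also have "\<dots> \<le> ?C * (a * (real CARD('n) * (\<integral>z. ?\<eta> z * f z \<partial>lborel)))"
        using ge a by (intro mult_left_mono) auto
      finally have "ennreal (\<kappa>1 * a * measure lborel (ball x (s / 4))) \<le> ennreal (?C * (a * (real CARD('n) * (\<integral>z. ?\<eta> z * f z \<partial>lborel))))"
        by (rule ennreal_leI)
      also have "\<dots> \<le> emeasure \<mu> (pre (ball x s))"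
        unfolding i[symmetric]
        by (rule coord_measure_ge[OF prechart[OF open_ball] U(1) U'(1) _ le \<mu>(1) smooth_on_ball_bump supp ball_bump_nonneg ball_bump_le_1])
          (use U'(2) V0U preV in auto)
      finally show ?thesis .
    qed
    have meas: "pre S \<in> sets \<mu>" if "open S" for S
    proof -
      have "pre S \<subseteq> covered \<R>" using prechart[OF that] by (auto simp: covered_def)
      then have "pre S \<in> sets (borel_reg X (covered \<R>))"
        using P(5)[OF that] unfolding borel_reg_def pre_def by (subst sets_measure_of) auto
      then show ?thesis using \<mu>(1) by (simp add: wedge_measure_def)
    qed
    have "ennreal (\<kappa> * a) \<le> ennreal (\<Sum>(x, s)\<in>C. \<kappa>1 * a * measure lborel (ball x (s / 4)))"
    proof (rule ennreal_leI)
      have "\<kappa> * a = \<kappa>1 * a * (measure lborel (cball (\<psi> x0) (r / 2)) / 20 ^ D)" by (simp add: \<kappa>_def)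
      also have "\<dots> \<le> \<kappa>1 * a * (\<Sum>(x, s)\<in>C. measure lborel (ball x (s / 4)))"
        using C(4) \<kappa>1 a by (intro mult_left_mono) auto
      finally show "\<kappa> * a \<le> (\<Sum>(x, s)\<in>C. \<kappa>1 * a * measure lborel (ball x (s / 4)))"
        by (simp add: sum_distrib_left case_prod_unfold)
    qed
    also have "\<dots> = (\<Sum>(x, s)\<in>C. ennreal (\<kappa>1 * a * measure lborel (ball x (s / 4))))"
      unfolding case_prod_unfold using \<kappa>1 a by (intro sum_ennreal[symmetric]) auto
    also have "\<dots> \<le> (\<Sum>i\<in>C. emeasure \<mu> (pre (ball (fst i) (snd i))))"
      by (intro sum_mono) (use sub in \<open>auto simp: case_prod_unfold\<close>)
    \<comment> \<open>Preimages of disjoint balls are disjoint, so the local masses add up, without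
      overlap, to at most the total mass.\<close>
    also have "\<dots> = emeasure \<mu> (\<Union>i\<in>C. pre (ball (fst i) (snd i)))"
    proof (rule sum_emeasure)
      show "disjoint_family_on (\<lambda>i. pre (ball (fst i) (snd i))) C"
        using C(3) unfolding disjoint_family_on_def pre_def case_prod_unfold by blast
    qed (use C(1) meas in auto)
    also have "\<dots> \<le> emeasure \<mu> (space \<mu>)" by (rule emeasure_space)
    finally have "ennreal (\<kappa> * a) \<le> ennreal A" by (simp only: \<mu>(2))
    then show ?thesis using A by simp
  qed
  then show ?thesis using \<kappa> by blast
qed

text \<open>The constant of \<open>wedge_mass_lower_bound\<close> serves all curvature currents at
  once, so A_p \<ge> \<kappa> a_p inherits the divergence of a_p.\<close>

lemma (in line_bundle_sequence) degree_tendsto_infinity: "filterlim A at_top sequentially"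
proof -
  obtain \<kappa> where "\<kappa> > 0"
    and \<kappa>: "\<And>T a r. (\<forall>(U, u)\<in>T. openin X U) \<and> \<Union>(fst ` T) = topspace X \<and> a \<ge> 0 \<and>
      current_le \<R> (scale_current a \<omega>) T \<and> wedge_mass X \<R> \<omega> T r \<Longrightarrow> \<kappa> * a \<le> r"
    using wedge_mass_lower_bound by auto
  have "\<kappa> * a p \<le> A p" if p: "p \<ge> 1" for p
  proof (rule \<kappa>[of "curvature (I p) (U p) (\<phi> p)"], intro conjI)
    show "\<forall>(U, u)\<in>curvature (I p) (U p) (\<phi> p). openin X U"
      using line_bundles[OF p] by (auto simp: curvature_def line_bundle_def)
    show "\<Union>(fst ` curvature (I p) (U p) (\<phi> p)) = topspace X"
      using line_bundles[OF p] by (auto simp: curvature_def line_bundle_def image_image)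
    show "0 \<le> a p" using a_pos[OF p] by simp
  qed (rule curvature_ge[OF p] A_eq[OF p])+
  then have "\<forall>\<^sub>F p in sequentially. \<kappa> * a p \<le> A p" by (auto simp: eventually_at_top_linorder)
  moreover have "filterlim (\<lambda>p. \<kappa> * a p) at_top sequentially"
    using a_lim \<open>\<kappa> > 0\<close> by (intro filterlim_tendsto_pos_mult_at_top[OF tendsto_const])
  ultimately show ?thesis by (rule filterlim_at_top_mono[rotated])
qed

section \<open>Moments of the logarithm of a random linear form\<close>

lemma nn_integral_powr_le_of_tail:
  fixes Y :: "'a \<Rightarrow> real"
  assumes "prob_space Q" and Y[measurable]: "Y \<in> borel_measurable Q" and Y0: "\<And>x. 0 \<le> Y x"
    and R: "R > 0" and D: "D \<ge> 0" and \<nu>: "0 < \<nu>" "\<nu> < \<rho>"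
    and tail: "\<And>t. t \<ge> R \<Longrightarrow> emeasure Q {x \<in> space Q. Y x > t} \<le> ennreal (D * t powr (- \<rho>))"
  shows "(\<integral>\<^sup>+ x. ennreal (Y x powr \<nu>) \<partial>Q)
    \<le> ennreal (R powr \<nu> + D * 2 powr \<nu> * R powr (\<nu> - \<rho>) / (1 - 2 powr (\<nu> - \<rho>)))"
proof -
  interpret prob_space Q by fact
  \<comment> \<open>The ratio of the dyadic series: the weight at level k grows like 2^(k \<nu>),
    the tail decays like 2^(-k \<rho>). It is below 1 because \<nu> < \<rho>.\<close>
  define q where "q = 2 powr (\<nu> - \<rho>)"
  have q: "0 < q" "q < 1" using \<nu> by (auto simp: q_def powr_less_one)
  define E where "E k = {x \<in> space Q. Y x > 2 ^ k * R}" for k :: nat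
  have E[measurable]: "E k \<in> sets Q" for k unfolding E_def by measurable
  let ?b = "\<lambda>k::nat. (2 ^ Suc k * R) powr \<nu>"
  \<comment> \<open>A point also lies in all lower \<open>E k\<close>, so the sum overcounts, which
    an upper bound tolerates.\<close>
  have pt: "ennreal (Y x powr \<nu>) \<le> ennreal (R powr \<nu>) + (\<Sum>k. ennreal (?b k) * indicator (E k) x)" if x: "x \<in> space Q" for x
  proof (cases "Y x \<le> R")
    case True
    then have "ennreal (Y x powr \<nu>) \<le> ennreal (R powr \<nu>)"
      using \<nu> Y0 by (intro ennreal_leI powr_mono2) auto
    then show ?thesis by (rule order_trans) simp
  next
    case False
    obtain n where "Y x / R < 2 ^ n" using real_arch_pow[of 2 "Y x / R"] by auto
    then have ex: "Y x \<le> 2 ^ n * R" using R by (simp add: field_simps)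
    \<comment> \<open>Minimality of m, which is not 0 because Y x > R, puts Y x between 2^(m-1) R
      and 2^m R; hence level k = m - 1 with weight \<open>?b k\<close> suffices.\<close>
    define m where "m = (LEAST n. Y x \<le> 2 ^ n * R)"
    have m: "Y x \<le> 2 ^ m * R" unfolding m_def by (rule LeastI[of _ n]) (rule ex)
    have "m \<noteq> 0"
    proof
      assume "m = 0"
      then show False using m False by simp
    qed
    then obtain k where k: "m = Suc k" using not0_implies_Suc by blast
    have "\<not> Y x \<le> 2 ^ k * R" using not_less_Least[of k "\<lambda>n. Y x \<le> 2 ^ n * R"] k m_def by auto
    then have xE: "x \<in> E k" using x by (simp add: E_def)
    have "ennreal (Y x powr \<nu>) \<le> ennreal (?b k)"
      using m k \<nu> Y0 by (intro ennreal_leI powr_mono2) auto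
    also have "\<dots> = (\<Sum>i\<in>{k}. ennreal (?b i) * indicator (E i) x)" using xE by simp
    also have "\<dots> \<le> (\<Sum>k. ennreal (?b k) * indicator (E k) x)" by (rule sum_le_suminf) auto
    finally show ?thesis by (rule order_trans) simp
  qed
  have term_le: "ennreal (?b k) * emeasure Q (E k) \<le> ennreal (D * 2 powr \<nu> * R powr (\<nu> - \<rho>) * q ^ k)" for k
  proof -
    have "1 * R \<le> 2 ^ k * R" using R by (intro mult_right_mono) auto
    then have "emeasure Q (E k) \<le> ennreal (D * (2 ^ k * R) powr (- \<rho>))"
      unfolding E_def by (intro tail) simp
    then have "ennreal (?b k) * emeasure Q (E k) \<le> ennreal (?b k) * ennreal (D * (2 ^ k * R) powr (- \<rho>))"
      by (rule mult_left_mono) simp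
    also have "\<dots> = ennreal (?b k * (D * (2 ^ k * R) powr (- \<rho>)))" using D by (simp add: ennreal_mult)
    also have "?b k * (D * (2 ^ k * R) powr (- \<rho>)) = D * 2 powr \<nu> * R powr (\<nu> - \<rho>) * q ^ k"
    proof -
      have "?b k = 2 powr \<nu> * (2 ^ k * R) powr \<nu>" using R by (simp add: powr_mult[symmetric] mult.assoc)
      moreover have "(2 ^ k * R) powr \<nu> * (2 ^ k * R) powr (- \<rho>) = (2 ^ k * R) powr (\<nu> - \<rho>)"
        by (simp add: powr_add[symmetric])
      moreover have "(2 ^ k * R) powr (\<nu> - \<rho>) = q ^ k * R powr (\<nu> - \<rho>)"
        using R by (simp add: powr_mult q_def powr_realpow[symmetric] powr_powr mult.commute)
      ultimately show ?thesis by (simp add: mult_ac)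
    qed
    finally show ?thesis .
  qed
  have "(\<integral>\<^sup>+ x. ennreal (Y x powr \<nu>) \<partial>Q) \<le> (\<integral>\<^sup>+ x. ennreal (R powr \<nu>) + (\<Sum>k. ennreal (?b k) * indicator (E k) x) \<partial>Q)"
    by (intro nn_integral_mono pt)
  also have "\<dots> = ennreal (R powr \<nu>) + (\<Sum>k. ennreal (?b k) * emeasure Q (E k))"
    by (subst nn_integral_add) (auto simp: nn_integral_suminf nn_integral_cmult emeasure_space_1)
  also have "(\<Sum>k. ennreal (?b k) * emeasure Q (E k)) \<le> (\<Sum>k. ennreal (D * 2 powr \<nu> * R powr (\<nu> - \<rho>) * q ^ k))"
    by (rule suminf_le[OF term_le]) auto
  also have "\<dots> = ennreal (\<Sum>k. D * 2 powr \<nu> * R powr (\<nu> - \<rho>) * q ^ k)"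
    using D q by (intro suminf_ennreal2 summable_mult summable_geometric) auto
  also have "(\<Sum>k. D * 2 powr \<nu> * R powr (\<nu> - \<rho>) * q ^ k) = D * 2 powr \<nu> * R powr (\<nu> - \<rho>) / (1 - q)"
    using q by (simp add: suminf_mult suminf_geometric summable_geometric)
  finally have "(\<integral>\<^sup>+ x. ennreal (Y x powr \<nu>) \<partial>Q)
      \<le> ennreal (R powr \<nu>) + ennreal (D * 2 powr \<nu> * R powr (\<nu> - \<rho>) / (1 - q))"
    by (simp add: add_left_mono)
  also have "\<dots> = ennreal (R powr \<nu> + D * 2 powr \<nu> * R powr (\<nu> - \<rho>) / (1 - q))"
    using D q by (intro ennreal_plus[symmetric]) auto
  finally show ?thesis by (simp add: q_def)
qed

section \<open>Tails of the modulus of a random linear form\<close>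

lemma law_ball_le:
  assumes dens: "dens \<in> borel_measurable borel" "\<And>z. 0 \<le> dens z" "\<And>z. dens z \<le> M" and "0 \<le> r"
  shows "emeasure (law dens) (ball w r) \<le> ennreal (M * (pi * r\<^sup>2))"
proof -
  have M: "M \<ge> 0" using dens(2,3) order_trans by blast
  have "emeasure (law dens) (ball w r) = (\<integral>\<^sup>+ z. ennreal (dens z) * indicator (ball w r) z \<partial>lborel)"
    using dens(1) by (subst emeasure_density) auto
  also have "\<dots> \<le> (\<integral>\<^sup>+ z. ennreal M * indicator (ball w r) z \<partial>lborel)"
    by (intro nn_integral_mono mult_right_mono ennreal_leI dens(3)) auto
  also have "\<dots> = ennreal M * emeasure lborel (ball w r)" by (rule nn_integral_cmult_indicator) simp
  also have "\<dots> = ennreal (M * (pi * r\<^sup>2))"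
    using M assms(4) by (simp add: emeasure_ball unit_ball_vol_2 ennreal_mult)
  finally show ?thesis .
qed

context
  fixes M c \<rho> :: real and dens :: "complex \<Rightarrow> real" and d :: nat and u :: "nat \<Rightarrow> complex"
  assumes adm: "admissible_density M c \<rho> dens" and unit: "unit_vector d u"
begin

interpretation P: product_prob_space "\<lambda>_::nat. law dens" "{1..d}"
  by (rule product_prob_spaceI) (use adm in \<open>simp add: admissible_density_def\<close>)

lemma linear_form_measurable [measurable]:
  "(\<lambda>a. \<Sum>j=1..d. a j * u j) \<in> borel_measurable (coeff_measure dens d)"
proof -
  have "(\<lambda>a. a j) \<in> borel_measurable (coeff_measure dens d)" if "j \<in> {1..d}" for j
  proof -
    have "(\<lambda>a. a j) \<in> measurable (coeff_measure dens d) (law dens)"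
      unfolding coeff_measure_def using that by (rule measurable_component_singleton)
    then show ?thesis by (simp cong: measurable_cong_sets)
  qed
  then show ?thesis by (intro borel_measurable_sum borel_measurable_times) auto
qed

lemma upper_tail:
  assumes "s \<ge> 1"
  shows "emeasure (coeff_measure dens d) {a \<in> space (coeff_measure dens d). cmod (\<Sum>j=1..d. a j * u j) > sqrt d * exp s}
    \<le> ennreal (real d * (c / s powr \<rho>))"
proof -
  let ?Q = "coeff_measure dens d"
  let ?A = "\<lambda>j. {a \<in> space ?Q. a j \<in> {z. ln (cmod z) > s}}"
  have Am: "{z::complex. ln (cmod z) > s} \<in> sets borel" by measurable
  have eA: "emeasure ?Q (?A j) \<le> ennreal (c / s powr \<rho>)" "?A j \<in> sets ?Q" if j: "j \<in> {1..d}" for j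
  proof -
    have "emeasure ?Q (?A j) = emeasure (law dens) {z. ln (cmod z) > s}"
      unfolding coeff_measure_def by (rule P.emeasure_PiM_Collect_single[OF j]) (use Am in simp)
    also have "\<dots> = ennreal (measure (law dens) {z. ln (cmod z) > s})"
      by (rule P.M.emeasure_eq_measure)
    also have "\<dots> \<le> ennreal (c / s powr \<rho>)"
      using adm assms by (intro ennreal_leI) (auto simp: admissible_density_def)
    finally show "emeasure ?Q (?A j) \<le> ennreal (c / s powr \<rho>)" .
    show "?A j \<in> sets ?Q"
      unfolding coeff_measure_def
      using measurable_sets[OF measurable_component_singleton[OF j, of "\<lambda>_. law dens"], of "{z. ln (cmod z) > s}"] Am
      by (simp add: vimage_def Int_def conj_commute)
  qed
  have "{a \<in> space ?Q. cmod (\<Sum>j=1..d. a j * u j) > sqrt d * exp s} \<subseteq> (\<Union>j\<in>{1..d}. ?A j)"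
  proof (intro subsetI, rule ccontr)
    fix a assume a: "a \<in> {a \<in> space ?Q. cmod (\<Sum>j=1..d. a j * u j) > sqrt d * exp s}"
      and n: "a \<notin> (\<Union>j\<in>{1..d}. ?A j)"
    have aj: "cmod (a j) \<le> exp s" if "j \<in> {1..d}" for j
    proof (cases "a j = 0")
      case False
      have "ln (cmod (a j)) \<le> s" using n a that by fastforce
      then show ?thesis using False by (simp add: ln_le_cancel_iff[symmetric] del: ln_le_cancel_iff)
    qed simp
    \<comment> \<open>Cauchy-Schwarz against the unit vector u leaves the norm of a; d coordinates
      of modulus at most exp s give the factor \<open>sqrt d\<close> of the event.\<close>
    have "cmod (\<Sum>j=1..d. a j * u j) \<le> (\<Sum>j=1..d. \<bar>cmod (a j)\<bar> * \<bar>cmod (u j)\<bar>)"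
      by (rule order_trans[OF norm_sum]) (simp add: norm_mult)
    also have "\<dots> \<le> L2_set (\<lambda>j. cmod (a j)) {1..d} * L2_set (\<lambda>j. cmod (u j)) {1..d}"
      by (rule L2_set_mult_ineq)
    also have "L2_set (\<lambda>j. cmod (u j)) {1..d} = 1" using unit by (simp add: L2_set_def unit_vector_def)
    also have "L2_set (\<lambda>j. cmod (a j)) {1..d} \<le> sqrt (\<Sum>j=1..d. (exp s)\<^sup>2)"
      unfolding L2_set_def by (intro real_sqrt_le_mono sum_mono power_mono aj) auto
    also have "sqrt (\<Sum>j=1..d. (exp s)\<^sup>2) = sqrt d * exp s" by (simp add: real_sqrt_mult)
    finally show False using a by simp
  qed
  then have "emeasure ?Q {a \<in> space ?Q. cmod (\<Sum>j=1..d. a j * u j) > sqrt d * exp s} \<le> emeasure ?Q (\<Union>j\<in>{1..d}. ?A j)"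
    by (rule emeasure_mono) (use eA(2) in \<open>auto intro!: sets.finite_UN\<close>)
  also have "\<dots> \<le> (\<Sum>j\<in>{1..d}. emeasure ?Q (?A j))"
    by (rule emeasure_subadditive_finite) (use eA(2) in auto)
  also have "\<dots> \<le> (\<Sum>j\<in>{1..d}. ennreal (c / s powr \<rho>))" by (intro sum_mono eA(1))
  also have "\<dots> = ennreal (real d * (c / s powr \<rho>))" by (simp add: ennreal_mult'[symmetric] ennreal_of_nat_eq_real_of_nat)
  finally show ?thesis .
qed

lemma lower_tail:
  assumes "r > 0"
  shows "emeasure (coeff_measure dens d) {a \<in> space (coeff_measure dens d). cmod (\<Sum>j=1..d. a j * u j) < r}
    \<le> ennreal (M * (pi * (real d * r\<^sup>2)))"
proof -
  let ?Q = "coeff_measure dens d"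
  have M: "M \<ge> 0" using adm by (meson admissible_density_def order_trans)
  have dens: "dens \<in> borel_measurable borel" "\<And>z. 0 \<le> dens z" "\<And>z. dens z \<le> M"
    using adm by (auto simp: admissible_density_def)
  have "\<exists>k\<in>{1..d}. 1 / real d \<le> (cmod (u k))\<^sup>2"
  proof (rule ccontr)
    assume n: "\<not> ?thesis"
    have "d \<noteq> 0" using unit by (cases d) (auto simp: unit_vector_def)
    then have "(\<Sum>j=1..d. (cmod (u j))\<^sup>2) < (\<Sum>j=1..d. 1 / real d)"
      using n by (intro sum_strict_mono) (auto simp: not_le)
    then show False using unit \<open>d \<noteq> 0\<close> by (simp add: unit_vector_def)
  qed
  then obtain k where k: "k \<in> {1..d}" "1 / real d \<le> (cmod (u k))\<^sup>2" by blast
  have d: "real d > 0" using k(1) by simp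
  have "0 < 1 / real d" using d by simp
  then have uk: "u k \<noteq> 0" using k(2) by auto
  define J where "J = {1..d} - {k}"
  have J: "{1..d} = insert k J" "finite J" "k \<notin> J" using k(1) by (auto simp: J_def)
  let ?S = "{a \<in> space ?Q. cmod (\<Sum>j=1..d. a j * u j) < r}"
  have S: "?S \<in> sets ?Q" by measurable
  have Qeq: "?Q = Pi\<^sub>M (insert k J) (\<lambda>_. law dens)" by (simp only: coeff_measure_def J(1))
  interpret J: prob_space "Pi\<^sub>M J (\<lambda>_. law dens)"
    by (rule prob_space_PiM) (use adm in \<open>simp add: admissible_density_def\<close>)
  have inner: "(\<integral>\<^sup>+ y. indicator ?S (x(k := y)) \<partial>law dens) \<le> ennreal (M * (pi * (real d * r\<^sup>2)))" for x
  proof -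
    \<comment> \<open>The part of the form that x freezes. In the remaining variable the event lies
      in a disc whose centre depends on x but whose radius does not, so the estimate survives
      integration over x.\<close>
    define w where "w = (\<Sum>j\<in>J. x j * u j)"
    have "(\<integral>\<^sup>+ y. indicator ?S (x(k := y)) \<partial>law dens) \<le> (\<integral>\<^sup>+ y. indicator (ball (- w / u k) (r / cmod (u k))) y \<partial>law dens)"
    proof (intro nn_integral_mono)
      fix y
      show "indicator ?S (x(k := y)) \<le> (indicator (ball (- w / u k) (r / cmod (u k))) y :: ennreal)"
      proof (cases "x(k := y) \<in> ?S")
        case True
        have "(\<Sum>j=1..d. (x(k := y)) j * u j) = y * u k + (\<Sum>j\<in>J. (x(k := y)) j * u j)"
          unfolding J(1) using J(2,3) by (subst sum.insert) auto
        also have "(\<Sum>j\<in>J. (x(k := y)) j * u j) = w"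
          unfolding w_def by (rule sum.cong) (use J(3) in auto)
        finally have "cmod (y * u k + w) < r" using True by simp
        moreover have "y * u k + w = (y - (- w / u k)) * u k" using uk by (simp add: field_simps)
        ultimately have "cmod (y - (- w / u k)) * cmod (u k) < r" by (simp only: norm_mult)
        then have "y \<in> ball (- w / u k) (r / cmod (u k))"
          using uk by (simp add: dist_norm norm_minus_commute pos_less_divide_eq)
        then show ?thesis by (simp add: indicator_def)
      qed simp
    qed
    also have "\<dots> = emeasure (law dens) (ball (- w / u k) (r / cmod (u k)))" by simp
    also have "\<dots> \<le> ennreal (M * (pi * (r / cmod (u k))\<^sup>2))"
      by (rule law_ball_le[OF dens]) (use assms in simp)
    also have "\<dots> \<le> ennreal (M * (pi * (real d * r\<^sup>2)))"
    proof (intro ennreal_leI mult_left_mono M)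
      have "1 \<le> real d * (cmod (u k))\<^sup>2" using k(2) d by (simp add: field_simps)
      then have "r\<^sup>2 * 1 \<le> r\<^sup>2 * (real d * (cmod (u k))\<^sup>2)" by (intro mult_left_mono) auto
      then show "(r / cmod (u k))\<^sup>2 \<le> real d * r\<^sup>2"
        using uk by (simp add: power_divide pos_divide_le_eq mult_ac)
    qed simp
    finally show ?thesis .
  qed
  have "emeasure ?Q ?S = (\<integral>\<^sup>+ a. indicator ?S a \<partial>?Q)" using S by simp
  also have "\<dots> = (\<integral>\<^sup>+ x. (\<integral>\<^sup>+ y. indicator ?S (x(k := y)) \<partial>law dens) \<partial>Pi\<^sub>M J (\<lambda>_. law dens))"
    unfolding Qeq by (rule P.product_nn_integral_insert[OF J(2,3)]) (use S Qeq in auto)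
  also have "\<dots> \<le> (\<integral>\<^sup>+ x. ennreal (M * (pi * (real d * r\<^sup>2))) \<partial>Pi\<^sub>M J (\<lambda>_. law dens))"
    by (intro nn_integral_mono inner)
  also have "\<dots> = ennreal (M * (pi * (real d * r\<^sup>2)))" by (simp add: J.emeasure_space_1)
  finally show ?thesis .
qed

text \<open>t \<ge> 2 makes s = t/2 admissible in \<open>upper_tail\<close>, whence the factor
  2^\<rho>; the other half of t pays for \<open>sqrt d\<close>, as ln d \<le> t gives sqrt d \<le>
  exp(t/2).\<close>

lemma log_tail:
  assumes "c > 0" "\<rho> > 0" and t: "t \<ge> 2" "ln (real d) \<le> t"
  shows "emeasure (coeff_measure dens d)
      {a \<in> space (coeff_measure dens d). \<bar>ln (cmod (\<Sum>j=1..d. a j * u j))\<bar> > t}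
    \<le> ennreal (real d * (c * 2 powr \<rho> + M * pi * \<rho> powr \<rho>) * t powr (- \<rho>))"
proof -
  let ?Q = "coeff_measure dens d"
  let ?L = "\<lambda>a. \<Sum>j=1..d. a j * u j"
  have M: "M \<ge> 0" using adm by (meson admissible_density_def order_trans)
  have d: "real d > 0" using unit by (cases d) (auto simp: unit_vector_def)
  let ?A = "{a \<in> space ?Q. cmod (?L a) > sqrt d * exp (t / 2)}"
  let ?B = "{a \<in> space ?Q. cmod (?L a) < exp (- t)}"
  have sd: "sqrt d * exp (t / 2) \<le> exp t"
  proof -
    have "sqrt d = exp (ln (real d) / 2)" using d by (simp add: ln_sqrt[symmetric])
    also have "\<dots> \<le> exp (t / 2)" using t by simp
    finally have "sqrt d * exp (t / 2) \<le> exp (t / 2) * exp (t / 2)" by (intro mult_right_mono) auto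
    then show ?thesis by (simp add: exp_add[symmetric])
  qed
  have sub: "{a \<in> space ?Q. \<bar>ln (cmod (?L a))\<bar> > t} \<subseteq> ?A \<union> ?B"
  proof
    fix a assume a: "a \<in> {a \<in> space ?Q. \<bar>ln (cmod (?L a))\<bar> > t}"
    \<comment> \<open>With \<open>ln 0 = 0\<close> a zero of the form is not in the event, since t >
      0.\<close>
    have "?L a \<noteq> 0" using a t by auto
    then have e: "cmod (?L a) = exp (ln (cmod (?L a)))" by simp
    consider "ln (cmod (?L a)) > t" | "ln (cmod (?L a)) < - t" using a by fastforce
    then show "a \<in> ?A \<union> ?B"
    proof cases
      case 1
      then have "exp t < cmod (?L a)" by (subst e) simp
      then show ?thesis using sd a by simp
    next
      case 2
      then have "cmod (?L a) < exp (- t)" by (subst e) simp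
      then show ?thesis using a by simp
    qed
  qed
  have m: "?A \<in> sets ?Q" "?B \<in> sets ?Q" by (measurable, measurable)
  have "emeasure ?Q {a \<in> space ?Q. \<bar>ln (cmod (?L a))\<bar> > t} \<le> emeasure ?Q (?A \<union> ?B)"
    by (rule emeasure_mono[OF sub sets.Un[OF m]])
  also have "\<dots> \<le> emeasure ?Q ?A + emeasure ?Q ?B" by (rule emeasure_subadditive[OF m])
  also have "\<dots> \<le> ennreal (real d * (c / (t / 2) powr \<rho>)) + ennreal (M * (pi * (real d * (exp (- t))\<^sup>2)))"
    by (intro add_mono upper_tail lower_tail) (use t in auto)
  also have "\<dots> = ennreal (real d * (c / (t / 2) powr \<rho>) + M * (pi * (real d * (exp (- t))\<^sup>2)))"
    using assms M by (intro ennreal_plus[symmetric]) auto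
  also have "\<dots> \<le> ennreal (real d * (c * 2 powr \<rho> + M * pi * \<rho> powr \<rho>) * t powr (- \<rho>))"
  proof (rule ennreal_leI)
    have "(t / 2) powr \<rho> = t powr \<rho> / 2 powr \<rho>" by (rule powr_divide)
    then have "c / (t / 2) powr \<rho> = c * 2 powr \<rho> * t powr (- \<rho>)" by (simp add: powr_minus_divide)
    moreover have "(exp (- t))\<^sup>2 \<le> \<rho> powr \<rho> * t powr (- \<rho>)"
    proof -
      \<comment> \<open>Already exp(-t) is at most \<rho>^\<rho> t^(-\<rho>): this is ln y \<le> y -
        1 at y = t/\<rho>, multiplied by \<rho>.\<close>
      have "ln (t / \<rho>) \<le> t / \<rho> - 1" using t assms by (intro ln_le_minus_one) auto
      then have "ln t - ln \<rho> \<le> t / \<rho>" using t assms by (simp add: ln_div)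
      then have "\<rho> * (ln t - ln \<rho>) \<le> \<rho> * (t / \<rho>)" using assms by (intro mult_left_mono) auto
      then have "- (2 * t) \<le> \<rho> * ln \<rho> - \<rho> * ln t" using assms t by (simp add: algebra_simps)
      then have "exp (- (2 * t)) \<le> exp (\<rho> * ln \<rho> - \<rho> * ln t)" by simp
      also have "\<dots> = \<rho> powr \<rho> * t powr (- \<rho>)" using assms t by (simp add: powr_def exp_add[symmetric])
      finally show ?thesis by (simp add: power2_eq_square exp_add[symmetric])
    qed
    then have "M * (pi * (real d * (exp (- t))\<^sup>2)) \<le> M * (pi * (real d * (\<rho> powr \<rho> * t powr (- \<rho>))))"
      using M by (intro mult_left_mono) auto
    ultimately show "real d * (c / (t / 2) powr \<rho>) + M * (pi * (real d * (exp (- t))\<^sup>2))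
        \<le> real d * (c * 2 powr \<rho> + M * pi * \<rho> powr \<rho>) * t powr (- \<rho>)"
      by (simp add: algebra_simps)
  qed
  finally show ?thesis .
qed

lemma log_moment_le:
  assumes "c > 0" "0 < \<nu>" "\<nu> < \<rho>"
  shows "log_moment dens d \<nu> u \<le> ennreal (((2 + \<rho>) powr \<nu>
    + (c * 2 powr \<rho> + M * pi * \<rho> powr \<rho>) * 2 powr \<nu> * (2 + \<rho>) powr (\<nu> - \<rho>) / (1 - 2 powr (\<nu> - \<rho>)))
    * real d powr (\<nu> / \<rho>))"
proof -
  have M: "M \<ge> 0" using adm by (meson admissible_density_def order_trans)
  have \<rho>: "\<rho> > 0" using assms by linarith
  have d: "real d \<ge> 1" using unit by (cases d) (auto simp: unit_vector_def)
  let ?K = "c * 2 powr \<rho> + M * pi * \<rho> powr \<rho>"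
  have K: "?K \<ge> 0" using assms M by auto
  define x where "x = real d powr (1 / \<rho>)"
  have x: "x \<ge> 1" using d \<rho> by (simp add: x_def ge_one_powr_ge_zero)
  \<comment> \<open>Of the factor 2 + \<rho>, the 2 secures R \<ge> 2 and the \<rho> secures ln d =
    \<rho> ln x \<le> \<rho> x \<le> R; these are the two requirements of
    \<open>log_tail\<close>.\<close>
  let ?R = "(2 + \<rho>) * x"
  have R2: "?R \<ge> 2" using mult_mono[of 2 "2 + \<rho>" 1 x] x \<rho> by simp
  have "ln x \<le> x" using ln_le_minus_one[of x] x by linarith
  then have "\<rho> * ln x \<le> \<rho> * x" using \<rho> by (intro mult_left_mono) auto
  moreover have "\<rho> * ln x = ln (real d)" using \<rho> d by (simp add: x_def ln_powr)
  ultimately have lnR: "ln (real d) \<le> ?R" using x by (simp add: algebra_simps)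
  have prob: "prob_space (coeff_measure dens d)"
    unfolding coeff_measure_def by (rule prob_space_PiM) (use adm in \<open>simp add: admissible_density_def\<close>)
  have "log_moment dens d \<nu> u \<le> ennreal (?R powr \<nu> + (real d * ?K) * 2 powr \<nu> * ?R powr (\<nu> - \<rho>) / (1 - 2 powr (\<nu> - \<rho>)))"
    unfolding log_moment_def
  proof (rule nn_integral_powr_le_of_tail[OF prob])
    show "?R > 0" using R2 by linarith
    show "0 \<le> real d * ?K" using K by simp
    show "emeasure (coeff_measure dens d)
      {a \<in> space (coeff_measure dens d). \<bar>ln (cmod (\<Sum>j=1..d. a j * u j))\<bar> > t} \<le> ennreal (real d * ?K * t powr (- \<rho>))"
      if "t \<ge> ?R" for t
      by (rule log_tail) (use assms \<rho> that R2 lnR in auto)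
    show "(\<lambda>a. \<bar>ln (cmod (\<Sum>j=1..d. a j * u j))\<bar>) \<in> borel_measurable (coeff_measure dens d)" by measurable
  qed (use assms in auto)
  also have "?R powr \<nu> + (real d * ?K) * 2 powr \<nu> * ?R powr (\<nu> - \<rho>) / (1 - 2 powr (\<nu> - \<rho>))
    = ((2 + \<rho>) powr \<nu> + ?K * 2 powr \<nu> * (2 + \<rho>) powr (\<nu> - \<rho>) / (1 - 2 powr (\<nu> - \<rho>))) * real d powr (\<nu> / \<rho>)"
  proof -
    have 1: "?R powr b = (2 + \<rho>) powr b * x powr b" for b using x \<rho> by (simp add: powr_mult)
    have 2: "x powr \<nu> = real d powr (\<nu> / \<rho>)" by (simp add: x_def powr_powr)
    \<comment> \<open>The power of R in the tail sum turns the factor d into d^(\<nu>/\<rho>), the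
      order of the trivial part R^\<nu>. This balance dictates the exponent 1/\<rho> in x.\<close>
    have 3: "real d * x powr (\<nu> - \<rho>) = real d powr (\<nu> / \<rho>)"
    proof -
      have "real d * x powr (\<nu> - \<rho>) = real d powr 1 * real d powr ((\<nu> - \<rho>) / \<rho>)" using d by (simp add: x_def powr_powr)
      also have "\<dots> = real d powr (1 + (\<nu> - \<rho>) / \<rho>)" by (rule powr_add[symmetric])
      also have "1 + (\<nu> - \<rho>) / \<rho> = \<nu> / \<rho>" using \<rho> by (simp add: field_simps)
      finally show ?thesis .
    qed
    have T: "(real d * ?K) * 2 powr \<nu> * ?R powr (\<nu> - \<rho>) / (1 - 2 powr (\<nu> - \<rho>))
      = ?K * 2 powr \<nu> * (2 + \<rho>) powr (\<nu> - \<rho>) / (1 - 2 powr (\<nu> - \<rho>)) * (real d * x powr (\<nu> - \<rho>))"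
      unfolding 1 by (simp add: mult_ac)
    show ?thesis unfolding T 3 unfolding 1 2 by (rule distrib_right[symmetric])
  qed
  finally show ?thesis .
qed

end

section \<open>Asymptotics of the constants\<close>

lemma powr_asymptotics:
  fixes A :: "nat \<Rightarrow> real" and d :: "nat \<Rightarrow> nat"
  assumes A: "filterlim A at_top sequentially" and dO: "(\<lambda>p. real (d p)) \<in> O(\<lambda>p. A p ^ N)"
    and "0 < \<nu>" "0 < \<rho>" "real N < \<rho>"
  shows "(\<lambda>p. \<Gamma> * real (d p) powr (\<nu> / \<rho>)) \<in> O(\<lambda>p. A p powr (real N * \<nu> / \<rho>))"
    and "(\<lambda>p. A p powr (real N * \<nu> / \<rho>)) \<in> o(\<lambda>p. A p powr \<nu>)"
    and "(\<lambda>p. \<Gamma> * real (d p) powr (\<nu> / \<rho>)) \<in> o(\<lambda>p. A p powr \<nu>)"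
proof -
  obtain C where C: "C > 0" "\<forall>\<^sub>F p in sequentially. norm (real (d p)) \<le> C * norm (A p ^ N)"
    using dO by (elim landau_o.bigE)
  \<comment> \<open>Replacing \<open>A p ^ N\<close> by a real power needs A p > 0, which holds
    eventually.\<close>
  have pos: "\<forall>\<^sub>F p in sequentially. A p > 0" using A by (simp add: filterlim_at_top_dense)
  have "\<forall>\<^sub>F p in sequentially. norm (\<Gamma> * real (d p) powr (\<nu> / \<rho>))
      \<le> (\<bar>\<Gamma>\<bar> * C powr (\<nu> / \<rho>)) * norm (A p powr (real N * \<nu> / \<rho>))"
    using C(2) pos
  proof eventually_elim
    case (elim p)
    have "real (d p) powr (\<nu> / \<rho>) \<le> (C * A p powr real N) powr (\<nu> / \<rho>)"
      using elim assms by (intro powr_mono2) (auto simp: powr_realpow)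
    also have "\<dots> = C powr (\<nu> / \<rho>) * A p powr (real N * \<nu> / \<rho>)"
      using C(1) elim by (simp add: powr_mult powr_powr)
    finally show ?case by (simp add: abs_mult mult.assoc mult_left_mono)
  qed
  then show O: "(\<lambda>p. \<Gamma> * real (d p) powr (\<nu> / \<rho>)) \<in> O(\<lambda>p. A p powr (real N * \<nu> / \<rho>))" by (rule bigoI)
  \<comment> \<open>N < \<rho> makes the exponent strictly smaller, which for A tending to infinity
    means little-o.\<close>
  have "real N * \<nu> / \<rho> < \<nu>" using assms by (simp add: field_simps)
  then show o: "(\<lambda>p. A p powr (real N * \<nu> / \<rho>)) \<in> o(\<lambda>p. A p powr \<nu>)"
    using powr_smallo_iff[OF A] by simp
  show "(\<lambda>p. \<Gamma> * real (d p) powr (\<nu> / \<rho>)) \<in> o(\<lambda>p. A p powr \<nu>)"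
    by (rule landau_o.big_small_trans[OF O o])
qed

theorem lemma4p15:
  fixes M c \<rho> \<nu> :: real
  assumes "c > 0" and "\<rho> > 1" and "1 \<le> \<nu>" and "\<nu> < \<rho>"
  shows "\<exists>\<Gamma>>0. \<forall>dens. admissible_density M c \<rho> dens \<longrightarrow>
    (\<forall>d u. unit_vector d u \<longrightarrow> log_moment dens d \<nu> u \<le> ennreal (\<Gamma> * real d powr (\<nu> / \<rho>))) \<and>
    (\<forall>(X :: 'a topology) (\<A> :: ('a, 'm::finite) atlas) (\<R> :: ('a, 'n::finite) atlas) \<omega> vol
       (I :: nat \<Rightarrow> 'i set) U g \<phi> a A d (\<Omega> :: 'w measure) Z.
       line_bundle_sequence X \<A> \<R> \<omega> vol I U g \<phi> a A d \<and> iid_array \<Omega> Z d dens \<longrightarrow>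
       (\<forall>p\<ge>1. \<forall>u. unit_vector (d p) u \<longrightarrow>
          log_moment dens (d p) \<nu> u \<le> ennreal (\<Gamma> * real (d p) powr (\<nu> / \<rho>))) \<and>
       (\<forall>N::nat. (\<lambda>p. real (d p)) \<in> O(\<lambda>p. A p ^ N) \<and> \<rho> > real N \<longrightarrow>
          (\<lambda>p. \<Gamma> * real (d p) powr (\<nu> / \<rho>)) \<in> O(\<lambda>p. A p powr (real N * \<nu> / \<rho>)) \<and>
          (\<lambda>p. A p powr (real N * \<nu> / \<rho>)) \<in> o(\<lambda>p. A p powr \<nu>) \<and>
          (\<lambda>p. \<Gamma> * real (d p) powr (\<nu> / \<rho>)) \<in> o(\<lambda>p. A p powr \<nu>)))"
proof -
  \<comment> \<open>The constant must be fixed, and be positive, before any density is given, hence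
    \<open>\<bar>M\<bar>\<close>. An admissible density forces M \<ge> 0, and then it is the
    constant of \<open>log_moment_le\<close>.\<close>
  define \<Gamma> where "\<Gamma> = (2 + \<rho>) powr \<nu>
    + (c * 2 powr \<rho> + \<bar>M\<bar> * pi * \<rho> powr \<rho>) * 2 powr \<nu> * (2 + \<rho>) powr (\<nu> - \<rho>) / (1 - 2 powr (\<nu> - \<rho>))"
  have "2 powr (\<nu> - \<rho>) < 1" using assms by (simp add: powr_less_one)
  then have \<Gamma>: "\<Gamma> > 0"
    unfolding \<Gamma>_def using assms by (intro add_pos_nonneg divide_nonneg_nonneg mult_nonneg_nonneg add_nonneg_nonneg) auto
  have bound: "log_moment dens d \<nu> u \<le> ennreal (\<Gamma> * real d powr (\<nu> / \<rho>))"
    if adm: "admissible_density M c \<rho> dens" and u: "unit_vector d u" for dens d u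
  proof -
    have "M \<ge> 0" using adm by (meson admissible_density_def order_trans)
    then show ?thesis using log_moment_le[OF adm u, of \<nu>] assms by (simp add: \<Gamma>_def)
  qed
  have asymp: "(\<lambda>p. \<Gamma> * real (d p) powr (\<nu> / \<rho>)) \<in> O(\<lambda>p. A p powr (real N * \<nu> / \<rho>)) \<and>
      (\<lambda>p. A p powr (real N * \<nu> / \<rho>)) \<in> o(\<lambda>p. A p powr \<nu>) \<and>
      (\<lambda>p. \<Gamma> * real (d p) powr (\<nu> / \<rho>)) \<in> o(\<lambda>p. A p powr \<nu>)"
    if "line_bundle_sequence X \<A> \<R> \<omega> vol I U g \<phi> a A d" and "(\<lambda>p. real (d p)) \<in> O(\<lambda>p. A p ^ N)" and "\<rho> > real N"
    for X :: "'a topology" and \<A> :: "('a, 'm) atlas" and \<R> :: "('a, 'n) atlas" and \<omega> vol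
      and I :: "nat \<Rightarrow> 'i set" and U g \<phi> a A d and N :: nat
    using powr_asymptotics[OF line_bundle_sequence.degree_tendsto_infinity[OF that(1)] that(2) _ _ that(3)] assms by simp
  show ?thesis
    by (intro exI[of _ \<Gamma>] conjI[OF \<Gamma>] allI impI conjI) (use bound asymp in blast)+
qed

end
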